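(* Let $n\ge1$, $d>0$ and $V_1,V_2\in C^\infty(\mathbb{T}^n)$. Given $H:\mathbb{R}^n\to\mathbb{R}$ as specified in each part, let $\overline H_{di}$ ($i=1,2$) be the viscous effective Hamiltonian associated with $H(p)+V_i(x)$ and diffusion constant $d$. (1) Suppose that $H\in C^2(\mathbb{R}^n)$, $\sup_{\mathbb{R}^n}\|D^2H\|<+\infty$ and $H$ is superlinear. Then for $i=1,2$ and any vector $Q\in\mathbb{R}^n$ satisfying a Diophantine condition, $$\int_{\mathbb{T}^n}V_i\,dx=\lim_{\lambda\to+\infty}\left(\overline H_{di}(\lambda P_\lambda)-H(\lambda P_\lambda)\right),$$ where $P_\lambda\in\mathbb{R}^n$ is chosen such that $DH(\lambda P_\lambda)=\lambda Q$. In particular, $$\overline H_{d1}\equiv\overline H_{d2}\ \Longrightarrow\ \int_{\mathbb{T}^n}V_1\,dx=\int_{\mathbb{T}^n}V_2\,dx.$$ (2) Let $H(p)=|p|^2$. If there exists $\tau>0$ such that the Fourier coefficients $\{\lambda_{ki}\}_{k\in\mathbb{Z}^n}$ of $V_i$ satisfy $$\sum_{k\in\mathbb{Z}^n}\left(|\lambda_{k1}|^2+|\lambda_{k2}|^2\right)e^{|k|^{n+\tau}}<+\infty,$$ then $$\overline H_{d1}\equiv\overline H_{d2}\ \Longrightarrow\ \int_{\mathbb{T}^n}|V_1|^2\,dx=\int_{\mathbb{T}^n}|V_2|^2\,dx.$$ (3) If $n=1$ and $H(p)=|p|^2$, then $$\overline H_{d1}\equiv\overline H_{d2}\ \Longrightarrow\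 \int_{\mathbb{T}^1}V_1\,dx=\int_{\mathbb{T}^1}V_2\,dx\ \text{ and }\ \int_{\mathbb{T}^1}|V_1|^2\,dx=\int_{\mathbb{T}^1}|V_2|^2\,dx.$$
   Context: $\mathbb{T}^n=\mathbb{R}^n/\mathbb{Z}^n$; functions on $\mathbb{T}^n$ are identified with $\mathbb{Z}^n$-periodic functions on $\mathbb{R}^n$. For $d>0$, the viscous effective Hamiltonian $\overline H_d:\mathbb{R}^n\to\mathbb{R}$ associated with $H(p)+V(x)$ is defined as follows: for each $p\in\mathbb{R}^n$, $\overline H_d(p)$ is the unique constant $c$ such that the cell problem $$-d\Delta w+H(p+Dw)+V(x)=c\quad\text{in }\mathbb{T}^n$$ has a ($\mathbb{Z}^n$-periodic) solution $w$. $H$ is superlinear if $H(p)/|p|\to+\infty$ as $|p|\to\infty$. A vector $Q\in\mathbb{R}^n$ satisfies a Diophantine condition if there exist $C,\alpha>0$ such that $|Q\cdot k|\ge C/|k|^\alpha$ for every $k\in\mathbb{Z}^n\setminus\{0\}$. The Fourier coefficients of $V_i$ are $\lambda_{ki}=\int_{\mathbb{T}^n}V_i(x)e^{-2\pi i\,k\cdot x}\,dx$ (in the exponent $i$ is the imaginary unit). *)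

theory Defs
  imports "HOL-Analysis.Analysis"
begin

text \<open>The dimension is the cardinality of the index type of \<^typ>\<open>real ^ 'n\<close>; functions on the
  torus are functions on \<^typ>\<open>real ^ 'n\<close> that are periodic with respect to the integer lattice.\<close>

definition lattice_vec :: "int ^ 'n \<Rightarrow> real ^ 'n" where
  "lattice_vec k = (\<chi> i. of_int (k $ i))"

definition periodic :: "(real ^ 'n \<Rightarrow> 'b) \<Rightarrow> bool" where
  "periodic f \<longleftrightarrow> (\<forall>x k. f (x + lattice_vec k) = f x)"

definition partial :: "'n \<Rightarrow> (real ^ 'n \<Rightarrow> real) \<Rightarrow> real ^ 'n \<Rightarrow> real" where
  "partial i f x = frechet_derivative f (at x) (axis i 1)"

definition grad :: "(real ^ 'n \<Rightarrow> real) \<Rightarrow> real ^ 'n \<Rightarrow> real ^ 'n" where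
  "grad f x = (\<chi> i. partial i f x)"

definition hessian :: "(real ^ 'n \<Rightarrow> real) \<Rightarrow> real ^ 'n \<Rightarrow> real ^ 'n ^ 'n" where
  "hessian f x = (\<chi> i j. partial i (partial j f) x)"

definition laplacian :: "(real ^ 'n \<Rightarrow> real) \<Rightarrow> real ^ 'n \<Rightarrow> real" where
  "laplacian f x = (\<Sum>i\<in>UNIV. partial i (partial i f) x)"

primrec C_k :: "nat \<Rightarrow> (real ^ 'n \<Rightarrow> real) \<Rightarrow> bool" where
  "C_k 0 f \<longleftrightarrow> continuous_on UNIV f"
| "C_k (Suc m) f \<longleftrightarrow> (\<forall>x. f differentiable (at x)) \<and> (\<forall>i. C_k m (partial i f))"

definition smooth_on_torus :: "(real ^ 'n \<Rightarrow> real) \<Rightarrow> bool" where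
  "smooth_on_torus V \<longleftrightarrow> periodic V \<and> (\<forall>m. C_k m V)"

definition torus_integral ::
    "(real ^ 'n \<Rightarrow> 'b::euclidean_space) \<Rightarrow> 'b" where
  "torus_integral f = integral {x. \<forall>i. 0 \<le> x $ i \<and> x $ i \<le> 1} f"

definition fourier_coeff :: "(real ^ 'n \<Rightarrow> real) \<Rightarrow> int ^ 'n \<Rightarrow> complex" where
  "fourier_coeff V k =
     torus_integral (\<lambda>x. of_real (V x) * exp (- 2 * of_real pi * \<i> * of_real (lattice_vec k \<bullet> x)))"

definition superlinear :: "(real ^ 'n \<Rightarrow> real) \<Rightarrow> bool" where
  "superlinear H \<longleftrightarrow> filterlim (\<lambda>p. H p / norm p) at_top at_infinity"

definition diophantine :: "real ^ 'n \<Rightarrow> bool" where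
  "diophantine Q \<longleftrightarrow> (\<exists>C>0. \<exists>\<alpha>>0. \<forall>k. k \<noteq> 0 \<longrightarrow>
     \<bar>Q \<bullet> lattice_vec k\<bar> \<ge> C / norm (lattice_vec k) powr \<alpha>)"

text \<open>Solutions of the cell problem are classical, i.e. twice continuously differentiable; for
  positive \<open>d\<close> and the Hamiltonians of interest here, viscosity solutions have this regularity.\<close>

definition cell_solution ::
    "real \<Rightarrow> (real ^ 'n \<Rightarrow> real) \<Rightarrow> (real ^ 'n \<Rightarrow> real) \<Rightarrow> real ^ 'n \<Rightarrow> real \<Rightarrow> (real ^ 'n \<Rightarrow> real) \<Rightarrow> bool"
  where
  "cell_solution d H V p c w \<longleftrightarrow> periodic w \<and> C_k 2 w \<and>
     (\<forall>x. - d * laplacian w x + H (p + grad w x) + V x = c)"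

text \<open>The effective Hamiltonian is specified by its defining property: \<open>Hbar p\<close> is the one and only
  constant for which the cell problem is solvable.\<close>

definition viscous_effective_hamiltonian ::
    "real \<Rightarrow> (real ^ 'n \<Rightarrow> real) \<Rightarrow> (real ^ 'n \<Rightarrow> real) \<Rightarrow> (real ^ 'n \<Rightarrow> real) \<Rightarrow> bool" where
  "viscous_effective_hamiltonian d H V Hbar \<longleftrightarrow>
     (\<forall>p c. (\<exists>w. cell_solution d H V p c w) \<longleftrightarrow> c = Hbar p)"

end

theory Submission
  imports Defs
begin

text \<open>
  At an extremum of \<open>w - \<phi>\<close> the cell problem of \<open>w\<close> can be compared with a periodic test
  function \<open>\<phi>\<close>: if \<open>- d \<Delta>\<phi> + H (p + D\<phi>) + V\<close> is everywhere within \<open>e\<close> of \<open>b\<close>, then the effective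
  Hamiltonian at \<open>p\<close> is within \<open>e\<close> of \<open>b\<close>. Only approximate solutions are needed, so \<open>V\<close> may be
  replaced by a uniformly close trigonometric polynomial, and small divisors play no role.

  For part (1) the test function is \<open>v / \<lambda>\<close>, where \<open>Q \<bullet> Dv\<close> cancels the oscillation of the
  polynomial; it suffices that \<open>Q\<close> is orthogonal to no nonzero integer vector.

  For \<open>H p = |p|\<^sup>2\<close>, let \<open>k\<close> be a primitive integer vector, \<open>K = |k|\<^sup>2\<close>, and \<open>Q\<close> orthogonal to \<open>k\<close> but to no
  integer vector off the line through \<open>k\<close>. At \<open>p = \<lambda> Q + s k\<close> a term \<open>v / \<lambda>\<close> removes all Fourier modes off
  the line. What remains is a one-dimensional cell problem, whose solution is expanded
  in powers of \<open>1 / s\<close>; this gives \<open>\<lambda>\<^sup>2 |Q|\<^sup>2 + K s\<^sup>2 + a + \<beta> / (4 K s\<^sup>2) + O (s\<^sup>-\<^sup>3)\<close> as \<open>\<lambda> \<rightarrow> \<infinity>\<close>, with \<open>a\<close> the mean of \<open>V\<close>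
  and \<open>\<beta>\<close> the sum of the squared moduli of its nonzero modes on the line. Summing \<open>\<beta>\<close> over all lines
  recovers the \<open>L\<^sup>2\<close> norm by Parseval's identity.
\<close>

subsection \<open>Twice differentiable functions and comparison\<close>

text \<open>For \<open>H p = |p|\<^sup>2\<close> three limits are taken, and their order shapes the
  proof: \<open>l\<close> to infinity at fixed frequency cutoff \<open>N\<close> and fixed
  \<open>s\<close>, then \<open>N\<close>, then \<open>s\<close>. The corrector for the modes off
  the line depends on \<open>N\<close> without any control on its size, but it enters only through
  an error \<open>D / l\<close>, which is gone before \<open>N\<close> moves. The one-dimensional
  error survives that limit, so its constant must be independent of \<open>N\<close>; it depends
  only on bounds for the profile and its first three derivatives, and the sum of
  \<open>|c\<^sub>k| (1 + |k|)\<^sup>3\<close> over all frequencies bounds these for every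
  \<open>N\<close> at once.

  For the mean alone any uniform trigonometric approximation will do. For \<beta> the approximants
  have to be partial Fourier sums, because \<beta> is read off from their coefficients.

  The term in \<open>s\<^sup>-\<^sup>2\<close> comes from a solvability condition: the third
  corrector has a periodic antiderivative only if a constant equals the mean of
  \<open>g\<^sub>1\<^sup>2\<close>, which is the variance of the profile over
  \<open>4 K\<^sup>2\<close>. An error of order \<open>s\<^sup>-\<^sup>3\<close> is just small
  enough to isolate it.\<close>

lemma has_derivative_grad:
  fixes f :: "real ^ 'n \<Rightarrow> real"
  assumes "f differentiable (at x)"
  shows "(f has_derivative (\<lambda>h. grad f x \<bullet> h)) (at x)"
proof -
  let ?D = "frechet_derivative f (at x)"
  have D: "(f has_derivative ?D) (at x)"
    using assms frechet_derivative_works by blast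
  then have lin: "linear ?D"
    by (rule has_derivative_linear)
  have "?D h = grad f x \<bullet> h" for h
  proof -
    have "?D h = ?D (\<Sum>i\<in>UNIV. h $ i *\<^sub>R axis i 1)"
      using basis_expansion[of h] by (simp add: scalar_mult_eq_scaleR)
    also have "\<dots> = (\<Sum>i\<in>UNIV. h $ i * ?D (axis i 1))"
      by (simp add: linear_sum[OF lin] linear_scale[OF lin])
    also have "\<dots> = grad f x \<bullet> h"
      by (simp add: inner_vec_def grad_def partial_def mult.commute)
    finally show ?thesis .
  qed
  then have "?D = (\<lambda>h. grad f x \<bullet> h)" by blast
  with D show ?thesis by simp
qed

text \<open>Derivatives are carried as explicit data: \<open>G\<close> is the gradient and
  \<open>M i\<close> the gradient of its \<open>i\<close>-th component. Linear combinations and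
  plane waves then get their derivatives by formula instead of through the choice in
  \<open>frechet_derivative\<close>, and the Laplacian is the trace
  \<open>\<Sum>i\<in>UNIV. M i x $ i\<close>.\<close>

definition has_C2 ::
    "(real ^ 'n \<Rightarrow> real) \<Rightarrow> (real ^ 'n \<Rightarrow> real ^ 'n) \<Rightarrow> ('n \<Rightarrow> real ^ 'n \<Rightarrow> real ^ 'n) \<Rightarrow> bool" where
  "has_C2 f G M \<longleftrightarrow>
     (\<forall>x. (f has_derivative (\<lambda>h. G x \<bullet> h)) (at x)) \<and>
     (\<forall>i x. ((\<lambda>y. G y $ i) has_derivative (\<lambda>h. M i x \<bullet> h)) (at x)) \<and>
     (\<forall>i. continuous_on UNIV (M i))"

lemma has_C2_D1: "has_C2 f G M \<Longrightarrow> (f has_derivative (\<lambda>h. G x \<bullet> h)) (at x)"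
  by (simp add: has_C2_def)

lemma has_C2_D2: "has_C2 f G M \<Longrightarrow> ((\<lambda>y. G y $ i) has_derivative (\<lambda>h. M i x \<bullet> h)) (at x)"
  by (simp add: has_C2_def)

lemma C_k_imp_continuous: "C_k m f \<Longrightarrow> continuous_on UNIV f"
  by (cases m) (auto intro: differentiable_imp_continuous_on simp: differentiable_on_def)

lemma C_k_2_imp_has_C2:
  assumes "C_k 2 f"
  shows "has_C2 f (grad f) (\<lambda>i. grad (partial i f))"
proof -
  have 1: "f differentiable (at x)" "partial i f differentiable (at x)"
    "continuous_on UNIV (partial j (partial i f))" for x i j
    using assms by (auto simp: numeral_2_eq_2)
  have "continuous_on UNIV (grad (partial i f))" for i
    unfolding grad_def by (intro continuous_on_vec_lambda 1)
  with has_derivative_grad[OF 1(1)] has_derivative_grad[OF 1(2)] show ?thesis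
    unfolding has_C2_def by (simp add: grad_def)
qed

lemma has_C2_zero: "has_C2 (\<lambda>x. 0) (\<lambda>x. 0) (\<lambda>i x. 0)"
  by (auto simp: has_C2_def)

lemma has_inner_derivative_add:
  assumes "(f has_derivative (\<lambda>h. g \<bullet> h)) (at x)" "(f' has_derivative (\<lambda>h. g' \<bullet> h)) (at x)"
  shows "((\<lambda>x. f x + f' x) has_derivative (\<lambda>h. (g + g') \<bullet> h)) (at x)"
  by (rule has_derivative_eq_rhs[OF has_derivative_add[OF assms]]) (simp add: inner_add_left)

lemma has_inner_derivative_mult:
  fixes f :: "_ \<Rightarrow> real"
  assumes "(f has_derivative (\<lambda>h. g \<bullet> h)) (at x)"
  shows "((\<lambda>x. a * f x) has_derivative (\<lambda>h. (a *\<^sub>R g) \<bullet> h)) (at x)"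
  by (rule has_derivative_eq_rhs[OF has_derivative_mult_right[OF assms]]) simp

lemma has_C2_add:
  assumes "has_C2 f G M" "has_C2 f' G' M'"
  shows "has_C2 (\<lambda>x. f x + f' x) (\<lambda>x. G x + G' x) (\<lambda>i x. M i x + M' i x)"
  using assms has_inner_derivative_add unfolding has_C2_def
  by (auto simp del: inner_add_left intro!: continuous_intros has_inner_derivative_add)

lemma has_C2_mult:
  assumes "has_C2 f G M"
  shows "has_C2 (\<lambda>x. a * f x) (\<lambda>x. a *\<^sub>R G x) (\<lambda>i x. a *\<^sub>R M i x)"
  using assms unfolding has_C2_def
  by (auto simp del: inner_scaleR_left intro!: continuous_intros has_inner_derivative_mult)

lemma has_C2_diff:
  assumes "has_C2 f G M" "has_C2 f' G' M'"
  shows "has_C2 (\<lambda>x. f x - f' x) (\<lambda>x. G x - G' x) (\<lambda>i x. M i x - M' i x)"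
  using has_C2_add[OF assms(1) has_C2_mult[OF assms(2), of "- 1"]] by simp

text \<open>The trace of this \<open>M\<close> is \<open>\<psi>2 (v \<bullet> x)\<close> times the
  squared norm of \<open>v\<close>, so the Laplacian reduces to a second derivative in one variable.
  Used for single Fourier modes and for the one-dimensional part of the test function.\<close>

lemma has_C2_plane_wave:
  assumes d1: "\<And>t. (\<psi> has_real_derivative \<psi>1 t) (at t)"
    and d2: "\<And>t. (\<psi>1 has_real_derivative \<psi>2 t) (at t)"
    and c: "continuous_on UNIV \<psi>2"
  shows "has_C2 (\<lambda>x. \<psi> (v \<bullet> x)) (\<lambda>x. \<psi>1 (v \<bullet> x) *\<^sub>R v) (\<lambda>i x. (\<psi>2 (v \<bullet> x) * v $ i) *\<^sub>R v)"
proof -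
  have lin: "((\<lambda>x. v \<bullet> x) has_derivative (\<lambda>h. v \<bullet> h)) (at x)" for x
    by (intro derivative_eq_intros) auto
  have 1: "((\<lambda>x. \<psi> (v \<bullet> x)) has_derivative (\<lambda>h. (\<psi>1 (v \<bullet> x) *\<^sub>R v) \<bullet> h)) (at x)" for x
    using has_derivative_compose[OF lin d1[unfolded has_field_derivative_def], of x]
    by simp
  have 2: "((\<lambda>x. \<psi>1 (v \<bullet> x)) has_derivative (\<lambda>h. (\<psi>2 (v \<bullet> x) *\<^sub>R v) \<bullet> h)) (at x)" for x
    using has_derivative_compose[OF lin d2[unfolded has_field_derivative_def], of x]
    by simp
  have 3: "((\<lambda>y. (\<psi>1 (v \<bullet> y) *\<^sub>R v) $ i) has_derivative (\<lambda>h. ((\<psi>2 (v \<bullet> x) * v $ i) *\<^sub>R v) \<bullet> h)) (at x)" for x i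
    using has_derivative_mult_left[OF 2, of "v $ i"] by (simp add: ac_simps)
  have "continuous_on UNIV (\<lambda>x. \<psi>2 (v \<bullet> x))"
    by (rule continuous_on_compose2[OF c]) (auto intro!: continuous_intros)
  then have "continuous_on UNIV (\<lambda>x. (\<psi>2 (v \<bullet> x) * v $ i) *\<^sub>R v)" for i
    by (intro continuous_intros)
  with 1 3 show ?thesis
    unfolding has_C2_def by blast
qed

section \<open>Periodic functions and the unit cube\<close>

lemma unit_cube_eq: "{x :: real ^ 'n. \<forall>i. 0 \<le> x $ i \<and> x $ i \<le> 1} = cbox 0 1"
  by (auto simp: mem_box_cart)

lemma periodicD: "periodic f \<Longrightarrow> f (x + lattice_vec k) = f x"
  by (simp add: periodic_def)

lemma cube_representative:
  fixes x :: "real ^ 'n"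
  obtains k where "x + lattice_vec k \<in> cbox 0 1"
proof
  show "x + lattice_vec (\<chi> i. - \<lfloor>x $ i\<rfloor>) \<in> cbox 0 1"
    by (auto simp: mem_box_cart lattice_vec_def) (smt (verit) of_int_floor_le real_of_int_floor_add_one_ge)+
qed

lemma periodic_attains_max:
  fixes f :: "real ^ 'n \<Rightarrow> real"
  assumes "periodic f" "continuous_on UNIV f"
  obtains x0 where "\<And>x. f x \<le> f x0"
proof -
  have "cbox 0 (1::real ^ 'n) \<noteq> {}"
    by (metis cube_representative empty_iff)
  then obtain x0 where x0: "\<And>x. x \<in> cbox 0 1 \<Longrightarrow> f x \<le> f x0"
    using continuous_attains_sup[OF compact_cbox, of 0 1 f]
      continuous_on_subset[OF assms(2)] by (metis subset_UNIV)
  have "f x \<le> f x0" for x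
    using cube_representative[of x] x0 periodicD[OF assms(1)] by metis
  then show ?thesis using that by blast
qed

lemma periodic_bounded:
  fixes f :: "real ^ 'n \<Rightarrow> 'b::real_normed_vector"
  assumes "periodic f" "continuous_on UNIV f"
  obtains B where "B \<ge> 0" "\<And>x. norm (f x) \<le> B"
proof -
  have "periodic (\<lambda>x. norm (f x))" "continuous_on UNIV (\<lambda>x. norm (f x))"
    using assms by (auto simp: periodic_def intro!: continuous_intros)
  then obtain x0 where "\<And>x. norm (f x) \<le> norm (f x0)"
    using periodic_attains_max by blast
  then show ?thesis using that[of "norm (f x0)"] by auto
qed

section \<open>Maximum principle and comparison\<close>

lemma second_derivative_at_max:
  fixes g :: "real \<Rightarrow> real"
  assumes d1: "\<And>t. (g has_real_derivative g1 t) (at t)"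
    and d2: "(g1 has_real_derivative l) (at 0)"
    and mx: "\<And>t. g t \<le> g 0"
  shows "g1 0 = 0" "l \<le> 0"
proof -
  show g0: "g1 0 = 0"
    by (rule DERIV_local_max[OF d1, of 1]) (auto simp: mx)
  show "l \<le> 0"
  proof (rule ccontr)
    \<comment> \<open>Since \<open>g1 0 = 0\<close>, a positive \<open>l\<close> would make
      \<open>g1\<close> positive just to the right of \<open>0\<close> and \<open>g\<close> strictly
      increasing there.\<close>
    assume "\<not> l \<le> 0"
    then obtain e where e: "e > 0" "\<And>h. 0 < h \<Longrightarrow> h < e \<Longrightarrow> g1 0 < g1 (0 + h)"
      using DERIV_pos_inc_right[OF d2] by auto
    have "g 0 < g (e/2)"
    proof (rule DERIV_pos_imp_increasing_open[where f = g])
      show "0 < e/2" using e by simp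
      show "\<exists>y. (g has_real_derivative y) (at x) \<and> 0 < y" if "0 < x" "x < e/2" for x
        using d1[of x] e(2)[of x] that g0 by auto
      show "continuous_on {0..e/2} g"
        by (rule DERIV_continuous_on[of _ _ g1]) (meson d1 DERIV_subset subset_UNIV)
    qed
    with mx[of "e/2"] show False by simp
  qed
qed

text \<open>Restriction to coordinate lines through \<open>x0\<close> is enough, because the
  Laplacian sees only pure second derivatives.\<close>

lemma has_C2_at_max:
  fixes f :: "real ^ 'n \<Rightarrow> real"
  assumes C: "has_C2 f G M" and mx: "\<And>x. f x \<le> f x0"
  shows "G x0 = 0" "M i x0 $ i \<le> 0"
proof -
  have line: "((\<lambda>t. x0 + t *\<^sub>R (axis i 1 :: real ^ 'n)) has_derivative (\<lambda>h. h *\<^sub>R axis i 1)) (at t)" for i t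
    by (auto intro!: derivative_eq_intros)
  have 1: "((\<lambda>t. f (x0 + t *\<^sub>R axis i 1)) has_real_derivative G (x0 + t *\<^sub>R axis i 1) $ i) (at t)" for i t
    using has_derivative_compose[OF line[of i t] has_C2_D1[OF C]]
    by (simp add: has_field_derivative_def inner_axis mult.commute)
      (simp add: mult.commute[of _ "_ $ _"] fun_eq_iff)
  have 2: "((\<lambda>t. G (x0 + t *\<^sub>R axis i 1) $ i) has_real_derivative M i (x0 + t *\<^sub>R axis i 1) $ i) (at t)" for i t
    using has_derivative_compose[OF line[of i t] has_C2_D2[OF C], of i]
    by (simp add: has_field_derivative_def inner_axis mult.commute)
      (simp add: mult.commute[of _ "_ $ _"] fun_eq_iff)
  have 3: "f (x0 + t *\<^sub>R (axis i 1 :: real ^ 'n)) \<le> f (x0 + 0 *\<^sub>R axis i 1)" for t i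
    using mx by simp
  show "M i x0 $ i \<le> 0"
    using second_derivative_at_max(2)[OF 1 2 3, of i] by simp
  have "G x0 $ i = 0" for i
    using second_derivative_at_max(1)[OF 1 2 3] by simp
  then show "G x0 = 0" by (simp add: vec_eq_iff)
qed

lemma periodic_diff: "periodic f \<Longrightarrow> periodic g \<Longrightarrow> periodic (\<lambda>x. f x - g x)"
  by (simp add: periodic_def)

lemma has_C2_continuous: "has_C2 f G M \<Longrightarrow> continuous_on UNIV f"
  by (meson has_C2_D1 has_derivative_continuous continuous_at_imp_continuous_on)

lemma comparison:
  fixes w \<phi> :: "real ^ 'n \<Rightarrow> real"
  assumes d: "d > 0" and w: "cell_solution d H V p c w"
    and C: "has_C2 \<phi> G M" and per: "periodic \<phi>"
    and bd: "\<And>x. \<bar>- d * (\<Sum>i\<in>UNIV. M i x $ i) + H (p + G x) + V x - b\<bar> \<le> e"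
  shows "\<bar>c - b\<bar> \<le> e"
proof -
  let ?N = "\<lambda>i. grad (partial i w)"
  have W: "has_C2 w (grad w) ?N" and pw: "periodic w"
    and eqn: "\<And>x. - d * (\<Sum>i\<in>UNIV. ?N i x $ i) + H (p + grad w x) + V x = c"
    using w C_k_2_imp_has_C2 by (auto simp: cell_solution_def laplacian_def grad_def)
  note D1 = has_C2_diff[OF W C]
  note D2 = has_C2_diff[OF C W]
  obtain x1 where x1: "\<And>x. w x - \<phi> x \<le> w x1 - \<phi> x1"
    using periodic_attains_max[OF periodic_diff[OF pw per] has_C2_continuous[OF D1]] by blast
  obtain x2 where x2: "\<And>x. \<phi> x - w x \<le> \<phi> x2 - w x2"
    using periodic_attains_max[OF periodic_diff[OF per pw] has_C2_continuous[OF D2]] by blast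
  \<comment> \<open>The gradients agree at the extremum, so \<open>H\<close> takes the same value in
    both expressions and only the Laplacians differ. With \<open>d > 0\<close> the maximum of
    \<open>w - \<phi>\<close> bounds \<open>c\<close> from below, and the maximum of
    \<open>\<phi> - w\<close> bounds it from above.\<close>
  have "grad w x1 = G x1" "(\<Sum>i\<in>UNIV. ?N i x1 $ i) \<le> (\<Sum>i\<in>UNIV. M i x1 $ i)"
    using has_C2_at_max[OF D1 x1] by (auto intro!: sum_mono)
  then have 1: "c \<ge> - d * (\<Sum>i\<in>UNIV. M i x1 $ i) + H (p + G x1) + V x1"
    using eqn[of x1] d by (smt (verit) mult_left_mono mult_minus_left)
  have "grad w x2 = G x2" "(\<Sum>i\<in>UNIV. M i x2 $ i) \<le> (\<Sum>i\<in>UNIV. ?N i x2 $ i)"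
    using has_C2_at_max[OF D2 x2] by (auto intro!: sum_mono)
  then have 2: "c \<le> - d * (\<Sum>i\<in>UNIV. M i x2 $ i) + H (p + G x2) + V x2"
    using eqn[of x2] d by (smt (verit) mult_left_mono mult_minus_left)
  show ?thesis
    using 1 2 bd[of x1] bd[of x2] by linarith
qed

subsection \<open>Density of trigonometric polynomials\<close>

definition wave :: "int ^ 'n \<Rightarrow> real ^ 'n \<Rightarrow> complex" where
  "wave k x = cis (2 * pi * (lattice_vec k \<bullet> x))"

lemma lattice_vec_simps [simp]:
  "lattice_vec 0 = 0"
  "lattice_vec (k + l) = lattice_vec k + lattice_vec l"
  "lattice_vec (k - l) = lattice_vec k - lattice_vec l"
  "lattice_vec (- k) = - lattice_vec k"
  "lattice_vec (m *s k) = of_int m *\<^sub>R lattice_vec k"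
  "lattice_vec (axis i 1) = axis i 1"
  by (auto simp: lattice_vec_def vec_eq_iff axis_def)

lemma lattice_vec_nth [simp]: "lattice_vec k $ i = of_int (k $ i)"
  by (simp add: lattice_vec_def)

lemma lattice_vec_inject [simp]: "lattice_vec k = lattice_vec l \<longleftrightarrow> k = l"
  by (auto simp: vec_eq_iff)

lemma lattice_vec_eq_0_iff [simp]: "lattice_vec k = 0 \<longleftrightarrow> k = 0"
  using lattice_vec_inject[of k 0] by (simp del: lattice_vec_inject)

lemma lattice_inner_Ints: "lattice_vec k \<bullet> lattice_vec l \<in> \<int>"
  by (auto simp: inner_vec_def intro!: Ints_sum)

lemma wave_0 [simp]: "wave 0 x = 1"
  by (simp add: wave_def)

lemma wave_add: "wave (k + l) x = wave k x * wave l x"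
  by (simp add: wave_def inner_add_left cis_mult algebra_simps)

lemma wave_uminus: "wave (- k) x = cnj (wave k x)"
  by (simp add: wave_def cis_cnj)

lemma wave_shift: "wave k (x + y) = wave k x * wave k y"
  by (simp add: wave_def inner_add_right cis_mult algebra_simps)

lemma norm_wave [simp]: "cmod (wave k x) = 1"
  by (simp add: wave_def)

lemma wave_lattice_vec: "wave k (lattice_vec l) = 1"
proof -
  obtain m where "lattice_vec k \<bullet> lattice_vec l = of_int m"
    using lattice_inner_Ints Ints_cases by metis
  then have "wave k (lattice_vec l) = cis (2 * pi * of_int m)"
    by (simp add: wave_def)
  then show ?thesis
    by (simp add: cis_multiple_2pi)
qed

lemma periodic_wave: "periodic (wave k)"
  by (simp add: periodic_def wave_shift wave_lattice_vec)

lemma continuous_on_wave [continuous_intros]: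
  "continuous_on S f \<Longrightarrow> continuous_on S (\<lambda>x. wave k (f x))"
  unfolding wave_def cis_conv_exp by (intro continuous_intros)

text \<open>Real parts of complex modes cover constants, cosines and sines with one constructor. The
  inductive form allows products and the transport equation to be treated mode by mode.\<close>

inductive trig_poly :: "(real ^ 'n \<Rightarrow> real) \<Rightarrow> bool" where
  single: "trig_poly (\<lambda>x. Re (c * wave k x))"
| add: "trig_poly f \<Longrightarrow> trig_poly g \<Longrightarrow> trig_poly (\<lambda>x. f x + g x)"

lemma trig_poly_const: "trig_poly (\<lambda>x. a)"
  using trig_poly.single[of "of_real a" 0] by simp

text \<open>The product-to-sum formula: two modes multiply to modes at the frequencies
  \<open>k + k'\<close> and \<open>k - k'\<close>. Closure under products is what Stone--Weierstrass
  asks for.\<close>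

lemma trig_poly_mult_single: "trig_poly g \<Longrightarrow> trig_poly (\<lambda>x. Re (c * wave k x) * g x)"
proof (induction rule: trig_poly.induct)
  case (single c' k')
  have "(\<lambda>x. Re (c * wave k x) * Re (c' * wave k' x)) =
    (\<lambda>x. Re ((c * c' / 2) * wave (k + k') x) + Re ((c * cnj c' / 2) * wave (k - k') x))"
  proof
    fix x
    have *: "Re a * Re b = Re (a * b / 2) + Re (a * cnj b / 2)" for a b
      by (simp add: field_simps)
    have "Re (c * wave k x) * Re (c' * wave k' x)
        = Re ((c * wave k x) * (c' * wave k' x) / 2) + Re ((c * wave k x) * cnj (c' * wave k' x) / 2)"
      by (rule *)
    also have "(c * wave k x) * (c' * wave k' x) / 2 = (c * c' / 2) * wave (k + k') x"
      by (simp add: wave_add)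
    also have "(c * wave k x) * cnj (c' * wave k' x) / 2 = (c * cnj c' / 2) * wave (k - k') x"
      using wave_add[of k "- k'" x] by (simp add: wave_uminus)
    finally show "Re (c * wave k x) * Re (c' * wave k' x) =
      Re ((c * c' / 2) * wave (k + k') x) + Re ((c * cnj c' / 2) * wave (k - k') x)" .
  qed
  then show ?case
    by (simp only: trig_poly.intros)
next
  case (add f g)
  then show ?case
    using trig_poly.add by (fastforce simp: distrib_left)
qed

lemma trig_poly_mult: "trig_poly f \<Longrightarrow> trig_poly g \<Longrightarrow> trig_poly (\<lambda>x. f x * g x)"
proof (induction rule: trig_poly.induct)
  case (single c k)
  then show ?case by (rule trig_poly_mult_single)
next
  case (add f1 f2)
  then show ?case
    using trig_poly.add by (fastforce simp: distrib_right)
qed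

lemma continuous_on_trig_poly: "trig_poly f \<Longrightarrow> continuous_on S f"
  by (induction rule: trig_poly.induct) (auto intro!: continuous_intros)

text \<open>The torus is realised as the compact set of all \<open>(cis (2 \<pi> x\<^sub>i))\<^sub>i\<close>, to which the
  Stone--Weierstrass theorem applies.\<close>

theorem trig_poly_dense:
  fixes f :: "real ^ 'n \<Rightarrow> real"
  assumes per: "periodic f" and cont: "continuous_on UNIV f" and e: "e > 0"
  obtains T where "trig_poly T" "\<And>x. \<bar>f x - T x\<bar> < e"
proof -
  define P :: "real ^ 'n \<Rightarrow> complex ^ 'n" where "P x = (\<chi> i. cis (2 * pi * x $ i))" for x
  define Q :: "(real ^ 'n) set" where "Q = cbox 0 1"
  define S where "S = P ` Q"
  have P_wave: "P x $ i = wave (axis i 1) x" for x i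
    by (simp add: P_def wave_def inner_axis')
  have contP: "continuous_on A P" for A
    unfolding P_def cis_conv_exp by (intro continuous_intros)
  \<comment> \<open>Points with the same image under \<open>P\<close> differ by a lattice vector, so
    a periodic \<open>f\<close> descends to a function \<open>g\<close> on the image
    \<open>S\<close>.\<close>
  have P_eq: "f x = f y" if "P x = P y" for x y
  proof -
    have "\<exists>m::int. x $ i = y $ i + of_int m" for i
    proof -
      have "cis (2 * pi * x $ i) = cis (2 * pi * y $ i)"
        using that by (simp add: P_def vec_eq_iff)
      then obtain m :: int where "2 * pi * x $ i = 2 * pi * y $ i + 2 * pi * of_int m"
        by (metis Re_complex_of_real cis.sel sin_cos_eq_iff)
      then have "2 * pi * x $ i = 2 * pi * (y $ i + of_int m)"
        by (simp add: distrib_left)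
      then show ?thesis by auto
    qed
    then obtain m where "\<And>i. x $ i = y $ i + of_int (m i)"
      by metis
    then have "x = y + lattice_vec (\<chi> i. m i)"
      by (simp add: vec_eq_iff)
    then show ?thesis
      using periodicD[OF per] by simp
  qed
  have P_per: "P (x + lattice_vec k) = P x" for x k
    by (simp add: vec_eq_iff P_wave wave_shift wave_lattice_vec)
  have P_in: "P x \<in> S" for x
    unfolding S_def Q_def by (metis P_per cube_representative imageI)
  define g where "g z = f (inv_into Q P z)" for z
  have gP: "g (P x) = f x" for x
    unfolding g_def using P_in[of x] P_eq by (metis S_def f_inv_into_f)
  have compactS: "compact S"
    unfolding S_def Q_def by (intro compact_continuous_image contP compact_cbox)
  \<comment> \<open>\<open>P\<close> restricted to the cube is a closed map by compactness, so
    closed sets have closed preimages under \<open>g\<close>.\<close>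
  have contg: "continuous_on S g"
  proof -
    have "closed (g -` B \<inter> S)" if "closed B" for B
    proof -
      have "g -` B \<inter> S = P ` (f -` B \<inter> Q)"
        by (auto simp: S_def gP)
      moreover have "closed (f -` B \<inter> Q)"
        by (rule continuous_on_closed_vimage[THEN iffD1, rule_format])
           (auto simp: Q_def that intro!: continuous_on_subset[OF cont])
      then have "compact (f -` B \<inter> Q)"
        unfolding Q_def by (metis compact_Int_closed compact_cbox inf_commute inf.right_idem)
      ultimately show ?thesis
        by (simp add: compact_imp_closed compact_continuous_image contP)
    qed
    then show ?thesis
      using continuous_on_closed_vimage[OF compact_imp_closed[OF compactS]] by blast
  qed
  \<comment> \<open>Membership is tested after pulling back along \<open>P\<close>. The real and
    imaginary parts of the coordinates pull back to single modes, and they separate points.\<close>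
  define R where "R = {h. continuous_on S h \<and> trig_poly (\<lambda>x. h (P x))}"
  interpret function_ring_on R S
  proof
    show "\<exists>h\<in>R. h z \<noteq> h z'" if "z \<in> S" "z' \<in> S" and ne: "z \<noteq> z'" for z z'
    proof -
      obtain i where i: "z $ i \<noteq> z' $ i"
        using ne unfolding vec_eq_iff by blast
      have "(\<lambda>z. Re (z $ i)) \<in> R" "(\<lambda>z. Im (z $ i)) \<in> R"
        using trig_poly.single[of 1 "axis i 1"] trig_poly.single[of "- \<i>" "axis i 1"]
        by (auto simp: R_def P_wave intro!: continuous_intros)
      then show ?thesis
        using i complex_eqI by metis
    qed
  qed (auto simp: R_def compactS intro!: continuous_intros trig_poly.add trig_poly_mult trig_poly_const)
  obtain h where "h \<in> R" "\<And>z. z \<in> S \<Longrightarrow> \<bar>g z - h z\<bar> < e"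
    using Stone_Weierstrass_basic[OF contg e] by blast
  then show ?thesis
    using that[of "\<lambda>x. h (P x)"] P_in gP unfolding R_def by fastforce
qed

subsection \<open>Integration over the torus\<close>

lemma torus_integral_eq: "torus_integral f = integral (cbox 0 1) f"
  by (simp add: torus_integral_def unit_cube_eq)

lemma content_unit_cube [simp]: "measure lborel (cbox 0 (1 :: real ^ 'n)) = 1"
proof -
  have "0 \<in> cbox 0 (1 :: real ^ 'n)"
    by (simp add: mem_box_cart)
  then have "cbox 0 (1 :: real ^ 'n) \<noteq> {}"
    by blast
  then show ?thesis
    by (subst content_cbox_cart) simp_all
qed

lemma continuous_integrable_on_cube:
  fixes f :: "real ^ 'n \<Rightarrow> 'b::euclidean_space"
  shows "continuous_on UNIV f \<Longrightarrow> f integrable_on cbox a b"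
  by (rule integrable_continuous) (auto intro: continuous_on_subset)

lemma torus_integral_add:
  assumes "continuous_on UNIV f" "continuous_on UNIV g"
  shows "torus_integral (\<lambda>x. f x + g x) = torus_integral f + torus_integral g"
  unfolding torus_integral_eq
  by (intro integral_add continuous_integrable_on_cube assms)

lemma torus_integral_diff:
  assumes "continuous_on UNIV f" "continuous_on UNIV g"
  shows "torus_integral (\<lambda>x. f x - g x) = torus_integral f - torus_integral g"
  unfolding torus_integral_eq
  by (intro integral_diff continuous_integrable_on_cube assms)

lemma torus_integral_mult_left:
  fixes f :: "real ^ 'n \<Rightarrow> 'b::{euclidean_space,real_normed_field}"
  shows "torus_integral (\<lambda>x. c * f x) = c * torus_integral f"
  unfolding torus_integral_eq by simp

lemma torus_integral_sum:
  assumes "finite F" "\<And>k. k \<in> F \<Longrightarrow> continuous_on UNIV (f k)"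
  shows "torus_integral (\<lambda>x. \<Sum>k\<in>F. f k x) = (\<Sum>k\<in>F. torus_integral (f k))"
  unfolding torus_integral_eq
  by (intro integral_sum continuous_integrable_on_cube assms)

lemma torus_integral_const [simp]: "torus_integral (\<lambda>x. c) = c"
  by (simp add: torus_integral_eq)

lemma norm_torus_integral_le:
  fixes f :: "real ^ 'n \<Rightarrow> 'b::euclidean_space"
  assumes "continuous_on UNIV f" "\<And>x. norm (f x) \<le> B"
  shows "norm (torus_integral f) \<le> B"
proof -
  have "norm (integral (cbox 0 1) f) \<le> integral (cbox 0 1) (\<lambda>x :: real ^ 'n. B)"
    by (rule integral_norm_bound_integral)
       (use assms in \<open>auto intro: continuous_integrable_on_cube\<close>)
  then show ?thesis
    by (simp add: torus_integral_eq)
qed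

text \<open>Cut the shifted cube at \<open>x $ i = 1\<close>. The slab beyond the cut moves back by
  one period and fills the gap left at the bottom, so the two pieces are those of the unit cube cut
  at \<open>x $ i = t\<close>.\<close>

lemma torus_integral_shift_axis_01:
  fixes f :: "real ^ 'n \<Rightarrow> 'b::euclidean_space"
  assumes per: "periodic f" and cont: "continuous_on UNIV f" and t: "0 \<le> t" "t \<le> 1"
  shows "torus_integral (\<lambda>x. f (x + axis i t)) = torus_integral f"
proof -
  let ?e = "axis i 1 :: real ^ 'n"
  define a where "a = axis i t"
  define b where "b = 1 + axis i t"
  have I: "f integrable_on cbox u v" for u v
    by (rule continuous_integrable_on_cube[OF cont])
  have bas: "?e \<in> Basis" by (simp add: axis_in_Basis_iff)
  have nth: "x \<bullet> ?e = x $ i" for x by (simp add: inner_axis)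
  have box_iff: "x \<in> cbox u v \<longleftrightarrow> (u $ i \<le> x $ i \<and> x $ i \<le> v $ i) \<and> (\<forall>j. j \<noteq> i \<longrightarrow> u $ j \<le> x $ j \<and> x $ j \<le> v $ j)"
    for x u v :: "real ^ 'n"
  proof -
    have "(\<forall>j. R j) \<longleftrightarrow> R i \<and> (\<forall>j. j \<noteq> i \<longrightarrow> R j)" for R
      by auto
    from this[of "\<lambda>j. u $ j \<le> x $ j \<and> x $ j \<le> v $ j"] show ?thesis
      by (simp add: mem_box_cart)
  qed
  define c :: "real ^ 'n" where "c = (\<chi> j. if j = i then t else 1)"
  define c' :: "real ^ 'n" where "c' = (\<chi> j. if j = i then 1 + t else 1)"
  have "torus_integral (\<lambda>x. f (x + axis i t)) = integral (cbox a b) f"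
    using integral_shift_cbox[of a a b f] by (simp add: torus_integral_eq a_def b_def)
  also have "integral (cbox a b) f = integral (cbox a b \<inter> {x. x \<bullet> ?e \<le> 1}) f + integral (cbox a b \<inter> {x. x \<bullet> ?e \<ge> 1}) f"
    by (rule integral_split[OF I bas])
  also have "cbox a b \<inter> {x. x \<bullet> ?e \<le> 1} = cbox a 1"
    using t unfolding nth by (auto simp: box_iff a_def b_def axis_def)
  also have "cbox a b \<inter> {x. x \<bullet> ?e \<ge> 1} = cbox ?e c'"
    using t unfolding nth by (auto simp: box_iff a_def b_def c'_def axis_def)
  also have "integral (cbox ?e c') f = integral (cbox 0 c) (\<lambda>x. f (x + ?e))"
  proof -
    have "c' - ?e = c"
      by (simp add: vec_eq_iff c_def c'_def axis_def)
    then show ?thesis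
      using integral_shift_cbox[of ?e ?e c' f] by simp
  qed
  also have "(\<lambda>x. f (x + ?e)) = f"
    using periodicD[OF per, of _ "axis i 1"] by simp
  also have "integral (cbox a 1) f + integral (cbox 0 c) f = integral (cbox 0 1 \<inter> {x. x \<bullet> ?e \<le> t}) f + integral (cbox 0 1 \<inter> {x. x \<bullet> ?e \<ge> t}) f"
  proof -
    have "cbox 0 1 \<inter> {x. x \<bullet> ?e \<le> t} = cbox 0 c"
      using t unfolding nth by (auto simp: box_iff c_def axis_def)
    moreover have "cbox 0 1 \<inter> {x. x \<bullet> ?e \<ge> t} = cbox a 1"
      using t unfolding nth by (auto simp: box_iff a_def axis_def)
    ultimately show ?thesis by simp
  qed
  also have "\<dots> = torus_integral f"
    unfolding torus_integral_eq by (rule integral_split[OF I bas, symmetric])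
  finally show ?thesis .
qed

lemma torus_integral_shift_axis:
  fixes f :: "real ^ 'n \<Rightarrow> 'b::euclidean_space"
  assumes per: "periodic f" and cont: "continuous_on UNIV f"
  shows "torus_integral (\<lambda>x. f (x + axis i t)) = torus_integral f"
proof -
  have "f (x + axis i t) = f (x + axis i (frac t))" for x
  proof -
    have "x + axis i t = (x + axis i (frac t)) + lattice_vec (\<lfloor>t\<rfloor> *s axis i 1)"
      by (auto simp: vec_eq_iff axis_def frac_def)
    then show ?thesis
      using periodicD[OF per] by metis
  qed
  then show ?thesis
    using torus_integral_shift_axis_01[OF assms, of "frac t" i] frac_lt_1[of t] by (simp add: less_imp_le)
qed

text \<open>Translation by half a wavelength along an axis with \<open>k $ i \<noteq> 0\<close>
  changes the sign of the mode but not its integral.\<close>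

lemma torus_integral_wave:
  assumes "k \<noteq> 0"
  shows "torus_integral (wave k) = 0"
proof -
  obtain i where i: "k $ i \<noteq> 0"
    using assms by (auto simp: vec_eq_iff)
  define t where "t = 1 / (2 * of_int (k $ i) :: real)"
  have "wave k (axis i t) = -1"
    using i by (simp add: wave_def inner_axis t_def)
  then have "torus_integral (\<lambda>x. wave k (x + axis i t)) = - torus_integral (wave k)"
    using torus_integral_mult_left[of "-1" "wave k"] unfolding wave_shift by simp
  moreover have "torus_integral (\<lambda>x. wave k (x + axis i t)) = torus_integral (wave k)"
    by (rule torus_integral_shift_axis) (auto intro!: continuous_intros periodic_wave)
  ultimately have "torus_integral (wave k) + torus_integral (wave k) = 0"
    by (metis add.right_inverse)
  then have "2 * torus_integral (wave k) = 0"
    by (metis mult_2)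
  then show ?thesis
    by (metis mult_eq_0_iff zero_neq_numeral)
qed

lemma wave_orthonormal:
  fixes k l :: "int ^ 'n"
  shows "torus_integral (\<lambda>x. wave k x * cnj (wave l x)) = (if k = l then 1 else 0)"
proof -
  have eq: "(\<lambda>x. wave k x * cnj (wave l x)) = wave (k - l)"
    using wave_add[of k "- l"] by (auto simp: wave_uminus)
  have 0: "wave (0 :: int ^ 'n) = (\<lambda>x. 1)"
    by (rule ext) (rule wave_0)
  show ?thesis
  proof (cases "k = l")
    case True
    then show ?thesis
      unfolding eq by (simp only: diff_self 0 torus_integral_const) simp
  next
    case False
    then show ?thesis
      unfolding eq using torus_integral_wave[of "k - l"] by simp
  qed
qed

text \<open>Stated for any orthonormal family on a box because it serves twice: for the modes on the
  unit cube and for the exponentials of one variable on the unit interval.\<close>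

lemma orthonormal_sum_integral:
  fixes e :: "'k \<Rightarrow> 'a::euclidean_space \<Rightarrow> complex"
  assumes fin: "finite F" and cont: "\<And>k. continuous_on (cbox a b) (e k)"
    and on: "\<And>k l. integral (cbox a b) (\<lambda>x. e k x * cnj (e l x)) = (if k = l then 1 else 0)"
  shows "integral (cbox a b) (\<lambda>x. (cmod (\<Sum>k\<in>F. c k * e k x))\<^sup>2) = (\<Sum>k\<in>F. (cmod (c k))\<^sup>2)"
proof -
  have pt: "complex_of_real ((cmod (\<Sum>k\<in>F. c k * e k x))\<^sup>2)
      = (\<Sum>k\<in>F. \<Sum>l\<in>F. (c k * cnj (c l)) * (e k x * cnj (e l x)))" for x
    unfolding complex_norm_square cnj_sum sum_product complex_cnj_mult
    by (intro sum.cong refl) (simp add: mult_ac)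
  have I1: "integral (cbox a b) (\<lambda>x. \<Sum>k\<in>F. \<Sum>l\<in>F. (c k * cnj (c l)) * (e k x * cnj (e l x)))
     = (\<Sum>k\<in>F. \<Sum>l\<in>F. (c k * cnj (c l)) * integral (cbox a b) (\<lambda>x. e k x * cnj (e l x)))"
  proof -
    have 1: "continuous_on (cbox a b) (\<lambda>x. (c k * cnj (c l)) * (e k x * cnj (e l x)))" for k l
      by (intro continuous_intros cont)
    have "integral (cbox a b) (\<lambda>x. \<Sum>k\<in>F. \<Sum>l\<in>F. (c k * cnj (c l)) * (e k x * cnj (e l x)))
      = (\<Sum>k\<in>F. integral (cbox a b) (\<lambda>x. \<Sum>l\<in>F. (c k * cnj (c l)) * (e k x * cnj (e l x))))"
      by (intro integral_sum fin integrable_continuous continuous_on_sum 1)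
    also have "\<dots> = (\<Sum>k\<in>F. \<Sum>l\<in>F. integral (cbox a b) (\<lambda>x. (c k * cnj (c l)) * (e k x * cnj (e l x))))"
      by (intro sum.cong refl integral_sum fin integrable_continuous 1)
    finally show ?thesis
      by (simp only: integral_mult_right)
  qed
  have I2: "(\<Sum>k\<in>F. \<Sum>l\<in>F. (c k * cnj (c l)) * integral (cbox a b) (\<lambda>x. e k x * cnj (e l x)))
      = (\<Sum>k\<in>F. c k * cnj (c k))"
  proof (intro sum.cong refl)
    fix k assume k: "k \<in> F"
    have "(\<Sum>l\<in>F. (c k * cnj (c l)) * integral (cbox a b) (\<lambda>x. e k x * cnj (e l x)))
        = (\<Sum>l\<in>F. if k = l then c k * cnj (c l) else 0)"
      unfolding on by (intro sum.cong refl) simp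
    then show "(\<Sum>l\<in>F. (c k * cnj (c l)) * integral (cbox a b) (\<lambda>x. e k x * cnj (e l x))) = c k * cnj (c k)"
      using fin k by simp
  qed
  have I3: "complex_of_real (\<Sum>k\<in>F. (cmod (c k))\<^sup>2) = (\<Sum>k\<in>F. c k * cnj (c k))"
    unfolding of_real_sum complex_norm_square ..
  have "(\<lambda>x. (cmod (\<Sum>k\<in>F. c k * e k x))\<^sup>2) integrable_on cbox a b"
    by (intro integrable_continuous continuous_intros cont)
  then have "complex_of_real (integral (cbox a b) (\<lambda>x. (cmod (\<Sum>k\<in>F. c k * e k x))\<^sup>2))
    = integral (cbox a b) (\<lambda>x. complex_of_real ((cmod (\<Sum>k\<in>F. c k * e k x))\<^sup>2))"
    by (rule integral_linear[OF _ bounded_linear_of_real, unfolded o_def, symmetric])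
  also have "\<dots> = complex_of_real (\<Sum>k\<in>F. (cmod (c k))\<^sup>2)"
    unfolding pt I3 I1 by (rule I2)
  finally show ?thesis
    by (rule of_real_eq_iff[THEN iffD1])
qed

section \<open>Fourier coefficients of derivatives\<close>

lemma fourier_coeff_eq: "fourier_coeff V k = torus_integral (\<lambda>x. of_real (V x) * cnj (wave k x))"
proof -
  have "exp (- 2 * of_real pi * \<i> * of_real (lattice_vec k \<bullet> x)) = cnj (wave k x)" for x
    by (simp add: wave_def cis_cnj cis_conv_exp exp_cnj mult_ac)
  then show ?thesis
    by (simp add: fourier_coeff_def)
qed

lemma fourier_coeff_uminus:
  assumes "continuous_on UNIV V"
  shows "fourier_coeff V (- k) = cnj (fourier_coeff V k)"
proof -
  have "(\<lambda>x. of_real (V x) * cnj (wave k x)) integrable_on cbox 0 1"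
    using assms by (intro continuous_integrable_on_cube continuous_intros)
  then have "integral (cbox 0 1) (\<lambda>x. cnj (of_real (V x) * cnj (wave k x))) = cnj (fourier_coeff V k)"
    unfolding fourier_coeff_eq torus_integral_eq
    by (rule integral_linear[OF _ bounded_linear_cnj, unfolded o_def])
  then show ?thesis
    by (simp add: fourier_coeff_eq torus_integral_eq wave_uminus)
qed

lemma norm_fourier_coeff_le:
  assumes "continuous_on UNIV V" "\<And>x. \<bar>V x\<bar> \<le> B"
  shows "cmod (fourier_coeff V k) \<le> B"
  unfolding fourier_coeff_eq
  by (rule norm_torus_integral_le) (use assms in \<open>auto intro!: continuous_intros simp: norm_mult\<close>)

lemma axis_eq_scaleR: "axis i t = t *\<^sub>R (axis i 1 :: real ^ 'n)"
  by (simp add: vec_eq_iff axis_def)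

text \<open>The integral of \<open>f (x + t e\<^sub>i)\<close> does not depend on \<open>t\<close>, so its derivative
  at \<open>t = 0\<close> vanishes.\<close>

lemma torus_integral_derivative:
  fixes f f' :: "real ^ 'n \<Rightarrow> complex"
  assumes per: "periodic f" and cont: "continuous_on UNIV f" "continuous_on UNIV f'"
    and der: "\<And>x. ((\<lambda>t. f (x + axis i t)) has_vector_derivative f' x) (at 0)"
  shows "torus_integral f' = 0"
proof -
  \<comment> \<open>The Leibniz rule wants the derivative at every \<open>t\<close>; moving the base
    point carries the assumption at \<open>0\<close> there.\<close>
  have der': "((\<lambda>t. f (x + axis i t)) has_vector_derivative f' (x + axis i t)) (at t)" for x t
  proof -
    have "((\<lambda>s. s - t) has_vector_derivative 1) (at t)"
      by (auto intro!: derivative_eq_intros)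
    moreover have "((\<lambda>s. f ((x + axis i t) + axis i s)) has_vector_derivative f' (x + axis i t)) (at (t - t))"
      using der[of "x + axis i t"] by simp
    ultimately have "((\<lambda>s. f ((x + axis i t) + axis i (s - t))) has_vector_derivative f' (x + axis i t)) (at t)"
      using vector_diff_chain_at unfolding o_def by fastforce
    moreover have "axis i t + axis i (s - t) = axis i s" for s
      by (simp add: vec_eq_iff axis_def)
    ultimately show ?thesis
      by (simp add: add.assoc)
  qed
  have "((\<lambda>t. integral (cbox 0 1) (\<lambda>x. f (x + axis i t))) has_vector_derivative
      integral (cbox 0 1) (\<lambda>x. f' (x + axis i 0))) (at 0 within UNIV)"
  proof (rule leibniz_rule_vector_derivative)
    have "axis i t = t *\<^sub>R (axis i 1 :: real ^ 'n)" for t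
      by (rule axis_eq_scaleR)
    then have "(\<lambda>p :: real \<times> (real ^ 'n). axis i (fst p) :: real ^ 'n) = (\<lambda>p. fst p *\<^sub>R axis i 1)"
      by (rule ext)
    then have "continuous_on UNIV (\<lambda>p :: real \<times> (real ^ 'n). axis i (fst p) :: real ^ 'n)"
      by (simp only:) (intro continuous_intros)
    then have "continuous_on UNIV (\<lambda>p. f' (snd p + axis i (fst p)))"
      by (intro continuous_on_compose2[OF cont(2)] continuous_intros) auto
    then show "continuous_on (UNIV \<times> cbox 0 1) (\<lambda>(t, x). f' (x + axis i t))"
      by (auto simp: case_prod_unfold intro: continuous_on_subset)
    show "(\<lambda>x. f (x + axis i t)) integrable_on cbox 0 1" for t
      by (intro continuous_integrable_on_cube continuous_on_compose2[OF cont(1)] continuous_intros) auto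
  qed (use der' in auto)
  moreover have "(\<lambda>t. integral (cbox 0 1) (\<lambda>x. f (x + axis i t))) = (\<lambda>t. torus_integral f)"
    using torus_integral_shift_axis[OF per cont(1)] by (simp add: torus_integral_eq)
  moreover have "axis i 0 = (0 :: real ^ 'n)"
    by (simp add: vec_eq_iff axis_def)
  ultimately have "((\<lambda>t. torus_integral f) has_vector_derivative torus_integral f') (at 0)"
    by (simp add: torus_integral_eq)
  then show ?thesis
    using vector_derivative_unique_at[OF _ has_vector_derivative_const] by blast
qed

text \<open>At two points that differ by a lattice vector the same linear maps qualify as
  derivatives, so the choice made by \<open>frechet_derivative\<close> is the same at both.\<close>

lemma periodic_partial:
  assumes "periodic f"
  shows "periodic (partial i f)"
  unfolding periodic_def
proof (intro allI)
  fix x k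
  have *: "(f has_derivative D) (at x)" if "(f has_derivative D) (at (x + lattice_vec k))" for D x k
  proof -
    have "((\<lambda>y. y + lattice_vec k) has_derivative (\<lambda>h. h)) (at x)"
      by (auto intro!: derivative_eq_intros)
    from has_derivative_compose[OF this that] show ?thesis
      using periodicD[OF assms] by simp
  qed
  have "(f has_derivative D) (at (x + lattice_vec k)) \<longleftrightarrow> (f has_derivative D) (at x)" for D
    using *[of D x k] *[of D "x + lattice_vec k" "- k"] by auto
  then show "partial i f (x + lattice_vec k) = partial i f x"
    by (simp add: partial_def frechet_derivative_def)
qed

lemma has_partial_derivative:
  fixes f :: "real ^ 'n \<Rightarrow> real"
  assumes "f differentiable (at x)"
  shows "((\<lambda>t. f (x + axis i t)) has_real_derivative partial i f x) (at 0)"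
proof -
  have line: "((\<lambda>t. x + axis i t) has_derivative (\<lambda>h. h *\<^sub>R axis i 1)) (at 0)"
    by (subst axis_eq_scaleR) (auto intro!: derivative_eq_intros)
  have "(f has_derivative (\<lambda>h. grad f x \<bullet> h)) (at (x + axis i 0))"
    using has_derivative_grad[OF assms] by (simp add: axis_eq_scaleR[of i 0])
  from has_derivative_compose[OF line this] show ?thesis
    unfolding has_field_derivative_def
    by (rule has_derivative_eq_rhs) (simp add: inner_axis grad_def fun_eq_iff)
qed

text \<open>Integration by parts without boundary terms: the derivative of \<open>V\<close> times
  the conjugate mode integrates to zero over the torus.\<close>

lemma fourier_coeff_partial:
  fixes V :: "real ^ 'n \<Rightarrow> real"
  assumes "periodic V" "C_k 1 V"
  shows "fourier_coeff (partial i V) k = 2 * pi * \<i> * of_int (k $ i) * fourier_coeff V k"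
proof -
  have dV: "V differentiable (at x)" and cV': "continuous_on UNIV (partial i V)" for x
    using assms by auto
  have cV: "continuous_on UNIV V"
    using assms C_k_imp_continuous by blast
  let ?f = "\<lambda>x. of_real (V x) * cnj (wave k x)"
  let ?f' = "\<lambda>x. of_real (partial i V x) * cnj (wave k x) - (2 * pi * \<i> * of_int (k $ i)) * ?f x"
  have "torus_integral ?f' = 0"
  proof (rule torus_integral_derivative[where f = ?f])
    fix x
    have ax: "axis i 0 = (0 :: real ^ 'n)"
      by (simp add: vec_eq_iff axis_def)
    have 1: "((\<lambda>t. of_real (V (x + axis i t)) :: complex) has_vector_derivative of_real (partial i V x)) (at 0)"
      by (rule has_vector_derivative_of_real[OF has_partial_derivative[OF dV]])
    have "((\<lambda>t. cnj (wave k x) * exp (t *\<^sub>R (- 2 * pi * \<i> * of_int (k $ i)))) has_vector_derivative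
        cnj (wave k x) * (exp (0 *\<^sub>R (- 2 * pi * \<i> * of_int (k $ i))) * (- 2 * pi * \<i> * of_int (k $ i)))) (at 0)"
      by (intro has_vector_derivative_mult_right exp_scaleR_has_vector_derivative_right)
    moreover have "cnj (wave k (x + axis i t)) = cnj (wave k x) * exp (t *\<^sub>R (- 2 * pi * \<i> * of_int (k $ i)))" for t
      by (simp add: wave_shift) (simp add: wave_def inner_axis cis_cnj cis_conv_exp exp_cnj scaleR_conv_of_real mult_ac)
    ultimately have 2: "((\<lambda>t. cnj (wave k (x + axis i t))) has_vector_derivative
        cnj (wave k x) * (- 2 * pi * \<i> * of_int (k $ i))) (at 0)"
      by simp
    show "((\<lambda>t. ?f (x + axis i t)) has_vector_derivative ?f' x) (at 0)"
      using has_vector_derivative_mult[OF 1 2]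
      by (rule has_vector_derivative_eq_rhs) (simp add: ax algebra_simps)
  qed (use assms periodicD[OF periodic_wave] in \<open>auto simp: periodic_def intro!: continuous_intros cV cV'\<close>)
  then show ?thesis
    by (subst (asm) torus_integral_diff)
       (auto intro!: continuous_intros cV cV' simp: torus_integral_mult_left fourier_coeff_eq)
qed

subsection \<open>Decay of Fourier coefficients\<close>

lemma smooth_partial: "smooth_on_torus V \<Longrightarrow> smooth_on_torus (partial i V)"
  unfolding smooth_on_torus_def by (metis C_k.simps(2) periodic_partial)

lemma smooth_on_torusD:
  assumes "smooth_on_torus V"
  shows "periodic V" "continuous_on UNIV V" "C_k m V"
  using assms C_k_imp_continuous unfolding smooth_on_torus_def by auto

lemma smooth_iterated_partial:
  fixes V :: "real ^ 'n \<Rightarrow> real"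
  assumes "smooth_on_torus V"
  shows "smooth_on_torus ((partial i ^^ N) V)"
    and "fourier_coeff ((partial i ^^ N) V) k = (2 * pi * \<i> * of_int (k $ i)) ^ N * fourier_coeff V k"
proof -
  have "smooth_on_torus ((partial i ^^ N) V) \<and>
    fourier_coeff ((partial i ^^ N) V) k = (2 * pi * \<i> * of_int (k $ i)) ^ N * fourier_coeff V k"
  proof (induction N)
    case (Suc N)
    then show ?case
      using fourier_coeff_partial[OF smooth_on_torusD(1) smooth_on_torusD(3), of "(partial i ^^ N) V" i k]
      by (simp add: smooth_partial)
  qed (use assms in simp)
  then show "smooth_on_torus ((partial i ^^ N) V)"
    "fourier_coeff ((partial i ^^ N) V) k = (2 * pi * \<i> * of_int (k $ i)) ^ N * fourier_coeff V k"
    by blast+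
qed

text \<open>Each derivative in direction \<open>i\<close> multiplies the coefficient by
  \<open>2 * pi * \<i> * of_int (k $ i)\<close>, and a bounded function has bounded coefficients.
  Summing the bounds over \<open>i\<close> gives one \<open>B\<close> for all directions.\<close>

lemma fourier_coeff_decay:
  fixes V :: "real ^ 'n \<Rightarrow> real"
  assumes "smooth_on_torus V"
  obtains B where "B \<ge> 0" "\<And>k i. of_int \<bar>k $ i\<bar> ^ N * cmod (fourier_coeff V k) \<le> B"
proof -
  have "\<exists>B\<ge>0. \<forall>k. of_int \<bar>k $ i\<bar> ^ N * cmod (fourier_coeff V k) \<le> B" for i
  proof -
    let ?W = "(partial i ^^ N) V"
    have W: "smooth_on_torus ?W"
      by (rule smooth_iterated_partial(1)[OF assms])
    obtain B where B: "B \<ge> 0" "\<And>x. norm (?W x) \<le> B"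
      using periodic_bounded[OF smooth_on_torusD(1,2)[OF W]] by blast
    have "of_int \<bar>k $ i\<bar> ^ N * cmod (fourier_coeff V k) \<le> B" for k
    proof -
      have "of_int \<bar>k $ i\<bar> ^ N * cmod (fourier_coeff V k)
          \<le> (2 * pi * of_int \<bar>k $ i\<bar>) ^ N * cmod (fourier_coeff V k)"
        using pi_ge_two by (intro mult_right_mono power_mono) (auto simp: mult_le_cancel_right1)
      also have "\<dots> = cmod (fourier_coeff ?W k)"
        by (simp add: smooth_iterated_partial(2)[OF assms] norm_mult norm_power)
      also have "\<dots> \<le> B"
        using norm_fourier_coeff_le[OF smooth_on_torusD(2)[OF W]] B by simp
      finally show ?thesis .
    qed
    with B(1) show ?thesis by blast
  qed
  then obtain B where B: "\<And>i. B i \<ge> 0" "\<And>i k. of_int \<bar>k $ i\<bar> ^ N * cmod (fourier_coeff V k) \<le> B i"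
    by metis
  show ?thesis
  proof (rule that)
    show "0 \<le> (\<Sum>i\<in>UNIV. B i)"
      by (intro sum_nonneg B)
    show "of_int \<bar>k $ i\<bar> ^ N * cmod (fourier_coeff V k) \<le> (\<Sum>i\<in>UNIV. B i)" for k i
      using B(2)[of k i] member_le_sum[of i UNIV B] B(1) by force
  qed
qed

lemma sum_inverse_square_int_le:
  assumes "finite A"
  shows "(\<Sum>m\<in>A. 1 / (1 + (of_int m)\<^sup>2)) \<le> (5 :: real)"
proof -
  have "finite ((\<lambda>m. nat \<bar>m\<bar>) ` A)"
    using assms by simp
  then obtain J where "\<forall>j\<in>(\<lambda>m. nat \<bar>m\<bar>) ` A. j \<le> J"
    using finite_nat_set_iff_bounded_le by blast
  then have A: "A \<subseteq> {- int J..int J}"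
    by (force simp: nat_le_iff abs_le_iff)
  \<comment> \<open>The bound is sharpened so that the induction closes: it is an equality for
    \<open>J = 0\<close>, and the two terms added at each step are at most the telescoping
    difference \<open>4 / (J + 1) - 4 / (J + 2)\<close>.\<close>
  have "(\<Sum>m\<in>{- int J..int J}. 1 / (1 + (of_int m)\<^sup>2)) \<le> (5 :: real) - 4 / (of_nat J + 1)"
  proof (induction J)
    case (Suc J)
    have "{- int (Suc J)..int (Suc J)} = insert (- int (Suc J)) (insert (int (Suc J)) {- int J..int J})"
      by auto
    moreover have "- int (Suc J) \<notin> insert (int (Suc J)) {- int J..int J}" "int (Suc J) \<notin> {- int J..int J}"
      by auto
    ultimately have "(\<Sum>m\<in>{- int (Suc J)..int (Suc J)}. 1 / (1 + (of_int m)\<^sup>2))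
        = 2 / (1 + (of_nat J + 1)\<^sup>2) + (\<Sum>m\<in>{- int J..int J}. 1 / (1 + (of_int m)\<^sup>2) :: real)"
      by (simp add: power2_eq_square algebra_simps)
    moreover have "2 / (1 + (of_nat J + 1)\<^sup>2) \<le> 4 / (of_nat J + 1) - 4 / (of_nat J + (2::real))"
    proof -
      have "4 / (of_nat J + 1) - 4 / (of_nat J + (2::real)) = 4 / ((of_nat J + 1) * (of_nat J + 2))"
        by (simp add: field_simps)
      moreover have "2 / y \<le> 4 / w" if "0 < y" "0 < w" "2 * w \<le> 4 * y" for y w :: real
        using that by (simp add: field_simps)
      from this[of "1 + (of_nat J + 1)\<^sup>2" "(of_nat J + 1) * (of_nat J + 2)"]
      have "2 / (1 + (of_nat J + 1)\<^sup>2) \<le> 4 / ((of_nat J + 1) * (of_nat J + (2::real)))"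
        by (simp add: power2_eq_square algebra_simps add_pos_nonneg)
      ultimately show ?thesis by simp
    qed
    moreover have "of_nat (Suc J) + 1 = of_nat J + (2 :: real)"
      by simp
    ultimately have "(\<Sum>m\<in>{- int (Suc J)..int (Suc J)}. 1 / (1 + (of_int m)\<^sup>2))
        \<le> (4 / (of_nat J + 1) - 4 / (of_nat J + (2::real))) + (5 - 4 / (of_nat J + 1))"
      using Suc.IH by (simp only: add_mono)
    also have "\<dots> = 5 - 4 / (of_nat J + (2::real))"
      by (rule add_diff_eq[THEN trans]) simp
    finally show ?case
      by (simp only: \<open>of_nat (Suc J) + 1 = of_nat J + (2 :: real)\<close>)
  qed simp
  moreover have "(\<Sum>m\<in>A. 1 / (1 + (of_int m)\<^sup>2)) \<le> (\<Sum>m\<in>{- int J..int J}. 1 / (1 + (of_int m)\<^sup>2) :: real)"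
    by (intro sum_mono2 A) (auto simp: add_nonneg_nonneg)
  moreover have "0 \<le> 4 / (of_nat J + (1::real))"
    by simp
  ultimately show ?thesis by linarith
qed

text \<open>Enlarging a finite set of frequencies to a product set makes the sum factor over the
  coordinates, so every finite sum is at most \<open>5\<close> to the power of the
  dimension.\<close>

lemma summable_lattice_weight:
  "(\<lambda>k :: int ^ 'n. \<Prod>i\<in>UNIV. 1 / (1 + (of_int (k $ i))\<^sup>2) :: real) summable_on UNIV"
proof (rule nonneg_bdd_above_summable_on)
  show "bdd_above (sum (\<lambda>k :: int ^ 'n. \<Prod>i\<in>UNIV. 1 / (1 + (of_int (k $ i))\<^sup>2) :: real) ` {F. F \<subseteq> UNIV \<and> finite F})"
  proof (rule bdd_aboveI2)
    fix F :: "(int ^ 'n) set" assume "F \<in> {F. F \<subseteq> UNIV \<and> finite F}"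
    then have F: "finite F" by simp
    define A where "A = (\<Union>i. (\<lambda>k. k $ i) ` F)"
    have A: "finite A" using F by (simp add: A_def)
    have "(\<Sum>k\<in>F. \<Prod>i\<in>UNIV. 1 / (1 + (of_int (k $ i))\<^sup>2)) = (\<Sum>g\<in>vec_nth ` F. \<Prod>i\<in>UNIV. 1 / (1 + (of_int (g i))\<^sup>2) :: real)"
      by (subst sum.reindex) (auto simp: inj_on_def vec_nth_inject)
    also have "\<dots> \<le> (\<Sum>g\<in>Pi\<^sub>E (UNIV :: 'n set) (\<lambda>_. A). \<Prod>i\<in>UNIV. 1 / (1 + (of_int (g i))\<^sup>2) :: real)"
    proof (rule sum_mono2)
      show "finite (Pi\<^sub>E UNIV (\<lambda>_ :: 'n. A))"
        using A by (intro finite_PiE) auto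
    qed (auto simp: A_def intro!: prod_nonneg)
    also have "\<dots> = (\<Prod>i\<in>(UNIV :: 'n set). \<Sum>m\<in>A. 1 / (1 + (of_int m)\<^sup>2))"
      by (rule prod_sum_PiE[symmetric]) (use A in auto)
    also have "\<dots> \<le> (\<Prod>i\<in>(UNIV :: 'n set). 5)"
      by (intro prod_mono conjI sum_nonneg sum_inverse_square_int_le A) auto
    finally show "(\<Sum>k\<in>F. \<Prod>i\<in>UNIV. 1 / (1 + (of_int (k $ i))\<^sup>2)) \<le> (\<Prod>i\<in>(UNIV :: 'n set). 5 :: real)" .
  qed
qed (auto intro!: prod_nonneg)

text \<open>The cubic weight pays for three derivatives of any part of the Fourier series, which
  makes the one-dimensional expansion uniform in the frequency cutoff.\<close>

lemma summable_fourier_coeff_cubic: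
  fixes V :: "real ^ 'n \<Rightarrow> real"
  assumes "smooth_on_torus V"
  shows "(\<lambda>k. cmod (fourier_coeff V k) * (1 + norm (lattice_vec k)) ^ 3) summable_on UNIV"
proof -
  let ?n = "CARD('n)"
  \<comment> \<open>Three powers pay for the weight, and two per coordinate for the product of the
    \<open>1 + (of_int (k $ i))\<^sup>2\<close> in the summable majorant.\<close>
  define N where "N = 2 * ?n + 3"
  obtain B where B: "B \<ge> 0" "\<And>k i. of_int \<bar>k $ i\<bar> ^ N * cmod (fourier_coeff V k) \<le> B"
    using fourier_coeff_decay[OF assms] by blast
  obtain B0 where B0: "B0 \<ge> 0" "\<And>k i. of_int \<bar>k $ i\<bar> ^ 0 * cmod (fourier_coeff V k) \<le> B0"
    using fourier_coeff_decay[OF assms] by blast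
  define w where "w k = (\<Prod>i\<in>UNIV. 1 / (1 + (of_int (k $ i))\<^sup>2) :: real)" for k :: "int ^ 'n"
  define C where "C = real ?n ^ 3 * (2 ^ N * (B0 + B))"
  have n1: "real ?n \<ge> 1"
    by (simp add: Suc_leI)
  have "cmod (fourier_coeff V k) * (1 + norm (lattice_vec k)) ^ 3 \<le> C * w k" for k
  proof -
    \<comment> \<open>Decay is used only in the coordinate of largest modulus, which controls all
      the others and the norm.\<close>
    define m where "m = (MAX i. \<bar>k $ i\<bar>)"
    have le_m: "\<bar>k $ i\<bar> \<le> m" for i
      by (simp add: m_def)
    have "m \<in> range (\<lambda>i. \<bar>k $ i\<bar>)"
      unfolding m_def by (rule Max_in) auto
    then obtain i0 where i0: "m = \<bar>k $ i0\<bar>" by blast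
    define r where "r = 1 + real_of_int m"
    have m0: "m \<ge> 0" and r1: "r \<ge> 1"
      using i0 by (auto simp: r_def)
    let ?L = "cmod (fourier_coeff V k)"
    have "r ^ N \<le> 2 ^ N * (1 + real_of_int m ^ N)"
    proof (cases "m = 0")
      case False
      then have "r \<le> 2 * real_of_int m" using m0 by (simp add: r_def)
      then have "r ^ N \<le> (2 * real_of_int m) ^ N" using r1 by (intro power_mono) auto
      also have "\<dots> \<le> 2 ^ N * (1 + real_of_int m ^ N)"
        by (simp add: power_mult_distrib)
      finally show ?thesis .
    next
      case True
      have "1 * 1 \<le> 2 ^ N * (1 + 0 ^ N :: real)"
        by (intro mult_mono) auto
      with True show ?thesis by (simp add: r_def)
    qed
    then have "r ^ N * ?L \<le> 2 ^ N * (1 + real_of_int m ^ N) * ?L"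
      by (intro mult_right_mono) auto
    also have "\<dots> = 2 ^ N * (?L + real_of_int m ^ N * ?L)"
      by (simp add: algebra_simps)
    also have "\<dots> \<le> 2 ^ N * (B0 + B)"
      using B(2)[of k i0] B0(2)[of k] i0 by (intro mult_left_mono add_mono) auto
    finally have 1: "r ^ N * ?L \<le> 2 ^ N * (B0 + B)" .
    have "norm (lattice_vec k) \<le> (\<Sum>i\<in>UNIV. \<bar>lattice_vec k $ i\<bar>)"
      by (rule norm_le_l1_cart)
    also have "\<dots> \<le> (\<Sum>i\<in>(UNIV :: 'n set). real_of_int m)"
      using le_m by (intro sum_mono) (simp flip: of_int_abs)
    finally have "1 + norm (lattice_vec k) \<le> real ?n * r"
      using n1 unfolding r_def distrib_left by (simp only: sum_constant)
    then have 2: "(1 + norm (lattice_vec k)) ^ 3 \<le> real ?n ^ 3 * r ^ 3"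
      by (metis add_nonneg_nonneg norm_ge_zero power_mono power_mult_distrib zero_le_one)
    have "(\<Prod>i\<in>UNIV. 1 + (real_of_int (k $ i))\<^sup>2) \<le> (\<Prod>i\<in>(UNIV :: 'n set). r\<^sup>2)"
    proof (intro prod_mono conjI)
      fix i
      have "(real_of_int (k $ i))\<^sup>2 \<le> (real_of_int m)\<^sup>2"
        using le_m[of i] by (metis abs_of_nonneg m0 of_int_abs of_int_le_iff power2_abs power_mono abs_ge_zero of_int_0_le_iff)
      then show "1 + (real_of_int (k $ i))\<^sup>2 \<le> r\<^sup>2"
        using m0 by (simp add: r_def power2_eq_square algebra_simps)
    qed (simp add: add_nonneg_nonneg)
    then have 3: "(\<Prod>i\<in>UNIV. 1 + (real_of_int (k $ i))\<^sup>2) \<le> r ^ (2 * ?n)"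
      by (simp add: power_mult)
    have P0: "0 < (\<Prod>i\<in>UNIV. 1 + (real_of_int (k $ i))\<^sup>2)"
      by (intro prod_pos) (auto simp: add_pos_nonneg)
    have "?L * (1 + norm (lattice_vec k)) ^ 3 * (\<Prod>i\<in>UNIV. 1 + (real_of_int (k $ i))\<^sup>2)
        \<le> ?L * (real ?n ^ 3 * r ^ 3) * r ^ (2 * ?n)"
      using r1 P0 by (intro mult_mono mult_left_mono 2 3) auto
    also have "\<dots> = real ?n ^ 3 * (r ^ N * ?L)"
      by (simp add: N_def power_add)
    also have "\<dots> \<le> C"
      unfolding C_def by (intro mult_left_mono 1) auto
    finally have "?L * (1 + norm (lattice_vec k)) ^ 3 \<le> C / (\<Prod>i\<in>UNIV. 1 + (real_of_int (k $ i))\<^sup>2)"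
      using P0 by (simp add: field_simps)
    then show ?thesis
      by (simp add: w_def prod_dividef)
  qed
  moreover have "(\<lambda>k. C * w k) summable_on UNIV"
    unfolding w_def by (intro summable_on_cmult_right summable_lattice_weight)
  ultimately show ?thesis
    by (rule_tac summable_on_comparison_test) auto
qed

lemma summable_fourier_coeff:
  fixes V :: "real ^ 'n \<Rightarrow> real"
  assumes "smooth_on_torus V"
  shows "(\<lambda>k. cmod (fourier_coeff V k)) summable_on UNIV"
  by (rule summable_on_comparison_test[OF summable_fourier_coeff_cubic[OF assms]])
     (auto simp: mult_le_cancel_left1)

subsection \<open>Fourier inversion and Parseval's identity\<close>

lemma continuous_nonneg_torus_integral_0:
  fixes f :: "real ^ 'n \<Rightarrow> real"
  assumes "periodic f" "continuous_on UNIV f" "\<And>x. f x \<ge> 0" "torus_integral f = 0"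
  shows "f x = 0"
proof -
  have "f y = 0" if "y \<in> cbox 0 1" for y
  proof -
    have "box 0 (1 :: real ^ 'n) \<noteq> {}"
      by (simp add: interval_eq_empty_cart)
    moreover have "integral (cbox 0 1) f = 0"
      using assms(4) by (simp add: torus_integral_eq)
    ultimately show ?thesis
      using integral_cbox_eq_0_iff[of 0 1 f] assms(2,3) that continuous_on_subset by blast
  qed
  then show ?thesis
    using cube_representative[of x] periodicD[OF assms(1)] by metis
qed

text \<open>Such an \<open>f\<close> is orthogonal to every trigonometric polynomial. If
  \<open>T\<close> is uniformly close to \<open>f\<close>, the integral of \<open>f\<^sup>2\<close>
  equals that of \<open>f (f - T)\<close> and is therefore arbitrarily small.\<close>

lemma fourier_uniqueness:
  fixes f :: "real ^ 'n \<Rightarrow> real"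
  assumes per: "periodic f" and cont: "continuous_on UNIV f" and z: "\<And>k. fourier_coeff f k = 0"
  shows "f x = 0"
proof -
  have T: "torus_integral (\<lambda>x. f x * T x) = 0" if "trig_poly T" for T
    using that
  proof induction
    case (single c k)
    let ?g = "\<lambda>x. c * (of_real (f x) * cnj (wave (- k) x))"
    have "torus_integral ?g = 0"
      unfolding torus_integral_mult_left using z[of "- k"] by (simp only: fourier_coeff_eq) simp
    moreover have "?g integrable_on cbox 0 1"
      by (intro continuous_integrable_on_cube continuous_intros cont)
    then have "integral (cbox 0 1) (\<lambda>x. Re (?g x)) = Re (integral (cbox 0 1) ?g)"
      by (rule integral_linear[OF _ bounded_linear_Re, unfolded o_def])
    moreover have "Re (?g x) = f x * Re (c * wave k x)" for x
      by (simp add: wave_uminus algebra_simps)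
    ultimately show ?case
      by (simp only: torus_integral_eq) simp
  next
    case (add g h)
    then have "torus_integral (\<lambda>x. f x * g x + f x * h x) = 0"
      by (subst torus_integral_add) (auto intro!: continuous_on_mult cont intro: continuous_on_trig_poly)
    then show ?case
      by (simp add: distrib_left)
  qed
  obtain B where B: "B \<ge> 0" "\<And>x. norm (f x) \<le> B"
    using periodic_bounded[OF per cont] by blast
  have "\<bar>torus_integral (\<lambda>x. f x * f x)\<bar> \<le> 0 + e" if "e > 0" for e
  proof -
    have e: "e / (B + 1) > 0" using that B by simp
    obtain T where tp: "trig_poly T" and T2: "\<And>x. \<bar>f x - T x\<bar> < e / (B + 1)"
      using trig_poly_dense[OF per cont e] by blast
    have cT: "continuous_on UNIV T" by (rule continuous_on_trig_poly[OF tp])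
    have "torus_integral (\<lambda>x. f x * f x - f x * T x) = torus_integral (\<lambda>x. f x * f x)"
      by (subst torus_integral_diff) (auto intro!: continuous_intros cont cT simp: T[OF tp])
    moreover have "norm (torus_integral (\<lambda>x. f x * f x - f x * T x)) \<le> B * (e / (B + 1))"
    proof (rule norm_torus_integral_le)
      show "norm (f x * f x - f x * T x) \<le> B * (e / (B + 1))" for x
        using B T2[of x] by (simp add: right_diff_distrib[symmetric] abs_mult mult_mono del: times_divide_eq_right)
    qed (intro continuous_intros cont cT)
    moreover have "B * (e / (B + 1)) \<le> e"
      using B that by (simp add: field_simps)
    ultimately show ?thesis by simp
  qed
  then have "torus_integral (\<lambda>x. f x * f x) = 0"
    using field_le_epsilon[of "\<bar>torus_integral (\<lambda>x. f x * f x)\<bar>" 0] by simp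
  then have "f x * f x = 0"
    by (intro continuous_nonneg_torus_integral_0[where f = "\<lambda>x. f x * f x"])
       (use per in \<open>auto simp: periodic_def intro!: continuous_intros cont\<close>)
  then show ?thesis by simp
qed

text \<open>Finite, increasing and exhausting; also invariant under negation, which makes partial
  Fourier sums of a real function real.\<close>

definition freq_box :: "nat \<Rightarrow> (int ^ 'n) set" where
  "freq_box N = {k. \<forall>i. \<bar>k $ i\<bar> \<le> int N}"

lemma finite_freq_box [simp]: "finite (freq_box N :: (int ^ 'n) set)"
proof -
  have "vec_nth ` (freq_box N :: (int ^ 'n) set) \<subseteq> Pi\<^sub>E UNIV (\<lambda>_. {- int N..int N})"
    by (auto simp: freq_box_def abs_le_iff minus_le_iff)
  moreover have "finite (Pi\<^sub>E (UNIV :: 'n set) (\<lambda>_. {- int N..int N}))"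
    by (intro finite_PiE) auto
  ultimately have "finite (vec_nth ` (freq_box N :: (int ^ 'n) set))"
    by (rule finite_subset)
  then show ?thesis
    by (rule finite_imageD) (auto simp: inj_on_def vec_nth_inject)
qed

lemma uminus_freq_box [simp]: "- k \<in> freq_box N \<longleftrightarrow> k \<in> freq_box N"
  by (simp add: freq_box_def)

lemma freq_box_mono: "N \<le> M \<Longrightarrow> freq_box N \<subseteq> freq_box M"
  by (auto simp: freq_box_def intro: order_trans)

lemma finite_subset_freq_box:
  fixes F :: "(int ^ 'n) set"
  assumes "finite F"
  obtains N where "F \<subseteq> freq_box N"
proof -
  have "finite (\<Union>i. (\<lambda>k. nat \<bar>k $ i\<bar>) ` F)"
    using assms by simp
  then obtain N where "\<forall>j\<in>(\<Union>i. (\<lambda>k. nat \<bar>k $ i\<bar>) ` F). j \<le> N"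
    using finite_nat_set_iff_bounded_le by blast
  then have "F \<subseteq> freq_box N"
    by (auto simp: freq_box_def nat_le_iff)
  then show ?thesis using that by blast
qed

lemma summable_tail_small:
  fixes f :: "int ^ 'n \<Rightarrow> real"
  assumes s: "f summable_on UNIV" and nn: "\<And>k. f k \<ge> 0" and e: "e > 0"
  obtains N0 where "\<And>N. N \<ge> N0 \<Longrightarrow> infsum f (- freq_box N) < e"
proof -
  have "eventually (\<lambda>F. dist (sum f F) (infsum f UNIV) < e) (finite_subsets_at_top UNIV)"
    using has_sum_infsum[OF s] e unfolding has_sum_def tendsto_iff by blast
  then obtain F where F: "finite F" "\<And>G. finite G \<Longrightarrow> F \<subseteq> G \<Longrightarrow> dist (sum f G) (infsum f UNIV) < e"
    unfolding eventually_finite_subsets_at_top by auto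
  obtain N0 where N0: "F \<subseteq> freq_box N0"
    using finite_subset_freq_box[OF F(1)] by blast
  show ?thesis
  proof
    fix N assume "N \<ge> N0"
    then have "F \<subseteq> freq_box N"
      using N0 freq_box_mono by blast
    then have "dist (sum f (freq_box N)) (infsum f UNIV) < e"
      by (intro F) auto
    moreover have "infsum f (- freq_box N) = infsum f UNIV - infsum f (freq_box N)"
      unfolding Compl_eq_Diff_UNIV by (rule infsum_Diff[OF s]) (auto intro: summable_on_finite)
    ultimately show "infsum f (- freq_box N) < e"
      by (simp add: dist_real_def abs_less_iff)
  qed
qed

lemma summable_tail_tendsto_0:
  fixes f :: "int ^ 'n \<Rightarrow> real"
  assumes s: "f summable_on UNIV" and nn: "\<And>k. f k \<ge> 0"
  shows "(\<lambda>N. infsum f (- freq_box N)) \<longlonglongrightarrow> 0"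
proof (rule LIMSEQ_I)
  fix r :: real assume "r > 0"
  then obtain N0 where "\<And>N. N \<ge> N0 \<Longrightarrow> infsum f (- freq_box N) < r"
    using summable_tail_small[OF s nn] by blast
  moreover have "infsum f (- freq_box N) \<ge> 0" for N
    by (intro infsum_nonneg nn)
  ultimately show "\<exists>N0. \<forall>N\<ge>N0. norm (infsum f (- freq_box N) - 0) < r"
    by auto
qed

definition fourier_sum :: "(real ^ 'n \<Rightarrow> real) \<Rightarrow> nat \<Rightarrow> real ^ 'n \<Rightarrow> real" where
  "fourier_sum V N x = (\<Sum>k\<in>freq_box N. Re (fourier_coeff V k * wave k x))"

text \<open>Reindexing by negation shows that the complex sum is its own conjugate, so nothing is
  lost by taking real parts termwise.\<close>

lemma of_real_symmetric_sum:
  assumes fin: "finite F" and sym: "\<And>k. - k \<in> F \<longleftrightarrow> k \<in> F" and c: "\<And>k. c (- k) = cnj (c k)"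
  shows "of_real (\<Sum>k\<in>F. Re (c k)) = (\<Sum>k\<in>(F :: 'a::group_add set). c k)"
proof -
  have "(\<Sum>k\<in>F. c (- k)) = (\<Sum>k\<in>F. c k)"
    by (rule sum.reindex_bij_witness[of _ uminus uminus]) (auto simp: sym)
  then have "cnj (\<Sum>k\<in>F. c k) = (\<Sum>k\<in>F. c k)"
    by (simp add: c)
  then have "Im (\<Sum>k\<in>F. c k) = 0"
    by (metis Im_complex_of_real Reals_cases Reals_cnj_iff)
  then show ?thesis
    by (auto simp: complex_eq_iff)
qed

lemma of_real_fourier_sum:
  assumes "continuous_on UNIV V"
  shows "of_real (fourier_sum V N x) = (\<Sum>k\<in>freq_box N. fourier_coeff V k * wave k x)"
  unfolding fourier_sum_def
  by (rule of_real_symmetric_sum) (auto simp: fourier_coeff_uminus[OF assms] wave_uminus)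

lemma continuous_on_fourier_sum: "continuous_on S (fourier_sum V N)"
  unfolding fourier_sum_def[abs_def] by (intro continuous_intros)

lemma fourier_coeff_fourier_sum:
  assumes "continuous_on UNIV V"
  shows "fourier_coeff (fourier_sum V N) l = (if l \<in> freq_box N then fourier_coeff V l else 0)"
proof -
  have "fourier_coeff (fourier_sum V N) l
      = torus_integral (\<lambda>x. \<Sum>k\<in>freq_box N. fourier_coeff V k * (wave k x * cnj (wave l x)))"
    unfolding fourier_coeff_eq[of "fourier_sum V N"] of_real_fourier_sum[OF assms] sum_distrib_right mult.assoc ..
  also have "\<dots> = (\<Sum>k\<in>freq_box N. fourier_coeff V k * torus_integral (\<lambda>x. wave k x * cnj (wave l x)))"
    by (subst torus_integral_sum) (auto simp: torus_integral_mult_left intro!: continuous_intros)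
  also have "\<dots> = (\<Sum>k\<in>freq_box N. if k = l then fourier_coeff V k else 0)"
    unfolding wave_orthonormal by (intro sum.cong) auto
  finally show ?thesis by simp
qed

text \<open>The absolutely convergent Fourier series of \<open>V\<close> has the same coefficients as \<open>V\<close>.\<close>

lemma fourier_sum_error:
  fixes V :: "real ^ 'n \<Rightarrow> real"
  assumes V: "smooth_on_torus V"
  shows "\<bar>V x - fourier_sum V N x\<bar> \<le> infsum (\<lambda>k. cmod (fourier_coeff V k)) (- freq_box N)"
proof -
  let ?c = "fourier_coeff V"
  have cont: "continuous_on UNIV V" and per: "periodic V"
    using smooth_on_torusD[OF V] by auto
  note s = summable_fourier_coeff[OF V]
  have sA: "(\<lambda>k. cmod (?c k)) summable_on A" for A
    by (rule summable_on_subset_banach[OF s]) auto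
  define R where "R x = infsum (\<lambda>k. Re (?c k * wave k x)) UNIV" for x
  have tail: "\<bar>R x - fourier_sum V N x\<bar> \<le> infsum (\<lambda>k. cmod (?c k)) (- freq_box N)" for x N
  proof -
    have le: "\<bar>Re (?c k * wave k x)\<bar> \<le> cmod (?c k)" for k
      using abs_Re_le_cmod[of "?c k * wave k x"] by (simp add: norm_mult)
    have abs: "(\<lambda>k. norm (Re (?c k * wave k x))) summable_on A" for A
      by (rule summable_on_comparison_test[OF sA]) (use le in auto)
    then have sm: "(\<lambda>k. Re (?c k * wave k x)) summable_on A" for A
      by (rule abs_summable_summable)
    have "R x - fourier_sum V N x = infsum (\<lambda>k. Re (?c k * wave k x)) (- freq_box N)"
      unfolding Compl_eq_Diff_UNIV R_def fourier_sum_def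
      by (subst infsum_Diff[OF sm sm]) auto
    also have "\<bar>\<dots>\<bar> \<le> infsum (\<lambda>k. norm (Re (?c k * wave k x))) (- freq_box N)"
      using norm_infsum_bound[OF abs] by simp
    also have "\<dots> \<le> infsum (\<lambda>k. cmod (?c k)) (- freq_box N)"
      by (rule infsum_mono[OF abs sA]) (use le in auto)
    finally show ?thesis .
  qed
  have small: "\<exists>N0. \<forall>N\<ge>N0. infsum (\<lambda>k. cmod (?c k)) (- freq_box N) < e" if "e > 0" for e
    using summable_tail_small[OF s norm_ge_zero that] by blast
  have "uniform_limit UNIV (fourier_sum V) R sequentially"
    unfolding uniform_limit_sequentially_iff
  proof (intro allI impI)
    fix e :: real assume "e > 0"
    then obtain N0 where "\<forall>N\<ge>N0. infsum (\<lambda>k. cmod (?c k)) (- freq_box N) < e"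
      using small by blast
    then show "\<exists>N0. \<forall>n\<ge>N0. \<forall>x\<in>UNIV. dist (fourier_sum V n x) (R x) < e"
      using tail by (metis abs_minus_commute dist_real_def order_le_less_trans)
  qed
  then have contR: "continuous_on UNIV R"
    by (rule uniform_limit_theorem[rotated]) (auto intro!: always_eventually continuous_on_fourier_sum)
  have perR: "periodic R"
    by (simp add: periodic_def R_def periodicD[OF periodic_wave])
  have fcR: "fourier_coeff R l = ?c l" for l
  proof -
    have "cmod (fourier_coeff R l - ?c l) \<le> 0 + e" if e: "e > 0" for e
    proof -
      obtain N0 where N0: "\<And>N. N \<ge> N0 \<Longrightarrow> infsum (\<lambda>k. cmod (?c k)) (- freq_box N) < e"
        using small[OF e] by blast
      obtain N1 where "{l} \<subseteq> freq_box N1"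
        using finite_subset_freq_box[of "{l}"] by blast
      then have l: "l \<in> freq_box (max N0 N1)"
        using freq_box_mono[of N1 "max N0 N1"] by auto
      let ?N = "max N0 N1"
      have "fourier_coeff R l - ?c l = fourier_coeff R l - fourier_coeff (fourier_sum V ?N) l"
        using l by (simp add: fourier_coeff_fourier_sum[OF cont])
      also have "\<dots> = fourier_coeff (\<lambda>x. R x - fourier_sum V ?N x) l"
        unfolding fourier_coeff_eq
        by (subst torus_integral_diff[symmetric])
           (auto intro!: continuous_intros contR continuous_on_fourier_sum simp: left_diff_distrib)
      also have "cmod \<dots> \<le> e"
      proof (rule norm_fourier_coeff_le)
        show "\<bar>R x - fourier_sum V ?N x\<bar> \<le> e" for x
          using tail[of x ?N] N0[of ?N] by simp
      qed (intro continuous_intros contR continuous_on_fourier_sum)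
      finally show ?thesis by simp
    qed
    then show ?thesis
      using field_le_epsilon[of "cmod (fourier_coeff R l - ?c l)" 0] by simp
  qed
  \<comment> \<open>\<open>R\<close> is continuous as a uniform limit, so equality of all
    coefficients gives equality at every point, and the tail bound for \<open>R\<close> becomes one
    for \<open>V\<close>.\<close>
  have "V x - R x = 0"
  proof (rule fourier_uniqueness[where f = "\<lambda>x. V x - R x"])
    show "fourier_coeff (\<lambda>x. V x - R x) k = 0" for k
    proof -
      have "fourier_coeff (\<lambda>x. V x - R x) k = ?c k - fourier_coeff R k"
        unfolding fourier_coeff_eq
        by (subst torus_integral_diff[symmetric])
           (auto intro!: continuous_intros contR cont simp: left_diff_distrib)
      then show ?thesis by (simp add: fcR)
    qed
  qed (use per perR in \<open>auto intro!: continuous_intros cont contR periodic_diff\<close>)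
  then show ?thesis
    using tail[of x N] by simp
qed

text \<open>Orthonormality gives the identity for partial sums \<open>S\<close>. The factorisation
  of \<open>V\<^sup>2 - S\<^sup>2\<close> as \<open>(V + S) (V - S)\<close> and the uniform tail
  bound carry it to the limit.\<close>

lemma parseval:
  fixes V :: "real ^ 'n \<Rightarrow> real"
  assumes V: "smooth_on_torus V"
  shows "((\<lambda>k. (cmod (fourier_coeff V k))\<^sup>2) has_sum torus_integral (\<lambda>x. (V x)\<^sup>2)) UNIV"
proof -
  let ?c = "fourier_coeff V" and ?t = "\<lambda>N. infsum (\<lambda>k. cmod (fourier_coeff V k)) (- freq_box N)"
  have cont: "continuous_on UNIV V" and per: "periodic V"
    using smooth_on_torusD[OF V] by auto
  obtain B where B: "B \<ge> 0" "\<And>x. \<bar>V x\<bar> \<le> B"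
    using periodic_bounded[OF per cont] by auto
  have "(\<lambda>k. B * cmod (?c k)) summable_on UNIV"
    by (intro summable_on_cmult_right summable_fourier_coeff[OF V])
  then have s2: "(\<lambda>k. (cmod (?c k))\<^sup>2) summable_on UNIV"
    by (rule summable_on_comparison_test)
       (use norm_fourier_coeff_le[OF cont B(2)] in \<open>auto simp: power2_eq_square mult_right_mono\<close>)
  have err: "\<bar>torus_integral (\<lambda>x. (V x)\<^sup>2) - (\<Sum>k\<in>freq_box N. (cmod (?c k))\<^sup>2)\<bar> \<le> (2 * B + ?t N) * ?t N" for N
  proof -
    have eq: "(\<Sum>k\<in>freq_box N. (cmod (?c k))\<^sup>2) = torus_integral (\<lambda>x. (fourier_sum V N x)\<^sup>2)"
    proof -
      have "(fourier_sum V N x)\<^sup>2 = (cmod (\<Sum>k\<in>freq_box N. ?c k * wave k x))\<^sup>2" for x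
        unfolding of_real_fourier_sum[OF cont, symmetric] by simp
      then show ?thesis
        using orthonormal_sum_integral[of "freq_box N" 0 1 wave ?c, OF _ continuous_on_wave[OF continuous_on_id]
            wave_orthonormal[unfolded torus_integral_eq]]
        by (simp add: torus_integral_eq)
    qed
    have pt: "\<bar>(V x)\<^sup>2 - (fourier_sum V N x)\<^sup>2\<bar> \<le> (2 * B + ?t N) * ?t N" for x
    proof -
      have 1: "\<bar>V x - fourier_sum V N x\<bar> \<le> ?t N"
        by (rule fourier_sum_error[OF V])
      then have 2: "\<bar>V x + fourier_sum V N x\<bar> \<le> 2 * B + ?t N"
        using B(2)[of x] by linarith
      have "(V x)\<^sup>2 - (fourier_sum V N x)\<^sup>2 = (V x + fourier_sum V N x) * (V x - fourier_sum V N x)"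
        by (simp add: power2_eq_square algebra_simps)
      then show ?thesis
        using 1 2 by (simp add: abs_mult mult_mono)
    qed
    have "norm (torus_integral (\<lambda>x. (V x)\<^sup>2 - (fourier_sum V N x)\<^sup>2)) \<le> (2 * B + ?t N) * ?t N"
      by (rule norm_torus_integral_le) (use pt in \<open>auto intro!: continuous_intros cont continuous_on_fourier_sum\<close>)
    then show ?thesis
      unfolding eq by (subst (asm) torus_integral_diff) (auto intro!: continuous_intros cont continuous_on_fourier_sum)
  qed
  have t0: "?t \<longlonglongrightarrow> 0"
    by (rule summable_tail_tendsto_0[OF summable_fourier_coeff[OF V] norm_ge_zero])
  have "(\<lambda>N. (2 * B + ?t N) * ?t N) \<longlonglongrightarrow> (2 * B + 0) * 0"
    by (intro tendsto_intros t0)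
  then have "(\<lambda>N. torus_integral (\<lambda>x. (V x)\<^sup>2) - (\<Sum>k\<in>freq_box N. (cmod (?c k))\<^sup>2)) \<longlonglongrightarrow> 0"
    by (rule_tac Lim_null_comparison[rotated]) (use err in auto)
  then have "(\<lambda>N. (\<Sum>k\<in>freq_box N. (cmod (?c k))\<^sup>2)) \<longlonglongrightarrow> torus_integral (\<lambda>x. (V x)\<^sup>2)"
    using tendsto_diff[OF tendsto_const[of "torus_integral (\<lambda>x. (V x)\<^sup>2)"]] by fastforce
  moreover have "(\<lambda>N. (\<Sum>k\<in>freq_box N. (cmod (?c k))\<^sup>2)) \<longlonglongrightarrow> infsum (\<lambda>k. (cmod (?c k))\<^sup>2) UNIV"
  proof (rule LIMSEQ_I)
    fix r :: real assume "r > 0"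
    then obtain N0 where N0: "\<And>N. N \<ge> N0 \<Longrightarrow> infsum (\<lambda>k. (cmod (?c k))\<^sup>2) (- freq_box N) < r"
      using summable_tail_small[OF s2] by (metis zero_le_power2)
    have "infsum (\<lambda>k. (cmod (?c k))\<^sup>2) (- freq_box N) = infsum (\<lambda>k. (cmod (?c k))\<^sup>2) UNIV - (\<Sum>k\<in>freq_box N. (cmod (?c k))\<^sup>2)" for N
      unfolding Compl_eq_Diff_UNIV by (subst infsum_Diff[OF s2]) (auto intro: summable_on_finite)
    moreover have "infsum (\<lambda>k. (cmod (?c k))\<^sup>2) (- freq_box N) \<ge> 0" for N
      by (intro infsum_nonneg) auto
    ultimately show "\<exists>N0. \<forall>N\<ge>N0. norm ((\<Sum>k\<in>freq_box N. (cmod (?c k))\<^sup>2) - infsum (\<lambda>k. (cmod (?c k))\<^sup>2) UNIV) < r"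
      using N0 by (intro exI[of _ N0]) (auto simp: abs_minus_commute)
  qed
  ultimately show ?thesis
    using LIMSEQ_unique has_sum_infsum[OF s2] by metis
qed

subsection \<open>Asymptotics in one dimension\<close>

text \<open>An antiderivative grows over each period by the same amount, the mean of
  \<open>h\<close>, which vanishes.\<close>

lemma periodic_antiderivative:
  fixes h :: "real \<Rightarrow> real"
  assumes cont: "continuous_on UNIV h" and per: "\<And>t. h (t + 1) = h t"
    and mean: "integral {0..1} h = 0"
  obtains \<phi> where "\<And>t. (\<phi> has_real_derivative h t) (at t)" "\<And>t. \<phi> (t + 1) = \<phi> t"
proof -
  have "\<exists>F. \<forall>x :: real. - \<infinity> < ereal x \<longrightarrow> ereal x < \<infinity> \<longrightarrow> (F has_vector_derivative h x) (at x)"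
    by (rule einterval_antiderivative) (use cont in \<open>auto simp: continuous_on_eq_continuous_at\<close>)
  then obtain F where F: "\<And>t. (F has_real_derivative h t) (at t)"
    by (auto simp: has_real_derivative_iff_has_vector_derivative)
  have "((\<lambda>t. F (t + 1) - F t) has_real_derivative 0) (at t)" for t
    using DERIV_diff[OF DERIV_shift[THEN iffD1, OF F] F, of 1 t] by (simp add: per)
  then have const: "F (t + 1) - F t = F (0 + 1) - F 0" for t
    using DERIV_isconst_all[of "\<lambda>t. F (t + 1) - F t" t 0] by blast
  have "(h has_integral (F 1 - F 0)) {0..1}"
    by (rule fundamental_theorem_of_calculus)
       (auto intro: has_vector_derivative_at_within F[unfolded has_real_derivative_iff_has_vector_derivative])
  then have "F 1 - F 0 = 0"
    using mean by (simp add: integral_unique)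
  then have "F (t + 1) = F t" for t
    using const[of t] by simp
  with F show ?thesis using that by blast
qed

text \<open>Here \<open>r = 1 / s\<close> and \<open>h1\<close>, \<open>h2\<close>,
  \<open>h3\<close> stand for the derivatives of the correctors. The last three hypotheses are the
  equations at orders \<open>s\<^sup>0\<close>, \<open>s\<^sup>-\<^sup>1\<close> and
  \<open>s\<^sup>-\<^sup>2\<close>; everything left over carries a factor
  \<open>r ^ 3\<close>.\<close>

lemma ansatz_identity:
  fixes s r K d a b u g1 g2 g3 h1 h2 h3 :: real
  assumes "s * r = 1" "2 * K * g1 = a - u" "2 * g2 = d * h1" "2 * g3 = d * h2 - (g1\<^sup>2 - b)"
  shows "- d * (K * (r * h1 + r ^ 2 * h2 + r ^ 3 * h3)) + K * (s + (r * g1 + r ^ 2 * g2 + r ^ 3 * g3))\<^sup>2 + u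
      - (K * s\<^sup>2 + a + K * b * r\<^sup>2)
    = - d * K * r ^ 3 * h3 + K * (r ^ 2 * g2 + r ^ 3 * g3) * (2 * r * g1 + r ^ 2 * g2 + r ^ 3 * g3)"
  using assms by algebra

text \<open>Inverse powers of \<open>s\<close> are matched in \<open>- d K g' + K (s + g)\<^sup>2 + U = c\<close> with
  \<open>g = g\<^sub>1/s + g\<^sub>2/s\<^sup>2 + g\<^sub>3/s\<^sup>3\<close>; each \<open>g\<^sub>i\<close> has mean zero, so \<open>g\<close> has a periodic antiderivative.\<close>

lemma one_dimensional_expansion:
  fixes d K M :: real
  assumes d: "d > 0" and K: "K \<ge> 1" and M: "M \<ge> 0"
  obtains C where "C \<ge> 0"
    and "\<And>U U1 U2 U3 s.
      \<lbrakk>\<And>t. (U has_real_derivative U1 t) (at t); \<And>t. (U1 has_real_derivative U2 t) (at t);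
       \<And>t. (U2 has_real_derivative U3 t) (at t); continuous_on UNIV U3;
       \<And>t. U (t + 1) = U t; \<And>t. U1 (t + 1) = U1 t;
       \<And>t. \<bar>U t\<bar> \<le> M; \<And>t. \<bar>U1 t\<bar> \<le> M; \<And>t. \<bar>U2 t\<bar> \<le> M; \<And>t. \<bar>U3 t\<bar> \<le> M; s \<ge> 1\<rbrakk> \<Longrightarrow>
      \<exists>\<phi> g g'. (\<forall>t. (\<phi> has_real_derivative g t) (at t)) \<and> (\<forall>t. (g has_real_derivative g' t) (at t)) \<and>
        continuous_on UNIV g' \<and> (\<forall>t. \<phi> (t + 1) = \<phi> t) \<and> (\<exists>B. \<forall>t. \<bar>g t\<bar> \<le> B) \<and>
        (\<forall>t. \<bar>- d * (K * g' t) + K * (s + g t)\<^sup>2 + U t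
             - (K * s\<^sup>2 + integral {0..1} U
                + (integral {0..1} (\<lambda>t. (U t)\<^sup>2) - (integral {0..1} U)\<^sup>2) / (4 * K * s\<^sup>2))\<bar> \<le> C / s ^ 3)"
proof -
  \<comment> \<open>Obtained from the bounds \<open>M\<close> for \<open>g1\<close> and
    \<open>h1\<close>, \<open>d * M\<close> for \<open>g2\<close>, and
    \<open>d\<^sup>2 * M + M\<^sup>2\<close> for \<open>g3\<close> and \<open>h3\<close>, with
    higher powers of \<open>1 / s\<close> replaced by the third. Only \<open>d\<close>,
    \<open>K\<close> and \<open>M\<close> occur, so \<open>C\<close> is fixed before
    \<open>U\<close> and \<open>s\<close>.\<close>
  define C where "C = d * K * (d\<^sup>2 * M + M\<^sup>2) + K * (d * M + (d\<^sup>2 * M + M\<^sup>2)) * (2 * M + d * M + (d\<^sup>2 * M + M\<^sup>2))"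
  have C0: "C \<ge> 0"
    using d K M by (auto simp: C_def intro!: add_nonneg_nonneg mult_nonneg_nonneg)
  show ?thesis
  proof (rule that[OF C0])
    fix U U1 U2 U3 :: "real \<Rightarrow> real" and s :: real
    assume D: "\<And>t. (U has_real_derivative U1 t) (at t)" "\<And>t. (U1 has_real_derivative U2 t) (at t)"
       "\<And>t. (U2 has_real_derivative U3 t) (at t)" and c3: "continuous_on UNIV U3"
      and per: "\<And>t. U (t + 1) = U t" "\<And>t. U1 (t + 1) = U1 t"
      and bd: "\<And>t. \<bar>U t\<bar> \<le> M" "\<And>t. \<bar>U1 t\<bar> \<le> M" "\<And>t. \<bar>U2 t\<bar> \<le> M" "\<And>t. \<bar>U3 t\<bar> \<le> M"
      and s: "s \<ge> 1"
    have cont: "continuous_on A U" "continuous_on A U1" "continuous_on A U2" for A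
      using D by (meson DERIV_continuous_on DERIV_subset subset_UNIV)+
    have I: "f integrable_on {0..1::real}" if "continuous_on UNIV f" for f :: "real \<Rightarrow> real"
      by (rule integrable_continuous_real) (use that continuous_on_subset in blast)
    have FTC: "integral {0..1} f' = f 1 - f 0" if "\<And>t. (f has_real_derivative f' t) (at t)" for f f' :: "real \<Rightarrow> real"
      by (rule integral_unique, rule fundamental_theorem_of_calculus)
         (auto intro: has_vector_derivative_at_within that[unfolded has_real_derivative_iff_has_vector_derivative])
    define a where "a = integral {0..1} U"
    define b0 where "b0 = integral {0..1} (\<lambda>t. (U t)\<^sup>2)"
    define r where "r = 1 / s"
    define g1 where "g1 t = (a - U t) / (2 * K)" for t
    define h1 where "h1 t = - U1 t / (2 * K)" for t
    define g2 where "g2 t = d * h1 t / 2" for t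
    define h2 where "h2 t = - d * U2 t / (4 * K)" for t
    \<comment> \<open>The only value for which \<open>g3\<close> has mean zero. It equals the
      variance of \<open>U\<close> divided by \<open>4 * K\<^sup>2\<close>, as computed in
      \<open>b_eq\<close>.\<close>
    define b where "b = integral {0..1} (\<lambda>t. (g1 t)\<^sup>2)"
    define g3 where "g3 t = d * h2 t / 2 - ((g1 t)\<^sup>2 - b) / 2" for t
    define h3 where "h3 t = - d\<^sup>2 * U3 t / (8 * K) - g1 t * h1 t" for t
    define g where "g t = r * g1 t + r ^ 2 * g2 t + r ^ 3 * g3 t" for t
    define g' where "g' t = r * h1 t + r ^ 2 * h2 t + r ^ 3 * h3 t" for t
    have K0: "K \<noteq> 0" "K > 0" using K by auto
    have r: "0 < r" "r \<le> 1" "s * r = 1"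
      using s by (auto simp: r_def)
    have Dg1: "(g1 has_real_derivative h1 t) (at t)" for t
      unfolding g1_def h1_def using K0 by (auto intro!: derivative_eq_intros D)
    have Dg2: "(g2 has_real_derivative h2 t) (at t)" for t
      unfolding g2_def h1_def h2_def using K0 by (auto intro!: derivative_eq_intros D simp: field_simps)
    have Dg3: "(g3 has_real_derivative h3 t) (at t)" for t
      unfolding g3_def h3_def h2_def using K0
      by (auto intro!: derivative_eq_intros D Dg1 simp: field_simps power2_eq_square)
    have Dg: "(g has_real_derivative g' t) (at t)" for t
      unfolding g_def g'_def by (auto intro!: derivative_eq_intros Dg1 Dg2 Dg3)
    have cg: "continuous_on UNIV g1" "continuous_on UNIV g2" "continuous_on UNIV g3" "continuous_on UNIV g"
      using Dg1 Dg2 Dg3 Dg by (meson DERIV_continuous_on DERIV_subset subset_UNIV)+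
    have cg': "continuous_on UNIV g'"
      unfolding g'_def h1_def h2_def h3_def using K0 by (intro continuous_intros cont c3 cg) auto
    have m1: "integral {0..1} g1 = 0"
      unfolding g1_def by (simp add: integral_diff I cont a_def[symmetric])
    have m2: "integral {0..1} g2 = 0"
    proof -
      have "g2 = (\<lambda>t. (- d / (4 * K)) * U1 t)"
        by (auto simp: g2_def h1_def)
      then show ?thesis
        using FTC[OF D(1)] per(1)[of 0] by simp
    qed
    have m3: "integral {0..1} g3 = 0"
    proof -
      have "g3 = (\<lambda>t. (- d\<^sup>2 / (8 * K)) * U2 t - ((1 / 2) * (g1 t)\<^sup>2 - b / 2))"
        by (auto simp: g3_def h2_def power2_eq_square field_simps)
      then have "integral {0..1} g3 = integral {0..1} (\<lambda>t. (- d\<^sup>2 / (8 * K)) * U2 t - ((1 / 2) * (g1 t)\<^sup>2 - b / 2))"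
        by (rule arg_cong)
      also have "\<dots> = (- d\<^sup>2 / (8 * K)) * integral {0..1} U2 - ((1 / 2) * integral {0..1} (\<lambda>t. (g1 t)\<^sup>2) - b / 2)"
        by (subst integral_diff; (intro I continuous_intros cont cg)?)+ simp
      also have "\<dots> = 0"
        using FTC[OF D(2)] per(2)[of 0] by (simp add: b_def)
      finally show ?thesis .
    qed
    have "integral {0..1} g = r * integral {0..1} g1 + r ^ 2 * integral {0..1} g2 + r ^ 3 * integral {0..1} g3"
      unfolding g_def by (simp add: integral_add I continuous_intros cg)
    then have mean: "integral {0..1} g = 0"
      by (simp add: m1 m2 m3)
    have per2: "U2 (t + 1) = U2 t" for t
    proof -
      have "(U1 has_real_derivative U2 (t + 1)) (at t)"
        using DERIV_shift[THEN iffD1, OF D(2)[of "t + 1"]] by (simp add: per)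
      then show ?thesis using D(2) DERIV_unique by blast
    qed
    have pg: "g (t + 1) = g t" for t
      by (simp add: g_def g1_def g2_def g3_def h1_def h2_def per per2)
    obtain \<phi> where \<phi>: "\<And>t. (\<phi> has_real_derivative g t) (at t)" "\<And>t. \<phi> (t + 1) = \<phi> t"
      using periodic_antiderivative[OF cg(4) pg mean] by blast
    have b_eq: "K * b * r\<^sup>2 = (b0 - a\<^sup>2) / (4 * K * s\<^sup>2)"
    proof -
      have "(\<lambda>t. (g1 t)\<^sup>2) = (\<lambda>t. (1 / (4 * K\<^sup>2)) * ((a\<^sup>2 - (2 * a) * U t) + (U t)\<^sup>2))"
        using K0 by (auto simp: g1_def power2_eq_square field_simps)
      then have "b = (1 / (4 * K\<^sup>2)) * integral {0..1} (\<lambda>t. (a\<^sup>2 - (2 * a) * U t) + (U t)\<^sup>2)"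
        unfolding b_def by simp
      also have "integral {0..1} (\<lambda>t. (a\<^sup>2 - (2 * a) * U t) + (U t)\<^sup>2) = (a\<^sup>2 - (2 * a) * a) + b0"
        by (subst integral_add integral_diff; (intro I continuous_intros cont)?)+ (simp add: a_def b0_def)
      finally show ?thesis
        using K0 s by (simp add: r_def power2_eq_square field_simps)
    qed
    have B1: "\<bar>a\<bar> \<le> M"
      unfolding a_def using integral_norm_bound_integral[OF I[OF cont(1)] I[of "\<lambda>_. M"]] bd(1) by simp
    have B2: "\<bar>g1 t\<bar> \<le> M" for t
    proof -
      have "\<bar>a - U t\<bar> \<le> 2 * M * K"
        using B1 bd(1)[of t] K M mult_left_mono[of 1 K "2 * M"] by linarith
      then show ?thesis
        using K0 by (simp add: g1_def abs_divide field_simps)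
    qed
    have le_K: "\<bar>u / (e * K)\<bar> \<le> c" if "\<bar>u\<bar> \<le> c" "e \<ge> 1" for u e c
    proof -
      have "1 \<le> e * K" using that K mult_mono[of 1 e 1 K] by simp
      then have "\<bar>u\<bar> / (e * K) \<le> \<bar>u\<bar> / 1"
        by (intro divide_left_mono) auto
      with that \<open>1 \<le> e * K\<close> show ?thesis
        by (simp add: abs_divide)
    qed
    have B3: "\<bar>h1 t\<bar> \<le> M" for t
      unfolding h1_def by (rule le_K) (use bd in auto)
    have B4: "\<bar>g2 t\<bar> \<le> d * M" for t
      using mult_left_mono[OF B3[of t], of d] d by (simp add: g2_def abs_mult)
    have sq: "(g1 t)\<^sup>2 \<le> M\<^sup>2" for t
      using B2[of t] M by (metis abs_ge_zero power2_abs power_mono)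
    have b0: "0 \<le> b"
      unfolding b_def by (intro integral_nonneg I continuous_intros cg) auto
    have b1: "b \<le> M\<^sup>2"
      unfolding b_def using integral_le[OF I I[of "\<lambda>_. M\<^sup>2"], of "\<lambda>t. (g1 t)\<^sup>2"] sq cg(1)
      by (simp add: continuous_intros)
    have B5: "\<bar>g3 t\<bar> \<le> d\<^sup>2 * M + M\<^sup>2" for t
    proof -
      have "\<bar>(- d\<^sup>2 * U2 t) / (8 * K)\<bar> \<le> d\<^sup>2 * M"
        by (rule le_K) (use bd in \<open>auto simp: abs_mult mult_left_mono\<close>)
      moreover have "g3 t = (- d\<^sup>2 * U2 t) / (8 * K) - ((g1 t)\<^sup>2 - b) / 2"
        by (simp add: g3_def h2_def power2_eq_square)
      moreover have "\<bar>(g1 t)\<^sup>2 - b\<bar> \<le> M\<^sup>2"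
        using sq[of t] b0 b1 zero_le_power2[of "g1 t"] unfolding abs_le_iff by linarith
      moreover have "\<bar>y - z / 2\<bar> \<le> A + B" if "\<bar>y\<bar> \<le> A" "\<bar>z\<bar> \<le> B" for y z A B :: real
        using that by linarith
      ultimately show ?thesis by metis
    qed
    have B6: "\<bar>h3 t\<bar> \<le> d\<^sup>2 * M + M\<^sup>2" for t
    proof -
      have "\<bar>(- d\<^sup>2 * U3 t) / (8 * K)\<bar> \<le> d\<^sup>2 * M"
        by (rule le_K) (use bd in \<open>auto simp: abs_mult mult_left_mono\<close>)
      moreover have "\<bar>g1 t * h1 t\<bar> \<le> M\<^sup>2"
        unfolding abs_mult power2_eq_square by (intro mult_mono B2 B3) (use M in auto)
      ultimately show ?thesis
        unfolding h3_def by (rule order_trans[OF abs_triangle_ineq4 add_mono])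
    qed
    have r32: "r ^ 3 \<le> r ^ 2" "r ^ 3 \<le> r" "r ^ 2 \<le> r"
      using r power_decreasing[of 2 3 r] power_decreasing[of 1 3 r] power_decreasing[of 1 2 r] by auto
    have Bg: "\<bar>g t\<bar> \<le> M + d * M + (d\<^sup>2 * M + M\<^sup>2)" for t
    proof -
      have le: "\<bar>r ^ j * y\<bar> \<le> c" if "\<bar>y\<bar> \<le> c" for j y c
        using that r power_le_one[of r j] mult_mono[of "r ^ j" 1 "\<bar>y\<bar>" c] by (simp add: abs_mult)
      have "\<bar>r ^ 1 * g1 t\<bar> \<le> M" "\<bar>r ^ 2 * g2 t\<bar> \<le> d * M" "\<bar>r ^ 3 * g3 t\<bar> \<le> d\<^sup>2 * M + M\<^sup>2"
        by (intro le B2 B4 B5)+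
      then show ?thesis unfolding g_def power_one_right by linarith
    qed
    have res: "\<bar>- d * (K * g' t) + K * (s + g t)\<^sup>2 + U t - (K * s\<^sup>2 + a + K * b * r\<^sup>2)\<bar> \<le> C / s ^ 3" for t
    proof -
      have "- d * (K * g' t) + K * (s + g t)\<^sup>2 + U t - (K * s\<^sup>2 + a + K * b * r\<^sup>2)
        = - d * K * r ^ 3 * h3 t + K * (r ^ 2 * g2 t + r ^ 3 * g3 t) * (2 * r * g1 t + r ^ 2 * g2 t + r ^ 3 * g3 t)"
        unfolding g_def g'_def
      proof (rule ansatz_identity[OF r(3)])
        show "2 * K * g1 t = a - U t" "2 * g2 t = d * h1 t"
          using K0 by (simp_all add: g1_def g2_def)
        show "2 * g3 t = d * h2 t - ((g1 t)\<^sup>2 - b)"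
          by (simp add: g3_def field_simps)
      qed
      also have "\<bar>\<dots>\<bar> \<le> \<bar>- d * K * r ^ 3 * h3 t\<bar> + \<bar>K * (r ^ 2 * g2 t + r ^ 3 * g3 t) * (2 * r * g1 t + r ^ 2 * g2 t + r ^ 3 * g3 t)\<bar>"
        by (rule abs_triangle_ineq)
      also have "\<bar>- d * K * r ^ 3 * h3 t\<bar> \<le> (d * K * r ^ 3) * (d\<^sup>2 * M + M\<^sup>2)"
        using mult_left_mono[OF B6[of t], of "d * K * r ^ 3"] d K r by (simp add: abs_mult)
      also have "\<bar>K * (r ^ 2 * g2 t + r ^ 3 * g3 t) * (2 * r * g1 t + r ^ 2 * g2 t + r ^ 3 * g3 t)\<bar>
          \<le> (K * (r ^ 2 * (d * M + (d\<^sup>2 * M + M\<^sup>2)))) * (r * (2 * M + d * M + (d\<^sup>2 * M + M\<^sup>2)))"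
      proof -
        have "\<bar>r ^ 2 * g2 t + r ^ 3 * g3 t\<bar> \<le> r ^ 2 * \<bar>g2 t\<bar> + r ^ 3 * \<bar>g3 t\<bar>"
          using abs_triangle_ineq[of "r ^ 2 * g2 t" "r ^ 3 * g3 t"] r by (simp add: abs_mult)
        also have "\<dots> \<le> r ^ 2 * (d * M) + r ^ 2 * (d\<^sup>2 * M + M\<^sup>2)"
          by (intro add_mono mult_mono B4 B5 r32) (use r in auto)
        finally have 1: "\<bar>r ^ 2 * g2 t + r ^ 3 * g3 t\<bar> \<le> r ^ 2 * (d * M + (d\<^sup>2 * M + M\<^sup>2))"
          by (simp only: distrib_left)
        have "\<bar>2 * r * g1 t + r ^ 2 * g2 t + r ^ 3 * g3 t\<bar> \<le> r * (2 * \<bar>g1 t\<bar>) + r ^ 2 * \<bar>g2 t\<bar> + r ^ 3 * \<bar>g3 t\<bar>"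
          using abs_triangle_ineq[of "2 * r * g1 t + r ^ 2 * g2 t" "r ^ 3 * g3 t"]
            abs_triangle_ineq[of "2 * r * g1 t" "r ^ 2 * g2 t"] r by (simp add: abs_mult)
        also have "\<dots> \<le> r * (2 * M) + r * (d * M) + r * (d\<^sup>2 * M + M\<^sup>2)"
          by (intro add_mono mult_mono B2 B4 B5 r32) (use r in auto)
        finally have 2: "\<bar>2 * r * g1 t + r ^ 2 * g2 t + r ^ 3 * g3 t\<bar> \<le> r * (2 * M + d * M + (d\<^sup>2 * M + M\<^sup>2))"
          by (simp only: distrib_left)
        show ?thesis
          unfolding abs_mult[of "K * _"] abs_mult[of K]
          using K r M d by (intro mult_mono 1 2) (auto intro!: mult_nonneg_nonneg add_nonneg_nonneg)
      qed
      also have "(d * K * r ^ 3) * (d\<^sup>2 * M + M\<^sup>2)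
          + (K * (r ^ 2 * (d * M + (d\<^sup>2 * M + M\<^sup>2)))) * (r * (2 * M + d * M + (d\<^sup>2 * M + M\<^sup>2))) = C * r ^ 3"
        unfolding C_def by algebra
      finally show ?thesis
        by (simp add: r_def power_divide)
    qed
    show "\<exists>\<phi> g g'. (\<forall>t. (\<phi> has_real_derivative g t) (at t)) \<and> (\<forall>t. (g has_real_derivative g' t) (at t)) \<and>
        continuous_on UNIV g' \<and> (\<forall>t. \<phi> (t + 1) = \<phi> t) \<and> (\<exists>B. \<forall>t. \<bar>g t\<bar> \<le> B) \<and>
        (\<forall>t. \<bar>- d * (K * g' t) + K * (s + g t)\<^sup>2 + U t
             - (K * s\<^sup>2 + integral {0..1} U
                + (integral {0..1} (\<lambda>t. (U t)\<^sup>2) - (integral {0..1} U)\<^sup>2) / (4 * K * s\<^sup>2))\<bar> \<le> C / s ^ 3)"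
      using \<phi> Dg cg' Bg res unfolding b_eq a_def b0_def by blast
  qed
qed

subsection \<open>The limit of large generic momenta\<close>

text \<open>The excluded vectors lie in countably many hyperplanes, hence in a null set.\<close>

lemma generic_direction:
  obtains Q :: "real ^ 'n" where "\<And>k. k \<noteq> 0 \<Longrightarrow> Q \<bullet> lattice_vec k \<noteq> 0"
proof -
  have "negligible (\<Union>k\<in>- {0 :: int ^ 'n}. {x. lattice_vec k \<bullet> x = 0})"
    by (rule negligible_countable_Union[OF countable_image]) (auto intro!: negligible_hyperplane)
  then have "(\<Union>k\<in>- {0 :: int ^ 'n}. {x. lattice_vec k \<bullet> x = 0}) \<noteq> UNIV"
    using non_negligible_UNIV by metis
  then show ?thesis
    using that by (auto simp: inner_commute)
qed

text \<open>Bundles a periodic solution of \<open>Q \<bullet> Dv = h\<close> with bounds on its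
  gradient and Laplacian. These are the two quantities that enter the error once \<open>v\<close> is
  scaled by \<open>1 / l\<close>.\<close>

definition transport_solvable :: "real ^ 'n \<Rightarrow> (real ^ 'n \<Rightarrow> real) \<Rightarrow> bool" where
  "transport_solvable Q h \<longleftrightarrow> (\<exists>v G M B. has_C2 v G M \<and> periodic v \<and> (\<forall>x. Q \<bullet> G x = h x) \<and>
     (\<forall>x. norm (G x) \<le> B) \<and> (\<forall>x. \<bar>\<Sum>i\<in>UNIV. M i x $ i\<bar> \<le> B))"

lemma transport_solvable_zero: "transport_solvable Q (\<lambda>x. 0)"
  unfolding transport_solvable_def
  by (intro exI[of _ "\<lambda>x. 0"] exI[of _ "\<lambda>i x. 0"] exI[of _ 0] conjI has_C2_zero) (auto simp: periodic_def)

lemma transport_solvable_add: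
  assumes "transport_solvable Q h" "transport_solvable Q h'"
  shows "transport_solvable Q (\<lambda>x. h x + h' x)"
proof -
  obtain v G M B where 1: "has_C2 v G M" "periodic v" "\<And>x. Q \<bullet> G x = h x"
     "\<And>x. norm (G x) \<le> B" "\<And>x. \<bar>\<Sum>i\<in>UNIV. M i x $ i\<bar> \<le> B"
    using assms(1) unfolding transport_solvable_def by blast
  obtain v' G' M' B' where 2: "has_C2 v' G' M'" "periodic v'" "\<And>x. Q \<bullet> G' x = h' x"
     "\<And>x. norm (G' x) \<le> B'" "\<And>x. \<bar>\<Sum>i\<in>UNIV. M' i x $ i\<bar> \<le> B'"
    using assms(2) unfolding transport_solvable_def by blast
  have "periodic (\<lambda>x. v x + v' x)"
    using 1(2) 2(2) by (simp add: periodic_def)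
  moreover have "Q \<bullet> (G x + G' x) = h x + h' x" for x
    by (simp add: inner_add_right 1 2)
  moreover have "norm (G x + G' x) \<le> B + B'" for x
    using norm_triangle_ineq[of "G x" "G' x"] 1(4)[of x] 2(4)[of x] by linarith
  moreover have "\<bar>\<Sum>i\<in>UNIV. (M i x + M' i x) $ i\<bar> \<le> B + B'" for x
    using 1(5)[of x] 2(5)[of x] by (simp add: sum.distrib)
  ultimately show ?thesis
    unfolding transport_solvable_def using has_C2_add[OF 1(1) 2(1)] by blast
qed

lemma DERIV_Re_cis:
  "((\<lambda>t. Re (c * cis (2 * pi * t))) has_real_derivative Re ((2 * pi * \<i> * c) * cis (2 * pi * t))) (at t)"
  by (auto intro!: derivative_eq_intros simp: algebra_simps)

lemma abs_Re_cis_le: "\<bar>Re (c * cis t)\<bar> \<le> cmod c"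
  using abs_Re_le_cmod[of "c * cis t"] by (simp add: norm_mult)

lemma continuous_on_Re_cis [continuous_intros]:
  "continuous_on S f \<Longrightarrow> continuous_on S (\<lambda>x. Re (c * cis (f x)))"
  unfolding cis_conv_exp by (intro continuous_intros)

text \<open>Differentiation along \<open>Q\<close> multiplies the mode by
  \<open>2 * pi * \<i> * (Q \<bullet> lattice_vec k)\<close>, so dividing the coefficient by this
  number solves the equation.\<close>

lemma transport_solvable_wave:
  fixes Q :: "real ^ 'n"
  assumes nz: "Q \<bullet> lattice_vec k \<noteq> 0"
  shows "transport_solvable Q (\<lambda>x. Re (c * wave k x))"
proof -
  let ?k = "lattice_vec k"
  define c0 where "c0 = c / (2 * pi * \<i> * (Q \<bullet> ?k))"
  define c1 where "c1 = 2 * pi * \<i> * c0"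
  define c2 where "c2 = 2 * pi * \<i> * c1"
  define G where "G x = Re (c1 * cis (2 * pi * (?k \<bullet> x))) *\<^sub>R ?k" for x :: "real ^ 'n"
  define M where "M i x = (Re (c2 * cis (2 * pi * (?k \<bullet> x))) * ?k $ i) *\<^sub>R ?k" for i and x :: "real ^ 'n"
  have C2: "has_C2 (\<lambda>x. Re (c0 * cis (2 * pi * (?k \<bullet> x)))) G M"
    unfolding G_def[abs_def] M_def[abs_def]
    by (rule has_C2_plane_wave) (use DERIV_Re_cis[of c0] DERIV_Re_cis[of c1] in \<open>auto simp: c1_def c2_def intro!: continuous_intros\<close>)
  have "periodic (\<lambda>x. Re (c0 * wave k x))"
    by (simp add: periodic_def periodicD[OF periodic_wave])
  then have per: "periodic (\<lambda>x. Re (c0 * cis (2 * pi * (?k \<bullet> x))))"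
    unfolding wave_def .
  have c1c: "c1 * (Q \<bullet> ?k) = c"
    using nz by (simp add: c1_def c0_def)
  have "Q \<bullet> G x = Re ((c1 * (Q \<bullet> ?k)) * wave k x)" for x
    by (simp add: G_def wave_def algebra_simps)
  then have eq: "Q \<bullet> G x = Re (c * wave k x)" for x
    by (simp only: c1c)
  define B where "B = cmod c1 * norm ?k + cmod c2 * (norm ?k)\<^sup>2"
  have "norm (G x) \<le> cmod c1 * norm ?k" for x
    unfolding G_def by (simp only: norm_scaleR) (intro mult_right_mono abs_Re_cis_le norm_ge_zero)
  then have B1: "norm (G x) \<le> B" for x
    unfolding B_def by (meson add_increasing2 mult_nonneg_nonneg norm_ge_zero zero_le_power2)
  have "(\<Sum>i\<in>UNIV. M i x $ i) = Re (c2 * cis (2 * pi * (?k \<bullet> x))) * (norm ?k)\<^sup>2" for x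
    unfolding power2_norm_eq_inner inner_vec_def M_def by (simp only: sum_distrib_left) (simp add: mult_ac)
  then have "\<bar>\<Sum>i\<in>UNIV. M i x $ i\<bar> \<le> cmod c2 * (norm ?k)\<^sup>2" for x
    by (simp only: abs_mult abs_power2) (intro mult_right_mono abs_Re_cis_le, auto)
  then have B2: "\<bar>\<Sum>i\<in>UNIV. M i x $ i\<bar> \<le> B" for x
    unfolding B_def by (meson add_increasing mult_nonneg_nonneg norm_ge_zero)
  show ?thesis
    unfolding transport_solvable_def using C2 per eq B1 B2 by blast
qed

lemma transport_solvable_sum:
  assumes "finite F" "\<And>k. k \<in> F \<Longrightarrow> transport_solvable Q (f k)"
  shows "transport_solvable Q (\<lambda>x. \<Sum>k\<in>F. f k x)"
  using assms by (induction F) (auto intro: transport_solvable_zero transport_solvable_add)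

text \<open>The constant mode is the only obstruction and cancels against the mean; the finitely
  many other modes are solved one at a time.\<close>

lemma trig_poly_transport_solvable:
  assumes gen: "\<And>k. k \<noteq> 0 \<Longrightarrow> Q \<bullet> lattice_vec k \<noteq> 0" and "trig_poly T"
  shows "transport_solvable Q (\<lambda>x. torus_integral T - T x)"
  using assms(2)
proof induction
  case (single c k)
  show ?case
  proof (cases "k = 0")
    case True
    then show ?thesis
      by (simp add: transport_solvable_zero)
  next
    case False
    have "wave k integrable_on cbox 0 1"
      by (intro continuous_integrable_on_cube continuous_intros)
    then have "(\<lambda>x. c * wave k x) integrable_on cbox 0 1"
      by (rule integrable_on_mult_right)
    then have "integral (cbox 0 1) (\<lambda>x. Re (c * wave k x)) = Re (integral (cbox 0 1) (\<lambda>x. c * wave k x))"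
      by (rule integral_linear[OF _ bounded_linear_Re, unfolded o_def])
    then have "torus_integral (\<lambda>x. Re (c * wave k x)) = 0"
      using torus_integral_wave[OF False] unfolding torus_integral_eq integral_mult_right by simp
    then show ?thesis
      using transport_solvable_wave[OF gen[OF False], of "- c"] by simp
  qed
next
  case (add f g)
  have "torus_integral (\<lambda>x. f x + g x) = torus_integral f + torus_integral g"
    by (intro torus_integral_add continuous_on_trig_poly add)
  then show ?case
    using transport_solvable_add[OF add.IH] by (simp add: algebra_simps)
qed

section \<open>The Hamiltonian at large gradients\<close>

lemma second_order_taylor_bound:
  fixes H :: "real ^ 'n \<Rightarrow> real"
  assumes H: "C_k 2 H" and bd: "bdd_above (range (\<lambda>p. onorm (\<lambda>v. hessian H p *v v)))"
  obtains B where "B \<ge> 0" "\<And>p \<delta>. \<bar>H (p + \<delta>) - H p - grad H p \<bullet> \<delta>\<bar> \<le> B * (norm \<delta>)\<^sup>2"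
proof -
  obtain B where B: "\<And>p. onorm (\<lambda>v. hessian H p *v v) \<le> B"
    using bd by (auto simp: bdd_above_def)
  have nB: "norm (hessian H p *v v) \<le> B * norm v" for p v
    using onorm[OF matrix_vector_mul_bounded_linear, of "hessian H p" v] B[of p]
    by (meson mult_right_mono norm_ge_zero order_trans)
  have B0: "B \<ge> 0"
    using B onorm_pos_le[OF matrix_vector_mul_bounded_linear] order_trans by blast
  note C2 = C_k_2_imp_has_C2[OF H]
  have "\<bar>H (p + \<delta>) - H p - grad H p \<bullet> \<delta>\<bar> \<le> B * (norm \<delta>)\<^sup>2" for p \<delta>
  proof -
    have line: "((\<lambda>t. p + t *\<^sub>R \<delta>) has_derivative (\<lambda>h. h *\<^sub>R \<delta>)) (at t)" for t
      by (auto intro!: derivative_eq_intros)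
    have 1: "((\<lambda>t. H (p + t *\<^sub>R \<delta>)) has_real_derivative grad H (p + t *\<^sub>R \<delta>) \<bullet> \<delta>) (at t)" for t
      using has_derivative_compose[OF line[of t] has_C2_D1[OF C2]]
      unfolding has_field_derivative_def by (rule has_derivative_eq_rhs) (simp add: fun_eq_iff)
    have 2: "((\<lambda>t. grad H (p + t *\<^sub>R \<delta>) \<bullet> \<delta>) has_real_derivative \<delta> \<bullet> (hessian H (p + t *\<^sub>R \<delta>) *v \<delta>)) (at t)" for t
    proof -
      have "((\<lambda>t. grad H (p + t *\<^sub>R \<delta>) $ i * \<delta> $ i) has_derivative
          (\<lambda>h. (grad (partial i H) (p + t *\<^sub>R \<delta>) \<bullet> (h *\<^sub>R \<delta>)) * \<delta> $ i)) (at t)" for i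
        by (rule has_derivative_mult_left[OF has_derivative_compose[OF line[of t] has_C2_D2[OF C2]]])
      then have "((\<lambda>t. \<Sum>i\<in>UNIV. grad H (p + t *\<^sub>R \<delta>) $ i * \<delta> $ i) has_derivative
          (\<lambda>h. \<Sum>i\<in>UNIV. (grad (partial i H) (p + t *\<^sub>R \<delta>) \<bullet> (h *\<^sub>R \<delta>)) * \<delta> $ i)) (at t)"
        by (rule has_derivative_sum)
      \<comment> \<open>The rows of \<open>hessian\<close> and the gradients of the partial
        derivatives carry their indices in opposite order. Interchanging the two sums matches them
        without appeal to symmetry of mixed derivatives.\<close>
      moreover have "(\<Sum>i\<in>UNIV. (grad (partial i H) q \<bullet> (h *\<^sub>R \<delta>)) * \<delta> $ i) = (\<delta> \<bullet> (hessian H q *v \<delta>)) * h" for q h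
      proof -
        have "\<delta> \<bullet> (hessian H q *v \<delta>) = (\<Sum>i\<in>UNIV. \<Sum>j\<in>UNIV. \<delta> $ i * (hessian H q $ i $ j * \<delta> $ j))"
          by (simp add: inner_vec_def matrix_vector_mult_def sum_distrib_left)
        also have "\<dots> = (\<Sum>j\<in>UNIV. \<Sum>i\<in>UNIV. \<delta> $ i * (hessian H q $ i $ j * \<delta> $ j))"
          by (rule sum.swap)
        also have "\<dots> = (\<Sum>j\<in>UNIV. (grad (partial j H) q \<bullet> \<delta>) * \<delta> $ j)"
          by (simp add: inner_vec_def hessian_def grad_def sum_distrib_left sum_distrib_right mult_ac)
        finally show ?thesis
          by (simp add: sum_distrib_left sum_distrib_right mult_ac)
      qed
      ultimately show ?thesis
        by (simp add: has_field_derivative_def inner_vec_def[of "grad H _"])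
    qed
    obtain z where z: "0 < z" "z < 1"
      "H (p + 1 *\<^sub>R \<delta>) - H (p + 0 *\<^sub>R \<delta>) = (1 - 0) * (grad H (p + z *\<^sub>R \<delta>) \<bullet> \<delta>)"
      using MVT2[of 0 1 "\<lambda>t. H (p + t *\<^sub>R \<delta>)" "\<lambda>t. grad H (p + t *\<^sub>R \<delta>) \<bullet> \<delta>"] 1 by auto
    obtain y where y: "0 < y" "y < z"
      "grad H (p + z *\<^sub>R \<delta>) \<bullet> \<delta> - grad H (p + 0 *\<^sub>R \<delta>) \<bullet> \<delta> = (z - 0) * (\<delta> \<bullet> (hessian H (p + y *\<^sub>R \<delta>) *v \<delta>))"
      using MVT2[of 0 z "\<lambda>t. grad H (p + t *\<^sub>R \<delta>) \<bullet> \<delta>" "\<lambda>t. \<delta> \<bullet> (hessian H (p + t *\<^sub>R \<delta>) *v \<delta>)"] 2 z by auto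
    have "H (p + \<delta>) - H p - grad H p \<bullet> \<delta> = z * (\<delta> \<bullet> (hessian H (p + y *\<^sub>R \<delta>) *v \<delta>))"
      using z(3) y(3) by simp
    also have "\<bar>\<dots>\<bar> \<le> 1 * (norm \<delta> * (B * norm \<delta>))"
      unfolding abs_mult
      by (intro mult_mono order_trans[OF Cauchy_Schwarz_ineq2] nB) (use z B0 in auto)
    finally show ?thesis
      by (simp add: power2_eq_square mult_ac)
  qed
  with B0 show ?thesis using that by blast
qed

text \<open>A minimiser of \<open>H p - q \<bullet> p\<close> has gradient \<open>q\<close>, and
  superlinearity makes this function coercive.\<close>

lemma superlinear_gradient_surjective:
  fixes H :: "real ^ 'n \<Rightarrow> real"
  assumes diff: "\<And>x. H differentiable (at x)" and sup: "superlinear H"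
  obtains p where "grad H p = q"
proof -
  define F where "F p = H p - q \<bullet> p" for p
  have "eventually (\<lambda>p. H p / norm p \<ge> norm q + 1) at_infinity"
    using sup by (simp add: superlinear_def filterlim_at_top)
  then obtain R where R: "\<And>p. norm p \<ge> R \<Longrightarrow> H p / norm p \<ge> norm q + 1"
    by (auto simp: eventually_at_infinity)
  \<comment> \<open>Outside the ball of radius \<open>S\<close> one has
    \<open>F p \<ge> norm p > F 0\<close>, so a minimum over the ball, which contains
    \<open>0\<close>, is global.\<close>
  define S where "S = max (max R 1) (\<bar>F 0\<bar>)"
  have cont: "continuous_on UNIV F"
    unfolding F_def using diff
    by (intro continuous_intros differentiable_imp_continuous_on) (auto simp: differentiable_on_def)
  have "cball 0 S \<noteq> ({} :: (real ^ 'n) set)"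
    by (auto simp: S_def)
  then obtain p0 where p0: "p0 \<in> cball 0 S" "\<And>p. p \<in> cball 0 S \<Longrightarrow> F p0 \<le> F p"
    using continuous_attains_inf[OF compact_cball, of 0 S F] continuous_on_subset[OF cont]
    by (metis subset_UNIV)
  have min: "F p0 \<le> F p" for p
  proof (cases "norm p \<le> S")
    case True
    then show ?thesis using p0 by simp
  next
    case False
    then have p: "norm p > S" "norm p > 0" "norm p \<ge> R"
      by (auto simp: S_def)
    have "H p \<ge> (norm q + 1) * norm p"
      using R[OF p(3)] p(2) by (simp add: pos_le_divide_eq)
    moreover have "q \<bullet> p \<le> norm q * norm p"
      by (rule norm_cauchy_schwarz)
    ultimately have "F p \<ge> norm p"
      by (simp add: F_def algebra_simps)
    also have "norm p \<ge> F 0"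
      using p(1) abs_ge_self[of "F 0"] unfolding S_def by linarith
    moreover have "F p0 \<le> F 0"
      by (rule p0(2)) (simp add: S_def)
    ultimately show ?thesis by linarith
  qed
  have "(F has_derivative (\<lambda>h. grad H p0 \<bullet> h - q \<bullet> h)) (at p0)"
    unfolding F_def by (intro derivative_intros has_derivative_grad diff)
  then have "(\<lambda>h. grad H p0 \<bullet> h - q \<bullet> h) = (\<lambda>h. 0)"
    by (rule differential_zero_maxmin[of p0 UNIV F, rotated 2]) (use min in auto)
  then have "(grad H p0 - q) \<bullet> (grad H p0 - q) = 0"
    by (metis inner_diff_left)
  then show ?thesis
    using that[of p0] by simp
qed

lemma viscous_effective_hamiltonian_estimate:
  assumes "d > 0" "viscous_effective_hamiltonian d H V Hbar"
    and "has_C2 \<phi> G M" "periodic \<phi>"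
    and "\<And>x. \<bar>- d * (\<Sum>i\<in>UNIV. M i x $ i) + H (p + G x) + V x - b\<bar> \<le> e"
  shows "\<bar>Hbar p - b\<bar> \<le> e"
proof -
  obtain w where "cell_solution d H V p (Hbar p) w"
    using assms(2) unfolding viscous_effective_hamiltonian_def by blast
  then show ?thesis
    using comparison assms by blast
qed

lemma effective_hamiltonian_limit:
  fixes H V Hbar :: "real ^ 'n \<Rightarrow> real"
  assumes d: "d > 0" and V: "smooth_on_torus V" and H: "C_k 2 H"
    and bd: "bdd_above (range (\<lambda>p. onorm (\<lambda>v. hessian H p *v v)))"
    and Hbar: "viscous_effective_hamiltonian d H V Hbar"
    and Q: "\<And>k. k \<noteq> 0 \<Longrightarrow> Q \<bullet> lattice_vec k \<noteq> 0"
    and P: "\<And>l. l > 0 \<Longrightarrow> grad H (l *\<^sub>R P l) = l *\<^sub>R Q"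
  shows "((\<lambda>l. Hbar (l *\<^sub>R P l) - H (l *\<^sub>R P l)) \<longlongrightarrow> torus_integral V) at_top"
proof (rule tendstoI)
  fix e :: real assume e: "e > 0"
  obtain T where tp: "trig_poly T" and T: "\<And>x. \<bar>V x - T x\<bar> < e / 4"
    using trig_poly_dense[OF smooth_on_torusD(1,2)[OF V], of "e / 4"] e by auto
  obtain v G M B where v: "has_C2 v G M" "periodic v" "\<And>x. Q \<bullet> G x = torus_integral T - T x"
     and B: "\<And>x. norm (G x) \<le> B" "\<And>x. \<bar>\<Sum>i\<in>UNIV. M i x $ i\<bar> \<le> B"
    using trig_poly_transport_solvable[OF Q tp] unfolding transport_solvable_def by blast
  obtain L where L: "L \<ge> 0" "\<And>p \<delta>. \<bar>H (p + \<delta>) - H p - grad H p \<bullet> \<delta>\<bar> \<le> L * (norm \<delta>)\<^sup>2"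
    using second_order_taylor_bound[OF H bd] by blast
  \<comment> \<open>\<open>d * B\<close> bounds the diffusion of the corrector and
    \<open>L * B\<^sup>2\<close> the Taylor remainder. The latter has order
    \<open>1 / l\<^sup>2\<close> and is weakened to \<open>1 / l\<close>, as
    \<open>l \<ge> 1\<close>.\<close>
  define C where "C = d * B + L * B\<^sup>2"
  have B0: "B \<ge> 0"
    using B(1)[of 0] norm_ge_zero order_trans by blast
  have mean: "\<bar>torus_integral V - torus_integral T\<bar> \<le> e / 4"
  proof -
    have "norm (torus_integral (\<lambda>x. V x - T x)) \<le> e / 4"
      by (rule norm_torus_integral_le)
         (use T smooth_on_torusD[OF V] continuous_on_trig_poly[OF tp] in \<open>auto intro!: continuous_intros less_imp_le\<close>)
    then show ?thesis
      by (subst (asm) torus_integral_diff) (use smooth_on_torusD[OF V] continuous_on_trig_poly[OF tp] in auto)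
  qed
  have est: "\<bar>Hbar (l *\<^sub>R P l) - (H (l *\<^sub>R P l) + torus_integral T)\<bar> \<le> C / l + e / 4" if l: "l \<ge> 1" for l
  proof (rule viscous_effective_hamiltonian_estimate[OF d Hbar has_C2_mult[OF v(1), of "1 / l"]])
    show "periodic (\<lambda>x. 1 / l * v x)"
      using v(2) by (simp add: periodic_def)
    fix x
    let ?p = "l *\<^sub>R P l" and ?\<delta> = "(1 / l) *\<^sub>R G x" and ?S = "\<Sum>i\<in>UNIV. M i x $ i"
    \<comment> \<open>The gradient \<open>l *\<^sub>R Q\<close> meets a corrector of size
      \<open>1 / l\<close>, so this term keeps order one and replaces \<open>T x\<close> by its
      mean.\<close>
    have "grad H ?p \<bullet> ?\<delta> = torus_integral T - T x"
      using P[of l] l v(3)[of x] by simp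
    then have eq: "- d * (\<Sum>i\<in>UNIV. ((1 / l) *\<^sub>R M i x) $ i) + H (?p + ?\<delta>) + V x - (H ?p + torus_integral T)
        = - (d * ?S / l) + (H (?p + ?\<delta>) - H ?p - grad H ?p \<bullet> ?\<delta>) + (V x - T x)"
      by (simp add: sum_divide_distrib[symmetric])
    have 1: "\<bar>- (d * ?S / l)\<bar> \<le> d * B / l"
      using d l B(2)[of x] by (simp add: abs_mult divide_right_mono)
    have "L * (norm ?\<delta>)\<^sup>2 \<le> L * (B\<^sup>2 / l)"
    proof (intro mult_left_mono L(1))
      have "(norm ?\<delta>)\<^sup>2 = (norm (G x))\<^sup>2 / l\<^sup>2"
        by (simp add: power_divide)
      also have "\<dots> \<le> B\<^sup>2 / l"
        using l B(1)[of x] self_le_power[of l 2] by (intro frac_le power_mono) auto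
      finally show "(norm ?\<delta>)\<^sup>2 \<le> B\<^sup>2 / l" .
    qed
    then have 2: "\<bar>H (?p + ?\<delta>) - H ?p - grad H ?p \<bullet> ?\<delta>\<bar> \<le> L * B\<^sup>2 / l"
      using L(2)[of ?p ?\<delta>] by simp
    have "C / l = d * B / l + L * B\<^sup>2 / l"
      by (simp add: C_def add_divide_distrib)
    then show "\<bar>- d * (\<Sum>i\<in>UNIV. ((1 / l) *\<^sub>R M i x) $ i) + H (?p + ?\<delta>) + V x - (H ?p + torus_integral T)\<bar> \<le> C / l + e / 4"
      unfolding eq using 1 2 T[of x] by linarith
  qed
  have "eventually (\<lambda>l. C / l < e / 4) at_top"
    by (rule order_tendstoD(2)[OF tendsto_divide_0[OF tendsto_const filterlim_ident[THEN filterlim_at_top_imp_at_infinity]]]) (use e in auto)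
  then show "eventually (\<lambda>l. dist (Hbar (l *\<^sub>R P l) - H (l *\<^sub>R P l)) (torus_integral V) < e) at_top"
    using eventually_ge_at_top[of 1]
  proof eventually_elim
    case (elim l)
    then show ?case
      using est[of l] mean e unfolding dist_real_def by linarith
  qed
qed

subsection \<open>Primitive lattice vectors\<close>

text \<open>Equivalent to coprime coordinates, in the form that is used: \<open>k0\<close> generates
  all integer vectors on its real line.\<close>

definition primitive :: "int ^ 'n \<Rightarrow> bool" where
  "primitive k0 \<longleftrightarrow> k0 \<noteq> 0 \<and> (\<forall>k r. lattice_vec k = r *\<^sub>R lattice_vec k0 \<longrightarrow> (\<exists>m. k = m *s k0))"

lemma primitive_uminus:
  assumes "primitive k0"
  shows "primitive (- k0)"
  unfolding primitive_def
proof (intro conjI allI impI)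
  show "- k0 \<noteq> 0" using assms by (simp add: primitive_def)
  fix k r assume "lattice_vec k = r *\<^sub>R lattice_vec (- k0)"
  then have "lattice_vec k = (- r) *\<^sub>R lattice_vec k0" by simp
  then obtain m where "k = m *s k0" using assms unfolding primitive_def by blast
  then have "k = (- m) *s (- k0)" by (simp add: vec_eq_iff)
  then show "\<exists>m. k = m *s - k0" by blast
qed

text \<open>A shortest nonzero lattice vector on the line through \<open>k\<close> is primitive.\<close>

lemma primitive_exists:
  fixes k :: "int ^ 'n"
  assumes "k \<noteq> 0"
  obtains k0 m where "primitive k0" "m \<ge> 1" "k = m *s k0"
proof -
  define S where "S = {k' :: int ^ 'n. k' \<noteq> 0 \<and> (\<exists>r. lattice_vec k' = r *\<^sub>R lattice_vec k)}"
  define f where "f k' = nat (\<Sum>i\<in>UNIV. (k' $ i)\<^sup>2)" for k' :: "int ^ 'n"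
  have f: "real (f k') = (norm (lattice_vec k'))\<^sup>2" for k'
    unfolding power2_norm_eq_inner inner_vec_def f_def by (simp add: sum_nonneg power2_eq_square)
  have "k \<in> S"
    using assms by (auto simp: S_def intro!: exI[of _ 1])
  then obtain k0 where k0: "k0 \<in> S" "\<And>k'. k' \<in> S \<Longrightarrow> f k0 \<le> f k'"
    using ex_has_least_nat[of "\<lambda>x. x \<in> S" k f] by blast
  obtain r0 where r0: "lattice_vec k0 = r0 *\<^sub>R lattice_vec k" and nz: "k0 \<noteq> 0"
    using k0(1) by (auto simp: S_def)
  have mult: "\<exists>m. k' = m *s k0" if k': "lattice_vec k' = r *\<^sub>R lattice_vec k0" for k' r
  proof -
    \<comment> \<open>Division with remainder: removing an integer multiple of \<open>k0\<close>
      leaves a vector on the line that is shorter than \<open>k0\<close>, hence zero.\<close>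
    define k'' where "k'' = k' - \<lfloor>r\<rfloor> *s k0"
    have k'': "lattice_vec k'' = frac r *\<^sub>R lattice_vec k0"
      by (simp add: k''_def k' frac_def scaleR_diff_left)
    have "k'' = 0"
    proof (rule ccontr)
      assume "k'' \<noteq> 0"
      moreover have "lattice_vec k'' = (frac r * r0) *\<^sub>R lattice_vec k"
        by (simp add: k'' r0)
      ultimately have "k'' \<in> S" by (auto simp: S_def)
      then have "real (f k0) \<le> real (f k'')"
        using k0(2) by simp
      then have "(norm (lattice_vec k0))\<^sup>2 \<le> (norm (frac r *\<^sub>R lattice_vec k0))\<^sup>2"
        by (simp only: f k'')
      then have "norm (lattice_vec k0) \<le> norm (frac r *\<^sub>R lattice_vec k0)"
        by (rule power2_le_imp_le) simp
      then show False
        using nz frac_lt_1[of r] by (simp add: mult_le_cancel_right1)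
    qed
    then show ?thesis
      unfolding k''_def by (intro exI[of _ "\<lfloor>r\<rfloor>"]) simp
  qed
  then have prim: "primitive k0"
    using nz unfolding primitive_def by blast
  have "r0 \<noteq> 0" using r0 nz by auto
  then have "lattice_vec k = (1 / r0) *\<^sub>R lattice_vec k0" by (simp add: r0)
  then obtain m where m: "k = m *s k0" using mult by blast
  then have "m \<noteq> 0" using assms by auto
  \<comment> \<open>Both \<open>k0\<close> and \<open>- k0\<close> are primitive, so the sign can be
    moved into the vector to keep the multiplier positive.\<close>
  then consider "m \<ge> 1" | "- m \<ge> 1" by linarith
  then show ?thesis
  proof cases
    case 1
    then show ?thesis using that prim m by blast
  next
    case 2
    moreover have "k = (- m) *s (- k0)" by (simp add: m vec_eq_iff)
    ultimately show ?thesis using that primitive_uminus[OF prim] by blast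
  qed
qed

text \<open>Two primitive vectors on a common line are integer multiples of each other, hence equal
  up to sign; positive multipliers fix the sign.\<close>

lemma primitive_unique:
  assumes p: "primitive k0" "primitive k1" and m: "m0 \<ge> 1" "m1 \<ge> 1" and eq: "m0 *s k0 = m1 *s k1"
  shows "k0 = k1 \<and> m0 = m1"
proof -
  have nz: "k0 \<noteq> 0" "k1 \<noteq> 0"
    using p by (auto simp: primitive_def)
  have e: "of_int m0 *\<^sub>R lattice_vec k0 = of_int m1 *\<^sub>R lattice_vec k1"
    using arg_cong[OF eq, of lattice_vec] by simp
  have k1: "lattice_vec k1 = (of_int m0 / of_int m1) *\<^sub>R lattice_vec k0"
    using arg_cong[OF e, of "\<lambda>v. (1 / of_int m1) *\<^sub>R v"] m by simp
  have k0: "lattice_vec k0 = (of_int m1 / of_int m0) *\<^sub>R lattice_vec k1"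
    using arg_cong[OF e, of "\<lambda>v. (1 / of_int m0) *\<^sub>R v"] m by simp
  obtain a where a: "k1 = a *s k0"
    using p(1) k1 unfolding primitive_def by blast
  obtain b where b: "k0 = b *s k1"
    using p(2) k0 unfolding primitive_def by blast
  obtain i where i: "k0 $ i \<noteq> 0"
    using nz by (auto simp: vec_eq_iff)
  have "k0 $ i = b * (a * k0 $ i)"
    using a b by (metis vector_smult_component)
  then have "b * a = 1" using i by simp
  moreover have "m0 * k0 $ i = m1 * (a * k0 $ i)"
    using eq a by (metis vector_smult_component)
  then have "m0 = m1 * a" using i by simp
  then have "a > 0"
    using m by (metis less_le_trans zero_less_mult_pos zero_less_one)
  ultimately have "a = 1"
    by (metis mult.commute pos_zmult_eq_1_iff)
  then show ?thesis
    using a \<open>m0 = m1 * a\<close> by simp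
qed

text \<open>Splits the nonzero frequencies into discrete half-lines, one for each primitive vector,
  with \<open>k0\<close> and \<open>- k0\<close> spanning different ones. Parseval sums can then be
  taken one half-line at a time.\<close>

lemma primitive_times_bij:
  "bij_betw (\<lambda>(k0, m). m *s k0) ({k0 :: int ^ 'n. primitive k0} \<times> {1..}) (- {0})"
proof (rule bij_betwI')
  fix p q :: "(int ^ 'n) \<times> int"
  assume "p \<in> {k0. primitive k0} \<times> {1..}" "q \<in> {k0. primitive k0} \<times> {1..}"
  then show "((case p of (k0, m) \<Rightarrow> m *s k0) = (case q of (k0, m) \<Rightarrow> m *s k0)) = (p = q)"
    using primitive_unique[of "fst p" "fst q" "snd p" "snd q"] by (auto simp: split_beta prod_eq_iff)
next
  fix p :: "(int ^ 'n) \<times> int"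
  assume "p \<in> {k0. primitive k0} \<times> {1..}"
  then show "(case p of (k0, m) \<Rightarrow> m *s k0) \<in> - {0}"
    by (auto simp: primitive_def)
next
  fix k :: "int ^ 'n" assume "k \<in> - {0}"
  then obtain k0 m where "primitive k0" "m \<ge> 1" "k = m *s k0"
    using primitive_exists[of k] by auto
  then show "\<exists>p\<in>{k0. primitive k0} \<times> {1..}. k = (case p of (k0, m) \<Rightarrow> m *s k0)"
    by (intro bexI[of _ "(k0, m)"]) auto
qed

text \<open>\<open>Q\<close> is a multiple of the projection of a generic \<open>R\<close> off
  \<open>k0\<close>, scaled so that \<open>Q \<bullet> lattice_vec k\<close> equals \<open>R\<close>
  paired with an integer vector. That vector vanishes only if \<open>k\<close> lies on the line. In
  dimension one \<open>Q\<close> is zero and there are no frequencies off the line.\<close>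

lemma generic_orthogonal_direction:
  fixes k0 :: "int ^ 'n"
  assumes p: "primitive k0"
  obtains Q where "Q \<bullet> lattice_vec k0 = 0" "\<And>k. (\<nexists>m. k = m *s k0) \<Longrightarrow> Q \<bullet> lattice_vec k \<noteq> 0"
proof -
  let ?c = "lattice_vec k0"
  obtain R :: "real ^ 'n" where R: "\<And>k. k \<noteq> 0 \<Longrightarrow> R \<bullet> lattice_vec k \<noteq> 0"
    using generic_direction by blast
  have K: "?c \<bullet> ?c \<noteq> 0" using p by (simp add: primitive_def)
  define Q where "Q = (?c \<bullet> ?c) *\<^sub>R R - (R \<bullet> ?c) *\<^sub>R ?c"
  show ?thesis
  proof
    show "Q \<bullet> ?c = 0" by (simp add: Q_def inner_diff_left)
    fix k assume k: "\<nexists>m. k = m *s k0"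
    obtain a where a: "?c \<bullet> ?c = of_int a" using lattice_inner_Ints Ints_cases by metis
    obtain b where b: "?c \<bullet> lattice_vec k = of_int b" using lattice_inner_Ints Ints_cases by metis
    have "a *s k - b *s k0 \<noteq> 0"
    proof
      assume "a *s k - b *s k0 = 0"
      then have "lattice_vec (a *s k - b *s k0) = 0" by simp
      then have "of_int a *\<^sub>R lattice_vec k = of_int b *\<^sub>R ?c" by simp
      from arg_cong[OF this, of "\<lambda>v. (1 / of_int a) *\<^sub>R v"]
      have "lattice_vec k = (of_int b / of_int a) *\<^sub>R ?c"
        using K a by simp
      then show False using p k unfolding primitive_def by blast
    qed
    then have "R \<bullet> lattice_vec (a *s k - b *s k0) \<noteq> 0" by (rule R)
    moreover have "R \<bullet> lattice_vec (a *s k - b *s k0) = Q \<bullet> lattice_vec k"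
      using a b by (simp add: Q_def inner_diff_left inner_diff_right)
    ultimately show "Q \<bullet> lattice_vec k \<noteq> 0" by simp
  qed
qed

subsection \<open>Averaging onto a lattice line\<close>

text \<open>With the coefficients of \<open>V\<close> along the line through \<open>k0\<close>, its
  value at \<open>t = lattice_vec k0 \<bullet> x\<close> is the part of the Fourier sum that stays
  constant orthogonally to \<open>k0\<close>.\<close>

definition profile :: "(int \<Rightarrow> complex) \<Rightarrow> int set \<Rightarrow> real \<Rightarrow> real" where
  "profile c A t = (\<Sum>m\<in>A. Re (c m * cis (2 * pi * (of_int m * t))))"

lemma DERIV_profile:
  "(profile c A has_real_derivative profile (\<lambda>m. 2 * pi * \<i> * of_int m * c m) A t) (at t)"
  unfolding profile_def[abs_def]
  by (rule DERIV_sum) (auto intro!: derivative_eq_intros simp: algebra_simps)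

lemma profile_periodic: "profile c A (t + 1) = profile c A t"
proof -
  have "cis (2 * pi * (of_int m * (t + 1))) = cis (2 * pi * (of_int m * t))" for m
  proof -
    have "cis (2 * pi * (of_int m * (t + 1))) = cis (2 * pi * (of_int m * t)) * cis (2 * pi * of_int m)"
      by (simp add: cis_mult algebra_simps)
    then show ?thesis by (simp add: cis_multiple_2pi)
  qed
  then show ?thesis by (simp add: profile_def)
qed

lemma continuous_on_profile: "continuous_on S (profile c A)"
  unfolding profile_def[abs_def] by (intro continuous_intros)

lemma abs_profile_le: "\<bar>profile c A t\<bar> \<le> (\<Sum>m\<in>A. cmod (c m))"
  unfolding profile_def by (rule order_trans[OF sum_abs sum_mono]) (rule abs_Re_cis_le)

lemma integral_cis:
  assumes "m \<noteq> 0"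
  shows "integral {0..1} (\<lambda>t. cis (2 * pi * (of_int m * t))) = 0"
proof -
  let ?a = "2 * pi * \<i> * of_int m"
  have "((\<lambda>t. exp (t *\<^sub>R ?a) / ?a) has_vector_derivative (exp (t *\<^sub>R ?a) * ?a) / ?a) (at t within {0..1})" for t
    by (intro has_vector_derivative_divide exp_scaleR_has_vector_derivative_right)
  then have "((\<lambda>t. exp (t *\<^sub>R ?a)) has_integral (exp (1 *\<^sub>R ?a) / ?a - exp (0 *\<^sub>R ?a) / ?a)) {0..1}"
    using assms by (intro fundamental_theorem_of_calculus) auto
  moreover have eq: "exp (t *\<^sub>R ?a) = cis (2 * pi * (of_int m * t))" for t
    by (simp add: cis_conv_exp scaleR_conv_of_real mult_ac)
  moreover have "exp (1 *\<^sub>R ?a) = 1"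
    unfolding eq using cis_multiple_2pi[of "of_int m"] by simp
  ultimately show ?thesis
    by (simp only: scaleR_zero_left exp_zero diff_self integral_unique)
qed

lemma cis_orthonormal:
  "integral (cbox 0 1) (\<lambda>t. cis (2 * pi * (of_int k * t)) * cnj (cis (2 * pi * (of_int l * t)))) = (if k = l then 1 else 0)"
proof -
  have "cis (2 * pi * (of_int k * t)) * cnj (cis (2 * pi * (of_int l * t))) = cis (2 * pi * (of_int (k - l) * t))" for t
    by (simp add: cis_cnj cis_mult algebra_simps)
  then show ?thesis
    using integral_cis[of "k - l"] by auto
qed

lemma integral_profile:
  assumes fin: "finite A" and sym: "\<And>m. - m \<in> A \<longleftrightarrow> m \<in> A" and c: "\<And>m. c (- m) = cnj (c m)" and 0: "0 \<in> A"
  shows "integral {0..1} (profile c A) = Re (c 0)"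
    and "integral {0..1} (\<lambda>t. (profile c A t)\<^sup>2) = (\<Sum>m\<in>A. (cmod (c m))\<^sup>2)"
proof -
  have cont: "continuous_on S (\<lambda>t. cis (2 * pi * (of_int m * t)))" for S m
    unfolding cis_conv_exp by (intro continuous_intros)
  have "integral {0..1} (\<lambda>t. Re (c m * cis (2 * pi * (of_int m * t)))) = (if m = 0 then Re (c 0) else 0)" for m
  proof -
    have "(\<lambda>t. c m * cis (2 * pi * (of_int m * t))) integrable_on {0..1}"
      by (intro integrable_continuous_real continuous_intros cont)
    then have "integral {0..1} (\<lambda>t. Re (c m * cis (2 * pi * (of_int m * t))))
        = Re (integral {0..1} (\<lambda>t. c m * cis (2 * pi * (of_int m * t))))"
      by (rule integral_linear[OF _ bounded_linear_Re, unfolded o_def])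
    then show ?thesis
      using integral_cis[of m] unfolding integral_mult_right by (cases "m = 0") simp_all
  qed
  moreover have "integral {0..1} (profile c A) = (\<Sum>m\<in>A. integral {0..1} (\<lambda>t. Re (c m * cis (2 * pi * (of_int m * t)))))"
    unfolding profile_def[abs_def]
    by (intro integral_sum fin integrable_continuous_real continuous_intros)
  ultimately show "integral {0..1} (profile c A) = Re (c 0)"
    using fin 0 by simp
  have "of_real (profile c A t) = (\<Sum>m\<in>A. c m * cis (2 * pi * (of_int m * t)))" for t
    unfolding profile_def by (rule of_real_symmetric_sum) (auto simp: fin sym c cis_cnj)
  then have "(profile c A t)\<^sup>2 = (cmod (\<Sum>m\<in>A. c m * cis (2 * pi * (of_int m * t))))\<^sup>2" for t
    by (metis norm_of_real power2_abs)
  then show "integral {0..1} (\<lambda>t. (profile c A t)\<^sup>2) = (\<Sum>m\<in>A. (cmod (c m))\<^sup>2)"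
    using orthonormal_sum_integral[OF fin cont cis_orthonormal, of c] by simp
qed

lemma norm_lattice_vec_ge_1:
  assumes "k \<noteq> 0"
  shows "norm (lattice_vec k) \<ge> 1"
proof -
  obtain a where a: "lattice_vec k \<bullet> lattice_vec k = of_int a"
    using lattice_inner_Ints Ints_cases by metis
  have "lattice_vec k \<bullet> lattice_vec k > 0"
    using assms by simp
  then have "(norm (lattice_vec k))\<^sup>2 \<ge> 1\<^sup>2"
    unfolding power2_norm_eq_inner a by simp
  then show ?thesis
    by (rule power2_le_imp_le) simp
qed

lemma inj_scale_vector:
  fixes k0 :: "int ^ 'n"
  assumes "k0 \<noteq> 0"
  shows "inj (\<lambda>m. m *s k0)"
proof (rule injI)
  fix m m' :: int assume "m *s k0 = m' *s k0"
  moreover obtain i where "k0 $ i \<noteq> 0"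
    using assms by (auto simp: vec_eq_iff)
  ultimately show "m = m'"
    by (metis mult_cancel_right vector_smult_component)
qed

definition line_freqs :: "int ^ 'n \<Rightarrow> nat \<Rightarrow> int set" where
  "line_freqs k0 N = {m. m *s k0 \<in> freq_box N}"

lemma finite_line_freqs: "k0 \<noteq> 0 \<Longrightarrow> finite (line_freqs k0 N)"
  using finite_vimageI[OF finite_freq_box inj_scale_vector, of k0 N]
  by (simp add: line_freqs_def vimage_def)

lemma line_freqs_sym: "- m \<in> line_freqs k0 N \<longleftrightarrow> m \<in> line_freqs k0 N"
proof -
  have "(- m) *s k0 = - (m *s k0)" by (simp add: vec_eq_iff)
  then show ?thesis by (simp add: line_freqs_def)
qed

lemma zero_in_line_freqs: "0 \<in> line_freqs k0 N"
  by (simp add: line_freqs_def freq_box_def)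

text \<open>At momentum \<open>l Q + s k\<^sub>0\<close> with \<open>Q\<close> orthogonal to \<open>k\<^sub>0\<close> and \<open>l\<close> large, the potential is averaged
  over all directions orthogonal to \<open>k\<^sub>0\<close>, so only the Fourier modes on the line through \<open>k\<^sub>0\<close> contribute.\<close>

lemma line_estimate:
  fixes V Hbar :: "real ^ 'n \<Rightarrow> real" and k0 :: "int ^ 'n"
  defines "a \<equiv> Re (fourier_coeff V 0)" and "K \<equiv> lattice_vec k0 \<bullet> lattice_vec k0"
    and "b \<equiv> \<lambda>N. \<Sum>m\<in>line_freqs k0 N. (cmod (fourier_coeff V (m *s k0)))\<^sup>2"
    and "t \<equiv> \<lambda>N. infsum (\<lambda>k. cmod (fourier_coeff V k)) (- freq_box N)"
  assumes d: "d > 0" and V: "smooth_on_torus V"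
    and Hbar: "viscous_effective_hamiltonian d (\<lambda>p. (norm p)\<^sup>2) V Hbar"
    and prim: "primitive k0" and Qk: "Q \<bullet> lattice_vec k0 = 0"
    and Q: "\<And>k. (\<nexists>m. k = m *s k0) \<Longrightarrow> Q \<bullet> lattice_vec k \<noteq> 0"
  obtains C where "C \<ge> 0" "\<And>N s. s \<ge> 1 \<Longrightarrow> \<exists>D. \<forall>l\<ge>1.
      \<bar>Hbar (l *\<^sub>R Q + s *\<^sub>R lattice_vec k0)
        - (l\<^sup>2 * (norm Q)\<^sup>2 + (K * s\<^sup>2 + a + (b N - a\<^sup>2) / (4 * K * s\<^sup>2)))\<bar> \<le> C / s ^ 3 + t N + D / l"
proof -
  let ?\<kappa> = "lattice_vec k0" and ?c = "fourier_coeff V"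
  have nz: "k0 \<noteq> 0" using prim by (simp add: primitive_def)
  have cont: "continuous_on UNIV V" using smooth_on_torusD[OF V] by auto
  have K1: "K \<ge> 1"
    using norm_lattice_vec_ge_1[OF nz] by (simp add: K_def power2_norm_eq_inner[symmetric] one_le_power)
  let ?f = "\<lambda>k. cmod (?c k) * (1 + norm (lattice_vec k)) ^ 3"
  \<comment> \<open>Dominates the profile and its first three derivatives for every cutoff, so the
    constant \<open>C\<close> below is obtained before \<open>N\<close> and \<open>s\<close> are
    chosen.\<close>
  define M where "M = (2 * pi) ^ 3 * infsum ?f UNIV"
  have M0: "M \<ge> 0" by (auto simp: M_def intro!: mult_nonneg_nonneg infsum_nonneg)
  obtain C where C: "C \<ge> 0" and expansion:
    "\<And>U U1 U2 U3 s.
      \<lbrakk>\<And>t. (U has_real_derivative U1 t) (at t); \<And>t. (U1 has_real_derivative U2 t) (at t);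
       \<And>t. (U2 has_real_derivative U3 t) (at t); continuous_on UNIV U3;
       \<And>t. U (t + 1) = U t; \<And>t. U1 (t + 1) = U1 t;
       \<And>t. \<bar>U t\<bar> \<le> M; \<And>t. \<bar>U1 t\<bar> \<le> M; \<And>t. \<bar>U2 t\<bar> \<le> M; \<And>t. \<bar>U3 t\<bar> \<le> M; s \<ge> 1\<rbrakk> \<Longrightarrow>
      \<exists>\<phi> g g'. (\<forall>t. (\<phi> has_real_derivative g t) (at t)) \<and> (\<forall>t. (g has_real_derivative g' t) (at t)) \<and>
        continuous_on UNIV g' \<and> (\<forall>t. \<phi> (t + 1) = \<phi> t) \<and> (\<exists>B. \<forall>t. \<bar>g t\<bar> \<le> B) \<and>
        (\<forall>t. \<bar>- d * (K * g' t) + K * (s + g t)\<^sup>2 + U t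
             - (K * s\<^sup>2 + integral {0..1} U
                + (integral {0..1} (\<lambda>t. (U t)\<^sup>2) - (integral {0..1} U)\<^sup>2) / (4 * K * s\<^sup>2))\<bar> \<le> C / s ^ 3)"
    using one_dimensional_expansion[OF d K1 M0] by blast
  show ?thesis
  proof (rule that[OF C])
    fix N and s :: real assume s: "s \<ge> 1"
    define A where "A = line_freqs k0 N"
    \<comment> \<open>The coefficients of the \<open>j\<close>-th derivative of the profile.\<close>
    define c where "c j m = (2 * pi * \<i> * of_int m) ^ j * ?c (m *s k0)" for j :: nat and m
    have finA: "finite A" unfolding A_def by (rule finite_line_freqs[OF nz])
    have cSuc: "c (Suc j) = (\<lambda>m. 2 * pi * \<i> * of_int m * c j m)" for j
      by (simp add: c_def fun_eq_iff mult.assoc)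
    have D: "(profile (c j) A has_real_derivative profile (c (Suc j)) A t) (at t)" for j t
      unfolding cSuc by (rule DERIV_profile)
    have bound: "\<bar>profile (c j) A t\<bar> \<le> M" if "j \<le> 3" for j t
    proof -
      have "\<bar>profile (c j) A t\<bar> \<le> (\<Sum>m\<in>A. cmod (c j m))"
        by (rule abs_profile_le)
      also have "\<dots> \<le> (\<Sum>m\<in>A. (2 * pi) ^ 3 * ?f (m *s k0))"
      proof (rule sum_mono)
        fix m assume "m \<in> A"
        have "\<bar>of_int m\<bar> * 1 \<le> \<bar>of_int m\<bar> * norm ?\<kappa>"
          by (intro mult_left_mono norm_lattice_vec_ge_1 nz) simp
        then have 1: "2 * pi * \<bar>of_int m\<bar> \<le> 2 * pi * (1 + norm (lattice_vec (m *s k0)))"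
          by simp
        have "1 * 1 \<le> 2 * pi * (1 + norm (lattice_vec (m *s k0)))"
          using pi_ge_two by (intro mult_mono) auto
        then have 2: "(2 * pi * (1 + norm (lattice_vec (m *s k0)))) ^ j \<le> (2 * pi * (1 + norm (lattice_vec (m *s k0)))) ^ 3"
          using that by (intro power_increasing) auto
        have "(2 * pi * \<bar>of_int m\<bar>) ^ j \<le> (2 * pi * (1 + norm (lattice_vec (m *s k0)))) ^ j"
          by (intro power_mono 1) simp
        also note 2
        finally have "(2 * pi * \<bar>of_int m\<bar>) ^ j * cmod (?c (m *s k0))
            \<le> (2 * pi * (1 + norm (lattice_vec (m *s k0)))) ^ 3 * cmod (?c (m *s k0))"
          by (intro mult_right_mono) auto
        then show "cmod (c j m) \<le> (2 * pi) ^ 3 * ?f (m *s k0)"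
          unfolding c_def norm_mult norm_power power_mult_distrib by (simp add: norm_mult mult_ac)
      qed
      also have "\<dots> = (2 * pi) ^ 3 * sum ?f ((\<lambda>m. m *s k0) ` A)"
        unfolding sum_distrib_left[symmetric]
        by (subst sum.reindex) (auto intro: inj_on_subset[OF inj_scale_vector[OF nz]])
      also have "\<dots> \<le> M"
        unfolding M_def using finA
        by (intro mult_left_mono finite_sum_le_infsum summable_fourier_coeff_cubic[OF V]) auto
      finally show ?thesis .
    qed
    have "(- m) *s k0 = - (m *s k0)" for m by (simp add: vec_eq_iff)
    then have sym: "c 0 (- m) = cnj (c 0 m)" for m
      by (simp add: c_def fourier_coeff_uminus[OF cont])
    note ints = integral_profile[where c = "c 0", OF finA line_freqs_sym[of _ k0 N, folded A_def] sym zero_in_line_freqs[of k0 N, folded A_def]]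
    have ints': "integral {0..1} (profile (c 0) A) = a" "integral {0..1} (\<lambda>t. (profile (c 0) A t)\<^sup>2) = b N"
      using ints by (simp_all add: a_def b_def c_def A_def)
    obtain \<phi> g g' Bg where \<phi>: "\<And>t. (\<phi> has_real_derivative g t) (at t)" and g: "\<And>t. (g has_real_derivative g' t) (at t)"
      and cg': "continuous_on UNIV g'" and \<phi>per: "\<And>t. \<phi> (t + 1) = \<phi> t" and Bg: "\<And>t. \<bar>g t\<bar> \<le> Bg"
      and res: "\<And>t. \<bar>- d * (K * g' t) + K * (s + g t)\<^sup>2 + profile (c 0) A t
             - (K * s\<^sup>2 + a + (b N - a\<^sup>2) / (4 * K * s\<^sup>2))\<bar> \<le> C / s ^ 3"
      using expansion[OF D[of 0] D D continuous_on_profile profile_periodic profile_periodic bound bound bound bound s]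
      unfolding ints' by auto
    define L where "L = (\<lambda>m. m *s k0) ` A"
    have L: "L \<subseteq> freq_box N"
      by (auto simp: L_def A_def line_freqs_def)
    define T where "T x = (\<Sum>k\<in>freq_box N - L. Re (?c k * wave k x))" for x
    \<comment> \<open>The factor one half compensates the cross term
      \<open>2 * (Q \<bullet> G x)\<close> produced by squaring the norm.\<close>
    have "transport_solvable Q (\<lambda>x. \<Sum>k\<in>freq_box N - L. Re ((- ?c k / 2) * wave k x))"
    proof (intro transport_solvable_sum transport_solvable_wave Q)
      fix k assume "k \<in> freq_box N - L"
      then show "\<nexists>m. k = m *s k0"
        by (auto simp: L_def A_def line_freqs_def)
    qed simp
    then obtain v G S B where v: "has_C2 v G S" "periodic v"
      and QG: "\<And>x. Q \<bullet> G x = (\<Sum>k\<in>freq_box N - L. Re ((- ?c k / 2) * wave k x))"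
      and B: "\<And>x. norm (G x) \<le> B" "\<And>x. \<bar>\<Sum>i\<in>UNIV. S i x $ i\<bar> \<le> B"
      unfolding transport_solvable_def by blast
    have B0: "B \<ge> 0" using B(1)[of 0] norm_ge_zero order_trans by blast
    have Bg0: "Bg \<ge> 0" using Bg[of 0] by simp
    have QT: "2 * (Q \<bullet> G x) = - T x" for x
    proof -
      have "2 * Re ((- z / 2) * w) = - Re (z * w)" for z w
        by (simp add: field_simps)
      then show ?thesis
        unfolding QG T_def sum_distrib_left sum_negf[symmetric] by (rule sum.cong[OF refl])
    qed
    have wave_line: "wave (m *s k0) x = cis (2 * pi * (of_int m * (?\<kappa> \<bullet> x)))" for m x
      by (simp add: wave_def)
    have split: "fourier_sum V N x = profile (c 0) A (?\<kappa> \<bullet> x) + T x" for x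
    proof -
      have "fourier_sum V N x = (\<Sum>k\<in>L. Re (?c k * wave k x)) + T x"
        unfolding fourier_sum_def T_def using sum.subset_diff[OF L finite_freq_box] by (simp add: add.commute)
      also have "(\<Sum>k\<in>L. Re (?c k * wave k x)) = profile (c 0) A (?\<kappa> \<bullet> x)"
        unfolding L_def profile_def
        by (subst sum.reindex) (auto intro: inj_on_subset[OF inj_scale_vector[OF nz]] simp: c_def wave_line)
      finally show ?thesis .
    qed
    have err: "\<bar>V x - fourier_sum V N x\<bar> \<le> t N" for x
      unfolding t_def by (rule fourier_sum_error[OF V])
    \<comment> \<open>Collects the three terms of order \<open>1 / l\<close>: the diffusion of the
      corrector, its squared gradient, and its coupling with the direction \<open>k0\<close>. It
      depends on \<open>N\<close> and \<open>s\<close> through \<open>B\<close> and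
      \<open>Bg\<close>, which is harmless because \<open>l\<close> goes to infinity first.\<close>
    define E where "E = d * B + B\<^sup>2 + 2 * (s + Bg) * (norm ?\<kappa> * B)"
    interpret P: periodic_fun_simple' \<phi>
      by unfold_locales (rule \<phi>per)
    show "\<exists>D. \<forall>l\<ge>1. \<bar>Hbar (l *\<^sub>R Q + s *\<^sub>R ?\<kappa>)
        - (l\<^sup>2 * (norm Q)\<^sup>2 + (K * s\<^sup>2 + a + (b N - a\<^sup>2) / (4 * K * s\<^sup>2)))\<bar> \<le> C / s ^ 3 + t N + D / l"
    proof (intro exI[of _ E] allI impI)
      fix l :: real assume l: "l \<ge> 1"
      note C2 = has_C2_add[OF has_C2_plane_wave[OF \<phi> g cg', of ?\<kappa>] has_C2_mult[OF v(1), of "1 / l"]]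
      show "\<bar>Hbar (l *\<^sub>R Q + s *\<^sub>R ?\<kappa>) - (l\<^sup>2 * (norm Q)\<^sup>2 + (K * s\<^sup>2 + a + (b N - a\<^sup>2) / (4 * K * s\<^sup>2)))\<bar>
          \<le> C / s ^ 3 + t N + E / l"
      proof (rule viscous_effective_hamiltonian_estimate[OF d Hbar C2])
        show "periodic (\<lambda>x. \<phi> (?\<kappa> \<bullet> x) + 1 / l * v x)"
          unfolding periodic_def
        proof (intro allI)
          fix x k
          obtain n where "?\<kappa> \<bullet> lattice_vec k = of_int n"
            using lattice_inner_Ints Ints_cases by metis
          then show "\<phi> (?\<kappa> \<bullet> (x + lattice_vec k)) + 1 / l * v (x + lattice_vec k) = \<phi> (?\<kappa> \<bullet> x) + 1 / l * v x"
            by (simp add: inner_add_right P.plus_of_int periodicD[OF v(2)])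
        qed
        fix x
        let ?t = "?\<kappa> \<bullet> x" and ?S = "\<Sum>i\<in>UNIV. S i x $ i"
        let ?\<beta> = "K * s\<^sup>2 + a + (b N - a\<^sup>2) / (4 * K * s\<^sup>2)"
        have lap: "(\<Sum>i\<in>UNIV. ((g' ?t * ?\<kappa> $ i) *\<^sub>R ?\<kappa> + (1 / l) *\<^sub>R S i x) $ i) = K * g' ?t + ?S / l"
        proof -
          have "(\<Sum>i\<in>UNIV. ((g' ?t * ?\<kappa> $ i) *\<^sub>R ?\<kappa>) $ i) = K * g' ?t"
            unfolding K_def inner_vec_def sum_distrib_right by (simp add: mult_ac)
          moreover have "(\<Sum>i\<in>UNIV. ((1 / l) *\<^sub>R S i x) $ i) = ?S / l"
            by (simp add: sum_divide_distrib)
          ultimately show ?thesis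
            by (simp only: vector_add_component sum.distrib)
        qed
        \<comment> \<open>Orthogonality of \<open>Q\<close> and \<open>k0\<close> removes the cross
          term that would grow with \<open>l\<close>. Of the others,
          \<open>2 * (Q \<bullet> G x)\<close> is of order one and equals \<open>- T x\<close>; the
          rest decays.\<close>
        have sq: "(norm (l *\<^sub>R Q + s *\<^sub>R ?\<kappa> + (g ?t *\<^sub>R ?\<kappa> + (1 / l) *\<^sub>R G x)))\<^sup>2
            = l\<^sup>2 * (norm Q)\<^sup>2 + K * (s + g ?t)\<^sup>2 - T x + ((norm (G x))\<^sup>2 / l\<^sup>2 + 2 * (s + g ?t) * (?\<kappa> \<bullet> G x) / l)"
        proof -
          have e1: "l *\<^sub>R Q + s *\<^sub>R ?\<kappa> + (g ?t *\<^sub>R ?\<kappa> + (1 / l) *\<^sub>R G x) = l *\<^sub>R Q + (s + g ?t) *\<^sub>R ?\<kappa> + (1 / l) *\<^sub>R G x"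
            by (simp add: scaleR_add_left)
          have e2: "(norm (l *\<^sub>R Q + r *\<^sub>R ?\<kappa> + (1 / l) *\<^sub>R y))\<^sup>2
            = l\<^sup>2 * (norm Q)\<^sup>2 + K * r\<^sup>2 + 2 * (Q \<bullet> y) + ((norm y)\<^sup>2 / l\<^sup>2 + 2 * r * (?\<kappa> \<bullet> y) / l)" for r y
          proof -
            have sym: "?\<kappa> \<bullet> Q = 0" "y \<bullet> Q = Q \<bullet> y" "y \<bullet> ?\<kappa> = ?\<kappa> \<bullet> y"
              using Qk by (simp_all only: inner_commute)
            show ?thesis
              unfolding power2_norm_eq_inner K_def inner_add_left inner_add_right inner_scaleR_left inner_scaleR_right Qk sym
              using l by (simp add: field_simps power2_eq_square)
          qed
          show ?thesis
            unfolding e1 e2 QT by simp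
        qed
        have "- d * (\<Sum>i\<in>UNIV. ((g' ?t * ?\<kappa> $ i) *\<^sub>R ?\<kappa> + (1 / l) *\<^sub>R S i x) $ i)
            + (norm (l *\<^sub>R Q + s *\<^sub>R ?\<kappa> + (g ?t *\<^sub>R ?\<kappa> + (1 / l) *\<^sub>R G x)))\<^sup>2 + V x - (l\<^sup>2 * (norm Q)\<^sup>2 + ?\<beta>)
          = (- d * (K * g' ?t) + K * (s + g ?t)\<^sup>2 + profile (c 0) A ?t - ?\<beta>) + (V x - fourier_sum V N x)
            + (- (d * (?S / l)) + (norm (G x))\<^sup>2 / l\<^sup>2 + 2 * (s + g ?t) * (?\<kappa> \<bullet> G x) / l)"
          unfolding lap sq split by (simp add: algebra_simps)
        also have "\<bar>\<dots>\<bar> \<le> C / s ^ 3 + t N + E / l"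
        proof -
          have 1: "\<bar>- (d * (?S / l))\<bar> \<le> d * B / l"
            using d l B(2)[of x] by (simp add: abs_mult divide_right_mono)
          have 2: "\<bar>(norm (G x))\<^sup>2 / l\<^sup>2\<bar> \<le> B\<^sup>2 / l"
            using l B(1)[of x] self_le_power[of l 2] by (simp add: abs_divide) (intro frac_le power_mono, auto)
          have "\<bar>2 * (s + g ?t) * (?\<kappa> \<bullet> G x)\<bar> \<le> 2 * (s + Bg) * (norm ?\<kappa> * B)"
          proof -
            have "\<bar>s + g ?t\<bar> \<le> s + Bg" using Bg[of ?t] s by linarith
            moreover have "\<bar>?\<kappa> \<bullet> G x\<bar> \<le> norm ?\<kappa> * B"
              by (rule order_trans[OF Cauchy_Schwarz_ineq2]) (intro mult_left_mono B norm_ge_zero)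
            ultimately show ?thesis
              unfolding abs_mult using s Bg0 by (intro mult_mono) auto
          qed
          then have 3: "\<bar>2 * (s + g ?t) * (?\<kappa> \<bullet> G x) / l\<bar> \<le> 2 * (s + Bg) * (norm ?\<kappa> * B) / l"
            using l by (simp add: abs_divide divide_right_mono)
          have Eeq: "E / l = d * B / l + B\<^sup>2 / l + 2 * (s + Bg) * (norm ?\<kappa> * B) / l"
            by (simp add: E_def add_divide_distrib)
          have five: "\<bar>y1 + y2 + (y3 + y4 + y5)\<bar> \<le> z1 + z2 + (z3 + z4 + z5)"
            if "\<bar>y1\<bar> \<le> z1" "\<bar>y2\<bar> \<le> z2" "\<bar>y3\<bar> \<le> z3" "\<bar>y4\<bar> \<le> z4" "\<bar>y5\<bar> \<le> z5" for y1 y2 y3 y4 y5 z1 z2 z3 z4 z5 :: real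
            using that by linarith
          show ?thesis
            unfolding Eeq by (rule five[OF res err 1 2 3])
        qed
        finally show "\<bar>- d * (\<Sum>i\<in>UNIV. ((g' ?t * ?\<kappa> $ i) *\<^sub>R ?\<kappa> + (1 / l) *\<^sub>R S i x) $ i)
            + (norm (l *\<^sub>R Q + s *\<^sub>R ?\<kappa> + (g ?t *\<^sub>R ?\<kappa> + (1 / l) *\<^sub>R G x)))\<^sup>2 + V x - (l\<^sup>2 * (norm Q)\<^sup>2 + ?\<beta>)\<bar>
          \<le> C / s ^ 3 + t N + E / l" .
      qed
    qed
  qed
qed

section \<open>Recovering the mean and the square norm from the expansion\<close>

lemma le_of_le_add_inverse:
  fixes x y D :: real
  assumes "\<And>l. l \<ge> 1 \<Longrightarrow> x \<le> y + D / l"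
  shows "x \<le> y"
proof (rule field_le_epsilon)
  fix e :: real assume e: "e > 0"
  define l where "l = max 1 (\<bar>D\<bar> / e)"
  have "\<bar>D\<bar> \<le> e * l"
    using e by (simp add: l_def pos_divide_le_eq[symmetric] mult.commute)
      (simp add: pos_divide_le_eq mult.commute max_def)
  moreover have l: "l \<ge> 1" by (simp add: l_def)
  ultimately have "D / l \<le> e"
    by (simp add: pos_divide_le_eq)
  then show "x \<le> y + e"
    using assms[OF l] by simp
qed

text \<open>Letting \<open>s\<close> grow gives \<open>x = 0\<close>; after multiplication by
  \<open>s\<^sup>2\<close> the right-hand side still tends to zero, which gives
  \<open>y = 0\<close>.\<close>

lemma expansion_coefficients_zero:
  fixes x y C :: real
  assumes C: "C \<ge> 0" and le: "\<And>s. s \<ge> 1 \<Longrightarrow> \<bar>x + y / s\<^sup>2\<bar> \<le> C / s ^ 3"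
  shows "x = 0" "y = 0"
proof -
  have "\<bar>x\<bar> \<le> 0 + (C + \<bar>y\<bar>) / s" if s: "s \<ge> 1" for s
  proof -
    have "\<bar>x\<bar> \<le> C / s ^ 3 + \<bar>y\<bar> / s\<^sup>2"
    proof -
      have "\<bar>y / s\<^sup>2\<bar> = \<bar>y\<bar> / s\<^sup>2" by (simp add: abs_divide)
      then show ?thesis using le[OF s] by linarith
    qed
    also have "\<dots> \<le> C / s + \<bar>y\<bar> / s"
      using C s self_le_power[of s 3] self_le_power[of s 2] by (intro add_mono divide_left_mono) auto
    finally show ?thesis by (simp add: add_divide_distrib)
  qed
  then have "\<bar>x\<bar> \<le> 0" by (rule le_of_le_add_inverse)
  then show x: "x = 0" by simp
  have "\<bar>y\<bar> \<le> 0 + C / s" if s: "s \<ge> 1" for s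
  proof -
    have "\<bar>y\<bar> / s\<^sup>2 * s\<^sup>2 \<le> C / s ^ 3 * s\<^sup>2"
      using le[OF s] x by (intro mult_right_mono) (auto simp: abs_divide)
    then show ?thesis
      using s by (simp add: power2_eq_square power3_eq_cube)
  qed
  then have "\<bar>y\<bar> \<le> 0" by (rule le_of_le_add_inverse)
  then show "y = 0" by simp
qed

lemma line_sum_tendsto:
  fixes f :: "int ^ 'n \<Rightarrow> real"
  assumes s: "f summable_on UNIV" and nz: "k0 \<noteq> 0"
  shows "(\<lambda>m. f (m *s k0)) summable_on UNIV"
    and "(\<lambda>N. \<Sum>m\<in>line_freqs k0 N. f (m *s k0)) \<longlonglongrightarrow> infsum (\<lambda>m. f (m *s k0)) UNIV"
proof -
  have "f summable_on range (\<lambda>m. m *s k0)"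
    by (rule summable_on_subset_banach[OF s]) simp
  then show sm: "(\<lambda>m. f (m *s k0)) summable_on UNIV"
    by (subst (asm) summable_on_reindex[OF inj_scale_vector[OF nz]]) (simp add: o_def)
  have "filterlim (line_freqs k0) (finite_subsets_at_top UNIV) sequentially"
    unfolding filterlim_finite_subsets_at_top
  proof (intro allI impI)
    fix X :: "int set" assume "finite X \<and> X \<subseteq> UNIV"
    then obtain N0 where N0: "(\<lambda>m. m *s k0) ` X \<subseteq> freq_box N0"
      using finite_subset_freq_box by (metis finite_imageI)
    have "X \<subseteq> line_freqs k0 N" if "N \<ge> N0" for N
      using N0 freq_box_mono[OF that] by (auto simp: line_freqs_def)
    then show "\<forall>\<^sub>F N in sequentially. finite (line_freqs k0 N) \<and> X \<subseteq> line_freqs k0 N \<and> line_freqs k0 N \<subseteq> UNIV"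
      using finite_line_freqs[OF nz] unfolding eventually_sequentially by blast
  qed
  then show "(\<lambda>N. \<Sum>m\<in>line_freqs k0 N. f (m *s k0)) \<longlonglongrightarrow> infsum (\<lambda>m. f (m *s k0)) UNIV"
    using has_sum_infsum[OF sm] unfolding has_sum_def by (rule filterlim_compose[rotated])
qed

lemma line_spectrum_determined:
  fixes V1 V2 Hbar :: "real ^ 'n \<Rightarrow> real" and k0 :: "int ^ 'n"
  assumes d: "d > 0" and V1: "smooth_on_torus V1" and V2: "smooth_on_torus V2"
    and H1: "viscous_effective_hamiltonian d (\<lambda>p. (norm p)\<^sup>2) V1 Hbar"
    and H2: "viscous_effective_hamiltonian d (\<lambda>p. (norm p)\<^sup>2) V2 Hbar"
    and prim: "primitive k0"
  shows "Re (fourier_coeff V1 0) = Re (fourier_coeff V2 0)"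
    and "infsum (\<lambda>m. (cmod (fourier_coeff V1 (m *s k0)))\<^sup>2) UNIV = infsum (\<lambda>m. (cmod (fourier_coeff V2 (m *s k0)))\<^sup>2) UNIV"
proof -
  let ?\<kappa> = "lattice_vec k0"
  have nz: "k0 \<noteq> 0" using prim by (simp add: primitive_def)
  obtain Q where Q: "Q \<bullet> ?\<kappa> = 0" "\<And>k. (\<nexists>m. k = m *s k0) \<Longrightarrow> Q \<bullet> lattice_vec k \<noteq> 0"
    using generic_orthogonal_direction[OF prim] by blast
  define K where "K = ?\<kappa> \<bullet> ?\<kappa>"
  have K0: "K > 0" using nz by (simp add: K_def)
  define a where "a V = Re (fourier_coeff V 0)" for V :: "real ^ 'n \<Rightarrow> real"
  define b where "b V N = (\<Sum>m\<in>line_freqs k0 N. (cmod (fourier_coeff V (m *s k0)))\<^sup>2)" for V N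
  define bl where "bl V = infsum (\<lambda>m. (cmod (fourier_coeff V (m *s k0)))\<^sup>2) UNIV" for V
  define t where "t V N = infsum (\<lambda>k. cmod (fourier_coeff V k)) (- freq_box N)" for V :: "real ^ 'n \<Rightarrow> real" and N
  define \<beta> where "\<beta> V N s = K * s\<^sup>2 + a V + (b V N - (a V)\<^sup>2) / (4 * K * s\<^sup>2)" for V N s
  obtain C1 where C1: "C1 \<ge> 0" "\<And>N s. s \<ge> 1 \<Longrightarrow> \<exists>D. \<forall>l\<ge>1.
      \<bar>Hbar (l *\<^sub>R Q + s *\<^sub>R ?\<kappa>) - (l\<^sup>2 * (norm Q)\<^sup>2 + \<beta> V1 N s)\<bar> \<le> C1 / s ^ 3 + t V1 N + D / l"
    using line_estimate[OF d V1 H1 prim Q] unfolding \<beta>_def a_def b_def t_def K_def by blast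
  obtain C2 where C2: "C2 \<ge> 0" "\<And>N s. s \<ge> 1 \<Longrightarrow> \<exists>D. \<forall>l\<ge>1.
      \<bar>Hbar (l *\<^sub>R Q + s *\<^sub>R ?\<kappa>) - (l\<^sup>2 * (norm Q)\<^sup>2 + \<beta> V2 N s)\<bar> \<le> C2 / s ^ 3 + t V2 N + D / l"
    using line_estimate[OF d V2 H2 prim Q] unfolding \<beta>_def a_def b_def t_def K_def by blast
  \<comment> \<open>The limit in \<open>l\<close>, at fixed \<open>N\<close> and \<open>s\<close>:
    subtraction cancels \<open>Hbar\<close> and the divergent
    \<open>l\<^sup>2 * (norm Q)\<^sup>2\<close>, and the uncontrolled constants \<open>D1\<close>,
    \<open>D2\<close> disappear.\<close>
  have fin: "\<bar>\<beta> V1 N s - \<beta> V2 N s\<bar> \<le> (C1 + C2) / s ^ 3 + t V1 N + t V2 N" if s: "s \<ge> 1" for N s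
  proof -
    obtain D1 where D1: "\<And>l. l \<ge> 1 \<Longrightarrow>
      \<bar>Hbar (l *\<^sub>R Q + s *\<^sub>R ?\<kappa>) - (l\<^sup>2 * (norm Q)\<^sup>2 + \<beta> V1 N s)\<bar> \<le> C1 / s ^ 3 + t V1 N + D1 / l"
      using C1(2)[OF s] by blast
    obtain D2 where D2: "\<And>l. l \<ge> 1 \<Longrightarrow>
      \<bar>Hbar (l *\<^sub>R Q + s *\<^sub>R ?\<kappa>) - (l\<^sup>2 * (norm Q)\<^sup>2 + \<beta> V2 N s)\<bar> \<le> C2 / s ^ 3 + t V2 N + D2 / l"
      using C2(2)[OF s] by blast
    show ?thesis
    proof (rule le_of_le_add_inverse)
      fix l :: real assume l: "l \<ge> 1"
      have "(C1 + C2) / s ^ 3 = C1 / s ^ 3 + C2 / s ^ 3" "(D1 + D2) / l = D1 / l + D2 / l"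
        by (simp_all add: add_divide_distrib)
      then show "\<bar>\<beta> V1 N s - \<beta> V2 N s\<bar> \<le> (C1 + C2) / s ^ 3 + t V1 N + t V2 N + (D1 + D2) / l"
        using D1[OF l] D2[OF l] by linarith
    qed
  qed
  have t0: "t V \<longlonglongrightarrow> 0" if "smooth_on_torus V" for V
    unfolding t_def[abs_def]
    by (rule summable_tail_tendsto_0[OF summable_fourier_coeff[OF that]]) simp
  have bl: "b V \<longlonglongrightarrow> bl V" if "smooth_on_torus V" for V
    unfolding b_def[abs_def] bl_def
    by (rule line_sum_tendsto(2)[OF has_sum_imp_summable[OF parseval[OF that]] nz])
  \<comment> \<open>The limit in \<open>N\<close>, at fixed \<open>s\<close>: the tails vanish and
    the truncated line sums converge, while \<open>C1\<close> and \<open>C2\<close> stay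
    fixed.\<close>
  have key: "\<bar>(a V1 - a V2) + (((bl V1 - (a V1)\<^sup>2) - (bl V2 - (a V2)\<^sup>2)) / (4 * K)) / s\<^sup>2\<bar> \<le> (C1 + C2) / s ^ 3"
    if s: "s \<ge> 1" for s
  proof -
    have "(\<lambda>N. \<bar>\<beta> V1 N s - \<beta> V2 N s\<bar>) \<longlonglongrightarrow>
      \<bar>(K * s\<^sup>2 + a V1 + (bl V1 - (a V1)\<^sup>2) / (4 * K * s\<^sup>2)) - (K * s\<^sup>2 + a V2 + (bl V2 - (a V2)\<^sup>2) / (4 * K * s\<^sup>2))\<bar>"
      unfolding \<beta>_def using K0 s by (intro tendsto_intros bl V1 V2) auto
    moreover have "(\<lambda>N. (C1 + C2) / s ^ 3 + t V1 N + t V2 N) \<longlonglongrightarrow> (C1 + C2) / s ^ 3 + 0 + 0"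
      by (intro tendsto_intros t0 V1 V2)
    ultimately have "\<bar>(K * s\<^sup>2 + a V1 + (bl V1 - (a V1)\<^sup>2) / (4 * K * s\<^sup>2)) - (K * s\<^sup>2 + a V2 + (bl V2 - (a V2)\<^sup>2) / (4 * K * s\<^sup>2))\<bar>
        \<le> (C1 + C2) / s ^ 3 + 0 + 0"
      by (rule LIMSEQ_le) (use fin[OF s] in blast)
    moreover have "(K * s\<^sup>2 + u + x / (4 * K * s\<^sup>2)) - (K * s\<^sup>2 + v + y / (4 * K * s\<^sup>2)) = (u - v) + ((x - y) / (4 * K)) / s\<^sup>2" for u v x y
      by (simp add: diff_divide_distrib)
    ultimately show ?thesis by simp
  qed
  have C: "C1 + C2 \<ge> 0" using C1 C2 by simp
  \<comment> \<open>The limit in \<open>s\<close>. The means must be equated first, because the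
    coefficient of \<open>1 / s\<^sup>2\<close> contains their squares.\<close>
  have a: "a V1 = a V2"
    using expansion_coefficients_zero(1)[OF C key] by simp
  then show "Re (fourier_coeff V1 0) = Re (fourier_coeff V2 0)"
    by (simp add: a_def)
  have "((bl V1 - (a V1)\<^sup>2) - (bl V2 - (a V2)\<^sup>2)) / (4 * K) = 0"
    by (rule expansion_coefficients_zero(2)[OF C key])
  then have "bl V1 = bl V2"
    using K0 a by simp
  then show "infsum (\<lambda>m. (cmod (fourier_coeff V1 (m *s k0)))\<^sup>2) UNIV = infsum (\<lambda>m. (cmod (fourier_coeff V2 (m *s k0)))\<^sup>2) UNIV"
    by (simp add: bl_def)
qed

lemma fourier_coeff_0:
  assumes "continuous_on UNIV V"
  shows "fourier_coeff V 0 = of_real (torus_integral V)"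
proof -
  have "integral (cbox 0 1) (\<lambda>x. complex_of_real (V x)) = of_real (integral (cbox 0 1) V)"
    by (rule integral_linear[OF continuous_integrable_on_cube[OF assms] bounded_linear_of_real, unfolded o_def])
  then show ?thesis
    by (simp add: fourier_coeff_eq torus_integral_eq)
qed

text \<open>Line sums run over all multiples of \<open>k0\<close>, the decomposition of the lattice
  only over positive ones; this converts between the two.\<close>

lemma infsum_even_int:
  fixes f :: "int \<Rightarrow> real"
  assumes s: "f summable_on UNIV" and even: "\<And>m. f (- m) = f m"
  shows "infsum f UNIV = f 0 + 2 * infsum f {1..}"
proof -
  have sA: "f summable_on A" for A
    by (rule summable_on_subset_banach[OF s]) simp
  have "infsum f {..- 1} = infsum (\<lambda>m. f (- m)) {1..}"
    by (rule infsum_reindex_bij_betw[symmetric], rule bij_betw_byWitness[where f' = uminus]) auto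
  then have "infsum f {..- 1} = infsum f {1..}"
    by (simp add: even)
  moreover have "(UNIV :: int set) = {..- 1} \<union> ({0} \<union> {1..})"
    by auto
  moreover have "infsum f ({..- 1} \<union> ({0} \<union> {1..})) = infsum f {..- 1} + infsum f ({0} \<union> {1..})"
    by (rule infsum_Un_disjoint[OF sA sA]) auto
  moreover have "infsum f ({0} \<union> {1..}) = infsum f {0} + infsum f {1..}"
    by (rule infsum_Un_disjoint[OF sA sA]) auto
  ultimately show ?thesis by simp
qed

theorem mean_and_L2_norm_determined:
  fixes V1 V2 Hbar :: "real ^ 'n \<Rightarrow> real"
  assumes d: "d > 0" and V1: "smooth_on_torus V1" and V2: "smooth_on_torus V2"
    and H1: "viscous_effective_hamiltonian d (\<lambda>p. (norm p)\<^sup>2) V1 Hbar"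
    and H2: "viscous_effective_hamiltonian d (\<lambda>p. (norm p)\<^sup>2) V2 Hbar"
  shows "torus_integral V1 = torus_integral V2"
    and "torus_integral (\<lambda>x. (V1 x)\<^sup>2) = torus_integral (\<lambda>x. (V2 x)\<^sup>2)"
proof -
  have c1: "continuous_on UNIV V1" and c2: "continuous_on UNIV V2"
    using smooth_on_torusD V1 V2 by auto
  define f where "f V k = (cmod (fourier_coeff V k))\<^sup>2" for V :: "real ^ 'n \<Rightarrow> real" and k
  have sf: "f V summable_on A" if "smooth_on_torus V" for V A
    unfolding f_def[abs_def]
    by (rule summable_on_subset_banach[OF has_sum_imp_summable[OF parseval[OF that]]]) simp
  \<comment> \<open>Any one line determines the mean; a primitive vector on an arbitrary coordinate
    axis supplies such a line.\<close>
  have "axis undefined 1 \<noteq> (0 :: int ^ 'n)"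
    by (simp add: axis_eq_0_iff)
  then obtain k1 :: "int ^ 'n" where k1: "primitive k1"
    using primitive_exists by metis
  have 0: "fourier_coeff V1 0 = fourier_coeff V2 0"
    using line_spectrum_determined(1)[OF d V1 V2 H1 H2 k1] by (simp add: fourier_coeff_0 c1 c2)
  then show "torus_integral V1 = torus_integral V2"
    by (simp add: fourier_coeff_0 c1 c2)
  \<comment> \<open>Squared moduli are even in the frequency, and the zero modes already agree, so
    equal sums over a line give equal sums over its half-lines.\<close>
  have half: "infsum (\<lambda>m. f V1 (m *s k0)) {1..} = infsum (\<lambda>m. f V2 (m *s k0)) {1..}" if p: "primitive k0" for k0
  proof -
    have nz: "k0 \<noteq> 0" using p by (simp add: primitive_def)
    have ev: "infsum (\<lambda>m. f V (m *s k0)) UNIV = f V 0 + 2 * infsum (\<lambda>m. f V (m *s k0)) {1..}"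
      if V: "smooth_on_torus V" for V
    proof -
      have "f V ((- m) *s k0) = f V (m *s k0)" for m
      proof -
        have "(- m) *s k0 = - (m *s k0)" by (simp add: vec_eq_iff)
        then show ?thesis
          by (simp add: f_def fourier_coeff_uminus[OF smooth_on_torusD(2)[OF V]])
      qed
      then show ?thesis
        using infsum_even_int[OF line_sum_tendsto(1)[OF sf[OF V] nz]] by simp
    qed
    have "infsum (\<lambda>m. f V1 (m *s k0)) UNIV = infsum (\<lambda>m. f V2 (m *s k0)) UNIV"
      unfolding f_def by (rule line_spectrum_determined(2)[OF d V1 V2 H1 H2 p])
    moreover have "f V1 0 = f V2 0"
      by (simp add: f_def 0)
    ultimately show ?thesis
      by (simp add: ev V1 V2)
  qed
  \<comment> \<open>Parseval's sum is split into the zero frequency and the half-lines, which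
    reduces the square norm to the quantities just compared.\<close>
  have total: "torus_integral (\<lambda>x. (V x)\<^sup>2) = f V 0 + infsum (\<lambda>k0. infsum (\<lambda>m. f V (m *s k0)) {1..}) {k0. primitive k0}"
    if V: "smooth_on_torus V" for V
  proof -
    have "torus_integral (\<lambda>x. (V x)\<^sup>2) = infsum (f V) ({0} \<union> - {0})"
      unfolding f_def[abs_def] using infsumI[OF parseval[OF V]] by simp
    also have "\<dots> = f V 0 + infsum (f V) (- {0})"
      by (subst infsum_Un_disjoint) (auto intro: sf V)
    also have "infsum (f V) (- {0}) = infsum (\<lambda>(k0, m). f V (m *s k0)) ({k0. primitive k0} \<times> {1..})"
      using infsum_reindex_bij_betw[OF primitive_times_bij, of "f V"] by (simp add: case_prod_unfold)
    also have "\<dots> = infsum (\<lambda>k0. infsum (\<lambda>m. f V (m *s k0)) {1..}) {k0. primitive k0}"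
    proof (rule infsum_Sigma'_banach[symmetric])
      show "(\<lambda>(k0, m). f V (m *s k0)) summable_on {k0. primitive k0} \<times> {1..}"
        using summable_on_reindex_bij_betw[OF primitive_times_bij, of "f V"] sf[OF V]
        by (simp add: case_prod_unfold)
    qed
    finally show ?thesis .
  qed
  have "infsum (\<lambda>k0. infsum (\<lambda>m. f V1 (m *s k0)) {1..}) {k0. primitive k0}
      = infsum (\<lambda>k0. infsum (\<lambda>m. f V2 (m *s k0)) {1..}) {k0. primitive k0}"
    by (rule infsum_cong) (simp add: half)
  then show "torus_integral (\<lambda>x. (V1 x)\<^sup>2) = torus_integral (\<lambda>x. (V2 x)\<^sup>2)"
    by (simp add: total V1 V2 f_def 0)
qed

theorem theorem1p6:
  fixes d :: real and V1 V2 :: "real ^ 'n \<Rightarrow> real"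
  assumes "d > 0" and "smooth_on_torus V1" and "smooth_on_torus V2"
  shows
    "(\<forall>H Hd1 Hd2.
        C_k 2 H \<longrightarrow> bdd_above (range (\<lambda>p. onorm (\<lambda>v. hessian H p *v v))) \<longrightarrow> superlinear H \<longrightarrow>
        viscous_effective_hamiltonian d H V1 Hd1 \<longrightarrow>
        viscous_effective_hamiltonian d H V2 Hd2 \<longrightarrow>
        (\<forall>Q. diophantine Q \<longrightarrow>
           (\<forall>l>0. \<exists>p. grad H (l *\<^sub>R p) = l *\<^sub>R Q) \<and>
           (\<forall>P. (\<forall>l>0. grad H (l *\<^sub>R P l) = l *\<^sub>R Q) \<longrightarrow>
              ((\<lambda>l. Hd1 (l *\<^sub>R P l) - H (l *\<^sub>R P l)) \<longlongrightarrow> torus_integral V1) at_top \<and>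
              ((\<lambda>l. Hd2 (l *\<^sub>R P l) - H (l *\<^sub>R P l)) \<longlongrightarrow> torus_integral V2) at_top)) \<and>
        (Hd1 = Hd2 \<longrightarrow> torus_integral V1 = torus_integral V2))
   \<and> (\<forall>Hd1 Hd2.
        viscous_effective_hamiltonian d (\<lambda>p. (norm p)\<^sup>2) V1 Hd1 \<longrightarrow>
        viscous_effective_hamiltonian d (\<lambda>p. (norm p)\<^sup>2) V2 Hd2 \<longrightarrow>
        (\<exists>\<tau>>0. (\<lambda>k. ((cmod (fourier_coeff V1 k))\<^sup>2 + (cmod (fourier_coeff V2 k))\<^sup>2)
                    * exp (norm (lattice_vec k) powr (real CARD('n) + \<tau>))) summable_on UNIV) \<longrightarrow>
        Hd1 = Hd2 \<longrightarrow>
        torus_integral (\<lambda>x. \<bar>V1 x\<bar>\<^sup>2) = torus_integral (\<lambda>x. \<bar>V2 x\<bar>\<^sup>2))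
   \<and> (\<forall>Hd1 Hd2. CARD('n) = 1 \<longrightarrow>
        viscous_effective_hamiltonian d (\<lambda>p. (norm p)\<^sup>2) V1 Hd1 \<longrightarrow>
        viscous_effective_hamiltonian d (\<lambda>p. (norm p)\<^sup>2) V2 Hd2 \<longrightarrow>
        Hd1 = Hd2 \<longrightarrow>
        torus_integral V1 = torus_integral V2 \<and>
        torus_integral (\<lambda>x. \<bar>V1 x\<bar>\<^sup>2) = torus_integral (\<lambda>x. \<bar>V2 x\<bar>\<^sup>2))"
proof (intro conjI)
  let ?sq = "\<lambda>p :: real ^ 'n. (norm p)\<^sup>2"
  note d = assms(1) and V1 = assms(2) and V2 = assms(3)
  show "\<forall>H Hd1 Hd2.
        C_k 2 H \<longrightarrow> bdd_above (range (\<lambda>p. onorm (\<lambda>v. hessian H p *v v))) \<longrightarrow> superlinear H \<longrightarrow>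
        viscous_effective_hamiltonian d H V1 Hd1 \<longrightarrow>
        viscous_effective_hamiltonian d H V2 Hd2 \<longrightarrow>
        (\<forall>Q. diophantine Q \<longrightarrow>
           (\<forall>l>0. \<exists>p. grad H (l *\<^sub>R p) = l *\<^sub>R Q) \<and>
           (\<forall>P. (\<forall>l>0. grad H (l *\<^sub>R P l) = l *\<^sub>R Q) \<longrightarrow>
              ((\<lambda>l. Hd1 (l *\<^sub>R P l) - H (l *\<^sub>R P l)) \<longlongrightarrow> torus_integral V1) at_top \<and>
              ((\<lambda>l. Hd2 (l *\<^sub>R P l) - H (l *\<^sub>R P l)) \<longlongrightarrow> torus_integral V2) at_top)) \<and>
        (Hd1 = Hd2 \<longrightarrow> torus_integral V1 = torus_integral V2)"
  proof (intro allI impI)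
    fix H Hd1 Hd2 :: "real ^ 'n \<Rightarrow> real"
    assume H: "C_k 2 H" "bdd_above (range (\<lambda>p. onorm (\<lambda>v. hessian H p *v v)))" and sup: "superlinear H"
      and H1: "viscous_effective_hamiltonian d H V1 Hd1" and H2: "viscous_effective_hamiltonian d H V2 Hd2"
    have diff: "H differentiable (at x)" for x
      using H(1) by (simp add: numeral_2_eq_2)
    have solve: "\<exists>p. grad H (l *\<^sub>R p) = q" if "l > 0" for l q
    proof -
      obtain p where "grad H p = q"
        using superlinear_gradient_surjective[OF diff sup] by blast
      then have "grad H (l *\<^sub>R ((1 / l) *\<^sub>R p)) = q"
        using that by simp
      then show ?thesis by blast
    qed
    note lim = effective_hamiltonian_limit[OF d _ H]
    have dioph: "Q \<bullet> lattice_vec k \<noteq> 0" if Q: "diophantine Q" and k: "k \<noteq> 0" for Q :: "real ^ 'n" and k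
    proof -
      obtain C \<alpha> where "C > 0" "\<bar>Q \<bullet> lattice_vec k\<bar> \<ge> C / norm (lattice_vec k) powr \<alpha>"
        using Q k unfolding diophantine_def by blast
      moreover have "norm (lattice_vec k) powr \<alpha> > 0"
        using k by simp
      ultimately show ?thesis
        by (metis abs_zero divide_pos_pos not_le)
    qed
    have "torus_integral V1 = torus_integral V2" if eq: "Hd1 = Hd2"
    proof -
      \<comment> \<open>The implication brings no vector of its own: a nonresonant \<open>Q\<close>
        comes from the measure argument and \<open>P\<close> from choice. Equal Hamiltonians then
        give one function with both integrals as its limit.\<close>
      obtain Q :: "real ^ 'n" where Q: "\<And>k. k \<noteq> 0 \<Longrightarrow> Q \<bullet> lattice_vec k \<noteq> 0"
        using generic_direction by blast
      have "\<forall>l. \<exists>p. l > 0 \<longrightarrow> grad H (l *\<^sub>R p) = l *\<^sub>R Q"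
        using solve by blast
      from choice[OF this] obtain P where P: "\<And>l. l > 0 \<Longrightarrow> grad H (l *\<^sub>R P l) = l *\<^sub>R Q"
        by blast
      show ?thesis
        using tendsto_unique[OF _ lim[OF V1 H1 Q P] lim[OF V2 H2 Q P, folded eq]] by simp
    qed
    then show "(\<forall>Q. diophantine Q \<longrightarrow>
           (\<forall>l>0. \<exists>p. grad H (l *\<^sub>R p) = l *\<^sub>R Q) \<and>
           (\<forall>P. (\<forall>l>0. grad H (l *\<^sub>R P l) = l *\<^sub>R Q) \<longrightarrow>
              ((\<lambda>l. Hd1 (l *\<^sub>R P l) - H (l *\<^sub>R P l)) \<longlongrightarrow> torus_integral V1) at_top \<and>
              ((\<lambda>l. Hd2 (l *\<^sub>R P l) - H (l *\<^sub>R P l)) \<longlongrightarrow> torus_integral V2) at_top)) \<and>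
        (Hd1 = Hd2 \<longrightarrow> torus_integral V1 = torus_integral V2)"
      using solve lim[OF V1 H1 dioph] lim[OF V2 H2 dioph] by blast
  qed
  show "\<forall>Hd1 Hd2.
        viscous_effective_hamiltonian d ?sq V1 Hd1 \<longrightarrow>
        viscous_effective_hamiltonian d ?sq V2 Hd2 \<longrightarrow>
        (\<exists>\<tau>>0. (\<lambda>k. ((cmod (fourier_coeff V1 k))\<^sup>2 + (cmod (fourier_coeff V2 k))\<^sup>2)
                    * exp (norm (lattice_vec k) powr (real CARD('n) + \<tau>))) summable_on UNIV) \<longrightarrow>
        Hd1 = Hd2 \<longrightarrow>
        torus_integral (\<lambda>x. \<bar>V1 x\<bar>\<^sup>2) = torus_integral (\<lambda>x. \<bar>V2 x\<bar>\<^sup>2)"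
    using mean_and_L2_norm_determined(2)[OF d V1 V2] unfolding power2_abs by blast
  show "\<forall>Hd1 Hd2. CARD('n) = 1 \<longrightarrow>
        viscous_effective_hamiltonian d ?sq V1 Hd1 \<longrightarrow>
        viscous_effective_hamiltonian d ?sq V2 Hd2 \<longrightarrow>
        Hd1 = Hd2 \<longrightarrow>
        torus_integral V1 = torus_integral V2 \<and>
        torus_integral (\<lambda>x. \<bar>V1 x\<bar>\<^sup>2) = torus_integral (\<lambda>x. \<bar>V2 x\<bar>\<^sup>2)"
    using mean_and_L2_norm_determined[OF d V1 V2] unfolding power2_abs by blast
qed

end
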